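(* There is a constant $c$, independent of $d,D,l$, such that the following holds. Let $D\ge 3$, $d\ge 2$, $l\ge1$ be integers, and let $A$ be an $l\times l$ square block of sites in the $L\times L$ periodic lattice, with $L\to\infty$ (i.e. for all $L$ sufficiently large depending on $d,D,l$). Then the averaged purity of the reduced density matrix $\rho_A$ of the random tensor-network state with bond dimension $D$ and physical dimension $d$ satisfies $$\lambda_1 q_a^{|A|}+\lambda_2 q_p^{|\partial A|}\le \overline{\mathrm{Tr}(\rho_A^2)}\le c\,(1.91\,q_a)^{|A|}+c\,(2.9\,q_p)^{|\partial A|},$$ where $|A|=l^2$, $|\partial A|=4l$, $q_a=\frac{D^4d-d}{D^4d^2-1}$, $q_p=\frac{D^3d^2-D}{D^4d^2-1}$, $\lambda_1=(1+q_a^{-1}q_p^4/2)^{(l-1)^2/2}$ and $\lambda_2=0.7\,(1+q_aq_p^2/2)^{4l-1}$.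
   Context: Random tensor-network state: the sites are the elements $v=(x,y)$ of $\mathbb{Z}_L\times\mathbb{Z}_L$ (torus, coordinates modulo $L$). To each site attach an independent random unitary $U_v$ on $\mathbb{C}^D\otimes\mathbb{C}^D\otimes\mathbb{C}^d$, distributed according to Haar measure on $U(D^2d)$. Define the site tensor $A^{(v)}_{\alpha,\beta,\gamma,\lambda,j}=\langle\alpha,\beta,0|U_v|\gamma,\lambda,j\rangle$, where $\alpha,\beta,\gamma,\lambda\in\{1,\dots,D\}$ are bond indices, $j\in\{1,\dots,d\}$ is the physical index, and $|0\rangle$ is a fixed unit reference vector of $\mathbb{C}^d$. The index $\gamma$ of site $(x,y)$ is identified with the index $\alpha$ of site $(x,y+1)$, and the index $\lambda$ of site $(x,y)$ with the index $\beta$ of site $(x+1,y)$. The state $|\Psi\rangle\in(\mathbb{C}^d)^{\otimes L^2}$ is $|\Psi\rangle=\sum_{(j_v)}\left(\sum_{\text{bond indices}}\prod_v A^{(v)}\right)|(j_v)_v\rangle$; it is not normalized. The overline denotes expectation over the unitaries. $\rho_A=\mathrm{Tr}_{A^c}|\Psi\rangle\langle\Psi|$ is the reduced density matrix on the physical legs in $A$, without dividing by the norm, so $\mathrm{Tr}(\rho_A^2)=\mathrm{Tr}(X_A\,|\Psi\rangle\langle\Psi|\otimes|\Psi\rangle\langle\Psi|)$ with $X_A$ the swap of the two copies on region $A$. *)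

theory Defs
  imports "HOL-Probability.Probability_Measure" "Jordan_Normal_Form.Schur_Decomposition"
begin

no_notation vec_nth (infixl "$" 90)

definition unitary_group :: "nat \<Rightarrow> complex mat set" where
  "unitary_group n = {W \<in> carrier_mat n n. mat_adjoint W * W = 1\<^sub>m n}"

text \<open>A matrix is determined by its entries, so the \<open>\<sigma>\<close>-algebra generated by the entry
  map is the Borel \<open>\<sigma>\<close>-algebra of \<open>U(n)\<close> as a subspace of the \<open>n \<times> n\<close> complex matrices.\<close>

definition unitary_borel :: "nat \<Rightarrow> complex mat measure" where
  "unitary_borel n =
     vimage_algebra (unitary_group n) (\<lambda>W. \<lambda>p\<in>{..<n} \<times> {..<n}. W $$ p)
       (\<Pi>\<^sub>M p\<in>{..<n} \<times> {..<n}. borel)"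

text \<open>Haar probability measure on \<open>U(n)\<close>. As \<open>U(n)\<close> is compact, it is the unique invariant
  probability measure, and invariance holds on both sides.\<close>

definition haar_measure :: "nat \<Rightarrow> complex mat measure \<Rightarrow> bool" where
  "haar_measure n \<mu> \<longleftrightarrow> prob_space \<mu> \<and> sets \<mu> = sets (unitary_borel n) \<and>
     (\<forall>V\<in>unitary_group n. distr \<mu> \<mu> (\<lambda>W. V * W) = \<mu> \<and> distr \<mu> \<mu> (\<lambda>W. W * V) = \<mu>)"

text \<open>Position of the product basis vector \<open>|\<alpha>,\<beta>,j\<rangle>\<close> of
  \<open>\<complex>\<^sup>D \<otimes> \<complex>\<^sup>D \<otimes> \<complex>\<^sup>d\<close> in the lexicographic (Kronecker) order. All indices
  are counted from \<open>0\<close>.\<close>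

definition tensor_index :: "nat \<Rightarrow> nat \<Rightarrow> nat \<Rightarrow> nat \<Rightarrow> nat \<Rightarrow> nat" where
  "tensor_index D d \<alpha> \<beta> j = (\<alpha> * D + \<beta>) * d + j"

text \<open>The matrix element \<open>\<langle>\<alpha>,\<beta>,e| W |\<gamma>,\<lambda>,j\<rangle>\<close> for a reference vector \<open>e\<close> of
  \<open>\<complex>\<^sup>d\<close>; the bra is conjugate linear in \<open>e\<close>.\<close>

definition site_tensor ::
  "nat \<Rightarrow> nat \<Rightarrow> complex Matrix.vec \<Rightarrow> complex mat \<Rightarrow> nat \<Rightarrow> nat \<Rightarrow> nat \<Rightarrow> nat \<Rightarrow> nat \<Rightarrow> complex"
  where
  "site_tensor D d e W \<alpha> \<beta> \<gamma> l j =
     (\<Sum>k<d. cnj (e $ k) * W $$ (tensor_index D d \<alpha> \<beta> k, tensor_index D d \<gamma> l j))"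

type_synonym site = "nat \<times> nat"

definition sites :: "nat \<Rightarrow> site set" where
  "sites L = {..<L} \<times> {..<L}"

definition configs :: "site set \<Rightarrow> nat \<Rightarrow> (site \<Rightarrow> nat) set" where
  "configs R m = (\<Pi>\<^sub>E v\<in>R. {..<m})"

text \<open>The amplitude of \<open>|(j\<^sub>v)\<^sub>v\<rangle>\<close> in the tensor-network state. The bond variables
  \<open>a\<close> and \<open>b\<close> are the \<open>\<alpha>\<close> and \<open>\<beta>\<close> indices of the sites; the \<open>\<gamma>\<close> index of \<open>(x,y)\<close> is
  the \<open>\<alpha>\<close> index of \<open>(x,y+1)\<close>, and the \<open>\<lambda>\<close> index of \<open>(x,y)\<close> is the \<open>\<beta>\<close> index of
  \<open>(x+1,y)\<close>.\<close>

definition amplitude ::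
  "nat \<Rightarrow> nat \<Rightarrow> nat \<Rightarrow> complex Matrix.vec \<Rightarrow> (site \<Rightarrow> complex mat) \<Rightarrow> (site \<Rightarrow> nat) \<Rightarrow> complex"
  where
  "amplitude L D d e U j =
     (\<Sum>a\<in>configs (sites L) D. \<Sum>b\<in>configs (sites L) D. \<Prod>(x, y)\<in>sites L.
        site_tensor D d e (U (x, y)) (a (x, y)) (b (x, y))
          (a (x, (y + 1) mod L)) (b ((x + 1) mod L, y)) (j (x, y)))"

text \<open>Matrix elements of the unnormalized reduced density matrix on \<open>A\<close>; \<open>s\<close> and \<open>s'\<close> range
  over \<open>configs A d\<close>.\<close>

definition reduced_density ::
  "nat \<Rightarrow> nat \<Rightarrow> nat \<Rightarrow> complex Matrix.vec \<Rightarrow> (site \<Rightarrow> complex mat) \<Rightarrow> site set \<Rightarrow>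
     (site \<Rightarrow> nat) \<Rightarrow> (site \<Rightarrow> nat) \<Rightarrow> complex"
  where
  "reduced_density L D d e U A s s' =
     (\<Sum>t\<in>configs (sites L - A) d.
        amplitude L D d e U (merge A (sites L - A) (s, t)) *
        cnj (amplitude L D d e U (merge A (sites L - A) (s', t))))"

text \<open>The trace of the square is real because the reduced density matrix is Hermitian.\<close>

definition purity ::
  "nat \<Rightarrow> nat \<Rightarrow> nat \<Rightarrow> complex Matrix.vec \<Rightarrow> (site \<Rightarrow> complex mat) \<Rightarrow> site set \<Rightarrow> real"
  where
  "purity L D d e U A =
     Re (\<Sum>s\<in>configs A d. \<Sum>s'\<in>configs A d.
           reduced_density L D d e U A s s' * reduced_density L D d e U A s' s)"

definition average_purity ::
  "complex mat measure \<Rightarrow> nat \<Rightarrow> nat \<Rightarrow> nat \<Rightarrow> complex Matrix.vec \<Rightarrow> site set \<Rightarrow> real"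
  where
  "average_purity \<mu> L D d e A = (\<integral>U. purity L D d e U A \<partial>(\<Pi>\<^sub>M v\<in>sites L. \<mu>))"

definition block :: "nat \<Rightarrow> nat \<Rightarrow> site \<Rightarrow> site set" where
  "block L l v = (\<lambda>(x, y). ((fst v + x) mod L, (snd v + y) mod L)) ` ({..<l} \<times> {..<l})"

definition q_area :: "nat \<Rightarrow> nat \<Rightarrow> real" where
  "q_area D d = (real D ^ 4 * real d - real d) / (real D ^ 4 * real d ^ 2 - 1)"

definition q_perimeter :: "nat \<Rightarrow> nat \<Rightarrow> real" where
  "q_perimeter D d = (real D ^ 3 * real d ^ 2 - real D) / (real D ^ 4 * real d ^ 2 - 1)"

definition lambda1 :: "nat \<Rightarrow> nat \<Rightarrow> nat \<Rightarrow> real" where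
  "lambda1 D d l =
     (1 + inverse (q_area D d) * q_perimeter D d ^ 4 / 2) powr ((real l - 1)\<^sup>2 / 2)"

definition lambda2 :: "nat \<Rightarrow> nat \<Rightarrow> nat \<Rightarrow> real" where
  "lambda2 D d l = 0.7 * (1 + q_area D d * q_perimeter D d ^ 2 / 2) ^ (4 * l - 1)"

end

(* Averaging over the Haar measure replaces the two copies of each unitary and of its conjugate by
   a sum over pairs of permutations in S_2. Summing out the permutation on the output side of
   every site leaves an Ising-like model with nonnegative weights: a site whose right and upper
   neighbours carry the permutation imposed on its physical leg must carry it as well, so that
   the model is a directed, substochastic process off the block.

   Lower bound: two disjoint families of configurations. In one, the identity fills the plane and
   spins are flipped in every other column of the block (weight about q_a^|A|). In the other, the
   swap fills the block and the domain wall around it is deformed (weight about q_p^|dA|). Both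
   families have supermultiplicative weights in the flipped sites.

   Upper bound: with a = 1.91 q_a and b = 2.9 q_p, an isoperimetric interpolation shows that
   max(a^|A|, b^|dA|) dominates a^(unflipped sites) * b^(domain wall), and dividing the local
   weights by these factors leaves a substochastic process, whose sum is at most 1.
   Configurations that wind around the torus are exponentially small in L. *)
theory Submission
  imports Defs "HOL-Real_Asymp.Real_Asymp"
begin

text \<open>The weight of a spin refers only to its right and upper neighbours, so spins could be
  summed out in order if the torus were not cyclic; this is the obstacle. Prescribing the spins on
  one row and one column, a cross, cuts the torus open, at the price of a sum over up to 4^L
  boundary conditions. If the cross just past the block carries the identity, there is only one of
  them, and this case yields the main terms. Otherwise the swap propagates right or up and fills at
  least \<open>L - l - 1\<close> sites outside of the block. The resulting factor (3/5)^(L-l-1) does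
  not beat 4^L, so the cross is chosen depending on the configuration, where few spins carry the
  swap.

  \<open>D \<ge> 3\<close> and \<open>d \<ge> 2\<close> give q_p \<le> 1/3 and q_a \<le> 1/2. Hence
  2.9 q_p and 1.91 q_a are below 1, as the isoperimetric interpolation requires; the local
  inequalities only need these multiples to be large enough, and leave room. The other two local
  weights are within factors 0.9 and 0.75 of q_a q_p and q_p^2; these losses become the 1/2 in
  \<open>lambda1\<close> and \<open>lambda2\<close> and the 0.7 in \<open>lambda2\<close>.\<close>

section \<open>Sums over subsets\<close>

lemma sum_Pow_insert:
  assumes "finite F" "x \<notin> F"
  shows "(\<Sum>Y\<in>Pow (insert x F). f Y) = (\<Sum>Y\<in>Pow F. f Y + f (insert x Y) :: real)"
proof -
  have inj: "inj_on (insert x) (Pow F)"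
    using assms(2) by (auto simp: inj_on_def)
  have "(\<Sum>Y\<in>Pow (insert x F). f Y) = (\<Sum>Y\<in>Pow F. f Y) + (\<Sum>Y\<in>insert x ` Pow F. f Y)"
    unfolding Pow_insert using assms by (intro sum.union_disjoint) auto
  also have "(\<Sum>Y\<in>insert x ` Pow F. f Y) = (\<Sum>Y\<in>Pow F. f (insert x Y))"
    by (simp add: sum.reindex[OF inj])
  finally show ?thesis by (simp add: sum.distrib)
qed

lemma sum_Pow_Un:
  assumes "finite F" "finite C" "F \<inter> C = {}"
  shows "(\<Sum>X\<in>Pow (F \<union> C). f X) = (\<Sum>B\<in>Pow C. \<Sum>Y\<in>Pow F. f (Y \<union> B) :: real)"
  using assms(2,3)
proof (induction C arbitrary: f rule: finite_induct)
  case (insert c C)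
  have "(\<Sum>X\<in>Pow (F \<union> insert c C). f X) = (\<Sum>X\<in>Pow (F \<union> C). f X + f (insert c X))"
    using insert assms(1) sum_Pow_insert[of "F \<union> C" c f] by simp
  also have "\<dots> = (\<Sum>B\<in>Pow C. \<Sum>Y\<in>Pow F. f (Y \<union> B) + f (insert c (Y \<union> B)))"
    using insert by (intro insert.IH) auto
  also have "\<dots> = (\<Sum>B\<in>Pow (insert c C). \<Sum>Y\<in>Pow F. f (Y \<union> B))"
    using insert by (simp add: sum_Pow_insert sum.distrib)
  finally show ?case .
qed simp

lemma sum_Pow_power_card:
  assumes "finite C"
  shows "(\<Sum>B\<in>Pow C. t ^ card B) = (1 + t :: real) ^ card C"
  using assms
proof (induction C rule: finite_induct)
  case (insert c C)
  have "(\<Sum>B\<in>Pow C. t ^ card B + t ^ card (insert c B)) = (\<Sum>B\<in>Pow C. (1 + t) * t ^ card B)"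
    using insert by (intro sum.cong refl)
      (auto simp: card_insert_if finite_subset algebra_simps)
  then show ?case using insert by (simp add: sum_Pow_insert sum_distrib_left [symmetric])
qed simp

lemma prod_power_of_bool:
  assumes "finite S"
  shows "(\<Prod>v\<in>S. t ^ of_bool (P v)) = (t :: real) ^ card {v\<in>S. P v}"
proof -
  have "card {v\<in>S. P v} = (\<Sum>v\<in>S. of_bool (P v))"
    using assms by (simp add: of_bool_def sum.If_cases Int_def)
  then show ?thesis by (simp add: power_sum)
qed

section \<open>Substochastic weights on the torus\<close>

text \<open>\<open>rt\<close> and \<open>up\<close> lead to the sites that share the indices
  \<lambda> and \<gamma> of \<open>v\<close>. Interactions are directed: the weight of a site
  involves these two neighbours and never the left or lower one.\<close>

definition rt :: "nat \<Rightarrow> site \<Rightarrow> site" where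
  "rt L v = ((fst v + 1) mod L, snd v)"

definition up :: "nat \<Rightarrow> site \<Rightarrow> site" where
  "up L v = (fst v, (snd v + 1) mod L)"

lemma finite_sites [simp]: "finite (sites L)"
  by (simp add: sites_def)

lemma rt_in [simp]: "v \<in> sites L \<Longrightarrow> rt L v \<in> sites L"
  and up_in [simp]: "v \<in> sites L \<Longrightarrow> up L v \<in> sites L"
  by (auto simp: sites_def rt_def up_def)

lemma bij_Suc_mod: "bij_betw (\<lambda>x. (x + 1) mod L) {..<L} {..<L::nat}"
proof -
  have "inj_on (\<lambda>x. (x + 1) mod L) {..<L}"
  proof (rule inj_onI)
    fix x y assume "x \<in> {..<L}" "y \<in> {..<L}" "(x + 1) mod L = (y + 1) mod L"
    then show "x = y"
      by (cases "x + 1 = L"; cases "y + 1 = L") auto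
  qed
  moreover have "(\<lambda>x. (x + 1) mod L) ` {..<L} \<subseteq> {..<L}"
    by auto
  ultimately show ?thesis
    using endo_inj_surj[of "{..<L}"] by (auto simp: bij_betw_def)
qed

lemma bij_rt: "bij_betw (rt L) (sites L) (sites L)"
proof -
  have "bij_betw (map_prod (\<lambda>x. (x + 1) mod L) id) ({..<L} \<times> {..<L}) ({..<L} \<times> {..<L})"
    by (intro bij_betw_map_prod bij_Suc_mod bij_betw_id)
  moreover have "rt L = map_prod (\<lambda>x. (x + 1) mod L) id"
    by (auto simp: rt_def)
  ultimately show ?thesis by (simp add: sites_def)
qed

lemma bij_up: "bij_betw (up L) (sites L) (sites L)"
proof -
  have "bij_betw (map_prod id (\<lambda>x. (x + 1) mod L)) ({..<L} \<times> {..<L}) ({..<L} \<times> {..<L})"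
    by (intro bij_betw_map_prod bij_Suc_mod bij_betw_id)
  moreover have "up L = map_prod id (\<lambda>x. (x + 1) mod L)"
    by (auto simp: up_def)
  ultimately show ?thesis by (simp add: sites_def)
qed

text \<open>The neighbour maps permute the torus. This lets factors charged to a neighbour be moved
  to the site itself, so that products of coboundary form cancel.\<close>

lemma card_rt: "card {v\<in>sites L. rt L v \<in> X} = card {v\<in>sites L. v \<in> X}"
proof (rule bij_betw_same_card[where f = "rt L"])
  have "{v\<in>rt L ` sites L. v \<in> X} = rt L ` {v\<in>sites L. rt L v \<in> X}"
    by auto
  then have "{v\<in>sites L. v \<in> X} = rt L ` {v\<in>sites L. rt L v \<in> X}"
    using bij_rt[of L] by (simp add: bij_betw_def)
  then show "bij_betw (rt L) {v\<in>sites L. rt L v \<in> X} {v\<in>sites L. v \<in> X}"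
    using bij_rt[of L] by (auto simp: bij_betw_def intro: inj_on_subset)
qed

lemma card_up: "card {v\<in>sites L. up L v \<in> X} = card {v\<in>sites L. v \<in> X}"
proof (rule bij_betw_same_card[where f = "up L"])
  have "{v\<in>up L ` sites L. v \<in> X} = up L ` {v\<in>sites L. up L v \<in> X}"
    by auto
  then have "{v\<in>sites L. v \<in> X} = up L ` {v\<in>sites L. up L v \<in> X}"
    using bij_up[of L] by (simp add: bij_betw_def)
  then show "bij_betw (up L) {v\<in>sites L. up L v \<in> X} {v\<in>sites L. v \<in> X}"
    using bij_up[of L] by (auto simp: bij_betw_def intro: inj_on_subset)
qed

text \<open>Neighbours in \<open>F\<close> have smaller rank, so no site looks at the one of largest
  rank. Its spin enters only its own weight, and summing it out costs a factor of at most 1.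
  \<open>B\<close> collects the fixed boundary spins that are on.\<close>

lemma sum_substochastic_le_1:
  fixes \<omega> :: "'a \<Rightarrow> bool \<Rightarrow> bool \<Rightarrow> bool \<Rightarrow> real" and rk :: "'a \<Rightarrow> nat"
  assumes "finite F"
    and "\<And>v. v \<in> F \<Longrightarrow> f v \<in> F \<Longrightarrow> rk (f v) < rk v"
    and "\<And>v. v \<in> F \<Longrightarrow> g v \<in> F \<Longrightarrow> rk (g v) < rk v"
    and "\<And>v x a b. v \<in> F \<Longrightarrow> \<omega> v x a b \<ge> 0"
    and "\<And>v a b. v \<in> F \<Longrightarrow> \<omega> v True a b + \<omega> v False a b \<le> 1"
  shows "(\<Sum>Y\<in>Pow F. \<Prod>v\<in>F. \<omega> v (v \<in> Y) (f v \<in> Y \<union> B) (g v \<in> Y \<union> B)) \<le> 1"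
  using assms
proof (induction F rule: finite_ranking_induct[where f = rk])
  case (insert w F)
  have new: "f v \<noteq> w" "g v \<noteq> w" if "v \<in> insert w F" for v
    using insert.prems(1,2)[of v] insert.hyps(2) that by (fastforce)+
  show ?case
  proof (cases "w \<in> F")
    case True
    then show ?thesis using insert by (simp add: insert_absorb)
  next
    case False
    define P where "P Y = (\<Prod>v\<in>F. \<omega> v (v \<in> Y) (f v \<in> Y \<union> B) (g v \<in> Y \<union> B))" for Y
    have P_insert: "P (insert w Y) = P Y" for Y
      unfolding P_def
    proof (intro prod.cong refl)
      fix v assume "v \<in> F"
      then have "v \<noteq> w" "f v \<noteq> w" "g v \<noteq> w" using False new by auto
      then show "\<omega> v (v \<in> insert w Y) (f v \<in> insert w Y \<union> B) (g v \<in> insert w Y \<union> B) =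
          \<omega> v (v \<in> Y) (f v \<in> Y \<union> B) (g v \<in> Y \<union> B)"
        by simp
    qed
    have "(\<Sum>Y\<in>Pow (insert w F). \<Prod>v\<in>insert w F. \<omega> v (v \<in> Y) (f v \<in> Y \<union> B) (g v \<in> Y \<union> B)) =
      (\<Sum>Y\<in>Pow (insert w F). \<omega> w (w \<in> Y) (f w \<in> Y \<union> B) (g w \<in> Y \<union> B) * P Y)"
      using False insert.hyps(1) by (simp add: P_def)
    also have "\<dots> = (\<Sum>Y\<in>Pow F. (\<omega> w True (f w \<in> Y \<union> B) (g w \<in> Y \<union> B) +
        \<omega> w False (f w \<in> Y \<union> B) (g w \<in> Y \<union> B)) * P Y)"
      unfolding sum_Pow_insert[OF insert.hyps(1) False]
    proof (intro sum.cong refl)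
      fix Y assume "Y \<in> Pow F"
      then have "w \<notin> Y" using False by auto
      moreover have "f w \<noteq> w" "g w \<noteq> w" using new by auto
      ultimately show "\<omega> w (w \<in> Y) (f w \<in> Y \<union> B) (g w \<in> Y \<union> B) * P Y +
        \<omega> w (w \<in> insert w Y) (f w \<in> insert w Y \<union> B) (g w \<in> insert w Y \<union> B) * P (insert w Y) =
        (\<omega> w True (f w \<in> Y \<union> B) (g w \<in> Y \<union> B) +
        \<omega> w False (f w \<in> Y \<union> B) (g w \<in> Y \<union> B)) * P Y"
        by (simp add: P_insert algebra_simps)
    qed
    also have "\<dots> \<le> (\<Sum>Y\<in>Pow F. 1 * P Y)"
      using insert.prems unfolding P_def
      by (intro sum_mono mult_right_mono prod_nonneg) auto
    also have "\<dots> \<le> 1"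
      using insert.IH insert.prems unfolding P_def by simp
    finally show ?thesis .
  qed
qed simp

section \<open>Cutting the torus open along a cross\<close>

definition cross :: "nat \<Rightarrow> nat \<Rightarrow> nat \<Rightarrow> site set" where
  "cross L x0 y0 = {v\<in>sites L. fst v = x0 \<or> snd v = y0}"

lemma cross_subset: "cross L x0 y0 \<subseteq> sites L"
  by (auto simp: cross_def)

lemma finite_cross [simp]: "finite (cross L x0 y0)"
  using cross_subset finite_sites by (rule finite_subset)

lemma card_cross_le: "card (cross L x0 y0) \<le> 2 * L"
proof -
  have "cross L x0 y0 \<subseteq> {x0} \<times> {..<L} \<union> {..<L} \<times> {y0}"
    by (auto simp: cross_def sites_def)
  then have "card (cross L x0 y0) \<le> card ({x0} \<times> {..<L} \<union> {..<L} \<times> {y0})"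
    by (intro card_mono) auto
  also have "\<dots> \<le> 2 * L"
    by (rule order_trans[OF card_Un_le]) (simp add: card_cartesian_product)
  finally show ?thesis .
qed

text \<open>Once the spins on a row and a column are fixed, the remaining ones can be summed out
  one at a time, starting with those that no other site looks at.\<close>

lemma torus_sum_le:
  fixes \<omega> :: "site \<Rightarrow> bool \<Rightarrow> bool \<Rightarrow> bool \<Rightarrow> real"
  assumes nonneg: "\<And>v x a b. v \<in> sites L \<Longrightarrow> \<omega> v x a b \<ge> 0"
    and le1: "\<And>v a b. v \<in> sites L \<Longrightarrow> \<omega> v True a b + \<omega> v False a b \<le> 1"
    and g: "\<And>B. g B \<ge> 0" and x0: "x0 < L" "y0 < L"
  shows "(\<Sum>X\<in>Pow (sites L). g (X \<inter> cross L x0 y0) *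
            (\<Prod>v\<in>sites L. \<omega> v (v \<in> X) (rt L v \<in> X) (up L v \<in> X)))
         \<le> (\<Sum>B\<in>Pow (cross L x0 y0). g B)"
proof -
  define C where "C = cross L x0 y0"
  define F where "F = sites L - C"
  have S: "sites L = F \<union> C" and disj: "F \<inter> C = {}" and fin: "finite F" "finite C"
    using cross_subset[of L x0 y0] by (auto simp: F_def C_def)
  have ub: "\<omega> v x a b \<le> 1" if "v \<in> sites L" for v x a b
    using le1[OF that, of a b] nonneg[OF that, of True a b] nonneg[OF that, of False a b]
    by (cases x) auto
  \<comment> \<open>The number of steps to the right until column \<open>x0\<close> plus the number
    of steps up until row \<open>y0\<close>, both counted cyclically. Off the cross, each move to a
    neighbour lowers it by one.\<close>
  define rk where "rk = (\<lambda>(x, y). (if x \<le> x0 then x0 - x else x0 + L - x) +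
                            (if y \<le> y0 then y0 - y else y0 + L - y))"
  have rank: "rk (rt L v) < rk v" "rk (up L v) < rk v" if "v \<in> F" for v
  proof -
    obtain x y where v: "v = (x, y)" by force
    have *: "x < L" "y < L" "x \<noteq> x0" "y \<noteq> y0"
      using that by (auto simp: v F_def C_def cross_def sites_def)
    have "(x + 1) mod L = (if x + 1 = L then 0 else x + 1)"
         "(y + 1) mod L = (if y + 1 = L then 0 else y + 1)"
      using * by auto
    then show "rk (rt L v) < rk v" "rk (up L v) < rk v"
      using * x0 by (auto simp: v rk_def rt_def up_def)
  qed
  have inner: "(\<Sum>Y\<in>Pow F. \<Prod>v\<in>F. \<omega> v (v \<in> Y) (rt L v \<in> Y \<union> B) (up L v \<in> Y \<union> B)) \<le> 1" for B
    using fin rank nonneg le1 by (intro sum_substochastic_le_1[where rk = rk]) (auto simp: S)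
  have "(\<Sum>X\<in>Pow (sites L). g (X \<inter> C) *
            (\<Prod>v\<in>sites L. \<omega> v (v \<in> X) (rt L v \<in> X) (up L v \<in> X))) =
        (\<Sum>B\<in>Pow C. \<Sum>Y\<in>Pow F. g ((Y \<union> B) \<inter> C) * (\<Prod>v\<in>sites L. \<omega> v (v \<in> Y \<union> B) (rt L v \<in> Y \<union> B) (up L v \<in> Y \<union> B)))"
    unfolding S using fin disj by (intro sum_Pow_Un)
  also have "\<dots> \<le> (\<Sum>B\<in>Pow C. g B * (\<Sum>Y\<in>Pow F. \<Prod>v\<in>F. \<omega> v (v \<in> Y) (rt L v \<in> Y \<union> B) (up L v \<in> Y \<union> B)))"
    unfolding sum_distrib_left
  proof (intro sum_mono)
    fix B Y assume B: "B \<in> Pow C" and Y: "Y \<in> Pow F"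
    let ?\<omega> = "\<lambda>v. \<omega> v (v \<in> Y \<union> B) (rt L v \<in> Y \<union> B) (up L v \<in> Y \<union> B)"
    have "(Y \<union> B) \<inter> C = B" using B Y disj by auto
    have "(\<Prod>v\<in>sites L. ?\<omega> v) = (\<Prod>v\<in>F. ?\<omega> v) * (\<Prod>v\<in>C. ?\<omega> v)"
      unfolding S using fin disj by (intro prod.union_disjoint)
    \<comment> \<open>The weights on the cross itself are discarded; each is one of two nonnegative
      numbers with sum at most 1.\<close>
    also have "\<dots> \<le> (\<Prod>v\<in>F. ?\<omega> v)"
      using ub nonneg by (intro mult_left_le prod_le_1 prod_nonneg) (auto simp: S)
    also have "(\<Prod>v\<in>F. ?\<omega> v) = (\<Prod>v\<in>F. \<omega> v (v \<in> Y) (rt L v \<in> Y \<union> B) (up L v \<in> Y \<union> B))"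
    proof (intro prod.cong refl)
      fix v assume "v \<in> F"
      then have "v \<notin> B" using B disj by auto
      then show "?\<omega> v = \<omega> v (v \<in> Y) (rt L v \<in> Y \<union> B) (up L v \<in> Y \<union> B)" by simp
    qed
    finally show "g ((Y \<union> B) \<inter> C) * (\<Prod>v\<in>sites L. ?\<omega> v)
       \<le> g B * (\<Prod>v\<in>F. \<omega> v (v \<in> Y) (rt L v \<in> Y \<union> B) (up L v \<in> Y \<union> B))"
      using g[of B] \<open>(Y \<union> B) \<inter> C = B\<close> by (simp only:) (rule mult_left_mono)
  qed
  also have "\<dots> \<le> (\<Sum>B\<in>Pow C. g B * 1)"
    using inner g by (intro sum_mono mult_left_mono)
  finally show ?thesis by (simp add: C_def)
qed

lemma prod_if_mem: "finite S \<Longrightarrow> (\<Prod>v\<in>S. if v \<in> P then c else 1) = (c :: real) ^ card (S \<inter> P)"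
  by (simp add: prod.If_cases)

section \<open>The spin model\<close>

text \<open>A configuration is the set of sites that carry the swap. The arguments of the local weight
  record whether the spin of a site, of its right neighbour and of its upper neighbour agrees
  with the permutation imposed on the physical leg of the site (the swap precisely on the
  region).\<close>

definition agree_weight ::
  "real \<Rightarrow> real \<Rightarrow> real \<Rightarrow> real \<Rightarrow> bool \<Rightarrow> bool \<Rightarrow> bool \<Rightarrow> real" where
  "agree_weight q p r s x a b =
     (if a \<and> b then of_bool x else if \<not> a \<and> \<not> b then (if x then s else q)
      else if x then p else r)"

definition config_weight ::
  "real \<Rightarrow> real \<Rightarrow> real \<Rightarrow> real \<Rightarrow> nat \<Rightarrow> site set \<Rightarrow> site set \<Rightarrow> real" where
  "config_weight q p r s L A X =
     (\<Prod>v\<in>sites L. agree_weight q p r s ((v \<in> X) = (v \<in> A)) ((rt L v \<in> X) = (v \<in> A))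
        ((up L v \<in> X) = (v \<in> A)))"

definition partition_function ::
  "real \<Rightarrow> real \<Rightarrow> real \<Rightarrow> real \<Rightarrow> nat \<Rightarrow> site set \<Rightarrow> real" where
  "partition_function q p r s L A = (\<Sum>X\<in>Pow (sites L). config_weight q p r s L A X)"

text \<open>The reference position of the block. With \<open>L = m + l + 1\<close> no site of it has
  a neighbour across the seam of the torus, and row and column \<open>L - 1\<close> are the ones
  directly above and to the right of it.\<close>

definition square :: "nat \<Rightarrow> nat \<Rightarrow> site set" where
  "square m l = {m..<m + l} \<times> {m..<m + l}"

lemma finite_square [simp]: "finite (square m l)"
  by (simp add: square_def)

lemma card_square: "card (square m l) = l ^ 2"
  by (simp add: square_def power2_eq_square)

lemma square_subset: "square m l \<subseteq> sites (m + l + 1)"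
  by (auto simp: square_def sites_def)

text \<open>\<open>q\<close> is the cost of a site whose leg disagrees with all three spins,
  \<open>p\<close> that of a piece of domain wall. A kink \<open>r\<close> costs about one of each,
  and an island \<open>s\<close> about two pieces of wall. The bounds on the spin model use nothing
  else about the four numbers.\<close>

locale spin_weights =
  fixes q p r s :: real
  assumes p: "0 < p" "p \<le> 1 / 3" and q: "0 < q" "q \<le> 1 / 2"
    and r: "0.9 * (p * q) \<le> r" "r \<le> p * q"
    and s: "0.75 * p\<^sup>2 \<le> s" "s \<le> p\<^sup>2"
begin

abbreviation "wt \<equiv> agree_weight q p r s"
abbreviation "cw \<equiv> config_weight q p r s"
abbreviation "Z \<equiv> partition_function q p r s"

lemma r_pos: "0 < r" and s_pos: "0 < s"
proof -
  have "0 < 0.9 * (p * q)" "0 < 0.75 * p\<^sup>2" using p q by auto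
  then show "0 < r" "0 < s"
    using order.strict_trans2[OF _ r(1)] order.strict_trans2[OF _ s(1)] by blast+
qed

lemmas pos = p(1) q(1) r_pos s_pos

lemma r_le: "r \<le> p / 2" and s_le: "s \<le> p / 3"
proof -
  have "p * q \<le> p * (1/2)" using p q by (intro mult_left_mono) auto
  then show "r \<le> p / 2" using r by simp
  have "p * p \<le> p * (1/3)" using p by (intro mult_left_mono) auto
  then show "s \<le> p / 3" using s by (simp add: power2_eq_square)
qed

lemma wt_nonneg: "0 \<le> wt x a b"
  using pos by (auto simp: agree_weight_def)

lemma cw_nonneg: "0 \<le> cw L A X"
  unfolding config_weight_def by (intro prod_nonneg ballI wt_nonneg)

subsection \<open>Lower bound\<close>

text \<open>Each flipped site is charged \<open>\<rho>\<close> at itself and \<open>\<tau>\<close>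
  at its left and at its lower neighbour, hence \<open>\<rho> * \<tau>\<^sup>2\<close> in total.
  This reduces a bound that is multiplicative in the flips to a check at a single site.\<close>

lemma config_weight_ge:
  assumes T: "T \<subseteq> sites L"
    and \<rho>: "0 \<le> \<rho>" and \<tau>: "0 \<le> \<tau>" and base: "\<And>v. v \<in> sites L \<Longrightarrow> 0 \<le> base v"
    and le: "\<And>v. v \<in> sites L \<Longrightarrow>
        base v * (\<rho> ^ of_bool (v \<in> T) * (\<tau> ^ of_bool (rt L v \<in> T) * \<tau> ^ of_bool (up L v \<in> T)))
        \<le> wt ((v \<in> X) = (v \<in> A)) ((rt L v \<in> X) = (v \<in> A)) ((up L v \<in> X) = (v \<in> A))"
  shows "(\<Prod>v\<in>sites L. base v) * (\<rho> * \<tau>\<^sup>2) ^ card T \<le> cw L A X"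
proof -
  have "{v\<in>sites L. v \<in> T} = T" using T by auto
  then have "(\<Prod>v\<in>sites L. base v) * (\<rho> * \<tau>\<^sup>2) ^ card T = (\<Prod>v\<in>sites L.
      base v * (\<rho> ^ of_bool (v \<in> T) * (\<tau> ^ of_bool (rt L v \<in> T) * \<tau> ^ of_bool (up L v \<in> T))))"
    by (simp add: prod.distrib prod_power_of_bool card_rt card_up power_mult_distrib
        power2_eq_square)
  also have "\<dots> \<le> cw L A X"
    unfolding config_weight_def using le \<rho> \<tau> base by (intro prod_mono) auto
  finally show ?thesis .
qed

section \<open>Flips inside the block: the area term\<close>

text \<open>In the all-identity background of the block, an unflipped site whose right and upper
  neighbours are both flipped has weight 0. Using every other column excludes this pattern and still
  keeps about half of the block, whence the exponent in \<open>lambda1\<close>.\<close>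

definition odd_columns :: "nat \<Rightarrow> nat \<Rightarrow> site set" where
  "odd_columns m l = {v\<in>square m l. odd (fst v - m)}"

lemma card_odd_columns: "card (odd_columns m l) = (l div 2) * l"
proof -
  have "odd_columns m l = (\<lambda>i. m + 2 * i + 1) ` {..<l div 2} \<times> {m..<m + l}"
  proof (intro equalityI subsetI)
    fix v assume "v \<in> odd_columns m l"
    then have v: "m \<le> fst v" "fst v < m + l" "snd v \<in> {m..<m + l}" "odd (fst v - m)"
      by (auto simp: odd_columns_def square_def)
    from v(4) obtain i where i: "fst v - m = 2 * i + 1" by (elim oddE)
    then have "fst v = m + 2 * i + 1" "i < l div 2" using v by linarith+
    then show "v \<in> (\<lambda>i. m + 2 * i + 1) ` {..<l div 2} \<times> {m..<m + l}"
      using v(3) by (cases v) auto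
  qed (auto simp: odd_columns_def square_def)
  moreover have "inj_on (\<lambda>i. m + 2 * i + 1) {..<l div 2}"
    by (auto simp: inj_on_def)
  ultimately show ?thesis by (simp add: card_cartesian_product card_image)
qed

text \<open>An isolated flip turns its own \<open>q\<close> into \<open>s\<close> and the
  \<open>q\<close> of its left and lower neighbours into \<open>r\<close>. Vertically adjacent
  flips, and neighbours outside of the block, produce \<open>p\<close> instead, which exceeds what
  is charged.\<close>

lemma area_weight_ge:
  assumes T: "T \<subseteq> odd_columns m l" and L: "L = m + l + 1" and m: "1 \<le> m"
  shows "q ^ (l\<^sup>2) * (s * r\<^sup>2 / q ^ 3) ^ card T \<le> cw L (square m l) T"
proof -
  let ?A = "square m l"
  have TA: "T \<subseteq> ?A" using T by (auto simp: odd_columns_def)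
  have AS: "?A \<subseteq> sites L" using square_subset L by simp
  have rq: "r / q \<le> p" using r q by (simp add: field_simps)
  have rq2: "s * (r / q) \<le> p"
  proof -
    have "s * (r / q) \<le> 1 * p"
      using rq pos p s_le by (intro mult_mono) auto
    then show ?thesis by simp
  qed
  have "(\<Prod>v\<in>sites L. if v \<in> ?A then q else 1) * (s / q * (r / q)\<^sup>2) ^ card T \<le> cw L ?A T"
  proof (rule config_weight_ge)
    fix v assume v: "v \<in> sites L"
    obtain x y where xy: "v = (x, y)" by force
    have lt: "x < L" "y < L" using v by (auto simp: xy sites_def)
    have notboth: "\<not> (rt L v \<in> T \<and> up L v \<in> T)"
    proof
      assume "rt L v \<in> T \<and> up L v \<in> T"
      then have *: "odd ((x + 1) mod L - m)" "odd (x - m)" "m \<le> x" "m \<le> (x + 1) mod L"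
        using T by (auto simp: xy rt_def up_def odd_columns_def square_def)
      moreover have "(x + 1) mod L = x + 1"
        using * m L lt by (cases "x + 1 = L") auto
      ultimately have "x + 1 - m = Suc (x - m)" by auto
      with * \<open>(x + 1) mod L = x + 1\<close> show False by simp
    qed
    show "(if v \<in> ?A then q else 1) * ((s / q) ^ of_bool (v \<in> T) *
          ((r / q) ^ of_bool (rt L v \<in> T) * (r / q) ^ of_bool (up L v \<in> T)))
        \<le> wt ((v \<in> T) = (v \<in> ?A)) ((rt L v \<in> T) = (v \<in> ?A)) ((up L v \<in> T) = (v \<in> ?A))"
      using notboth TA pos rq rq2
      by (cases "v \<in> ?A"; cases "v \<in> T"; cases "rt L v \<in> T"; cases "up L v \<in> T")
        (auto simp: agree_weight_def)
  qed (use TA AS pos in auto)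
  moreover have "(\<Prod>v\<in>sites L. if v \<in> ?A then q else 1) = q ^ (l\<^sup>2)"
    using AS by (simp add: prod.If_cases Int_absorb1 card_square)
  moreover have "s / q * (r / q)\<^sup>2 = s * r\<^sup>2 / q ^ 3"
    using q by (simp add: field_simps power2_eq_square power3_eq_cube)
  ultimately show ?thesis by simp
qed

section \<open>Deformations of the domain wall: the perimeter term\<close>

text \<open>Sites where the domain wall around the block can be deformed independently. Three corners of the
  block are left out: the flip of one has weight \<open>0\<close>, and the flips of the other two interact
  with those of sites outside of the block.\<close>

definition rim :: "nat \<Rightarrow> nat \<Rightarrow> site set" where
  "rim m l = ({m - 1} \<times> {m..<m + l} \<union> {m..<m + l} \<times> {m - 1}) \<union>
     ({m + 1..<m + l} \<times> {m + l - 1} \<union> {m + l - 1} \<times> {m + 1..<m + l - 1})"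

lemma card_rim:
  assumes "1 \<le> m"
  shows "4 * l - 3 \<le> card (rim m l)"
proof -
  have "card (rim m l) = (l + l) + ((l - 1) + (l - 2))"
    unfolding rim_def using assms
    by (subst card_Un_disjoint; (subst card_Un_disjoint)?; (subst card_Un_disjoint)?)
      (auto simp: card_cartesian_product)
  then show ?thesis by simp
qed

text \<open>The local weights of the undeformed configuration, in which exactly the block carries
  the swap: \<open>p\<close> where one of the two outgoing bonds crosses the wall, and
  \<open>s\<close> at the upper right corner of the block, where both do.\<close>

definition rim_base :: "nat \<Rightarrow> nat \<Rightarrow> site \<Rightarrow> real" where
  "rim_base m l v = (if v = (m + l - 1, m + l - 1) then s
     else if v \<in> ({m - 1} \<times> {m..<m + l} \<union> {m..<m + l} \<times> {m - 1}) \<union>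
        ({m..<m + l - 1} \<times> {m + l - 1} \<union> {m + l - 1} \<times> {m..<m + l - 1}) then p else 1)"

text \<open>Since \<open>s\<close> is about \<open>p\<^sup>2\<close>, this is about
  \<open>p ^ (4 * l)\<close>; the corner is the only place where a constant factor is lost.\<close>

lemma prod_rim_base:
  assumes "1 \<le> m" "1 \<le> l" "L = m + l + 1"
  shows "(\<Prod>v\<in>sites L. rim_base m l v) = s * p ^ (4 * l - 2)"
proof -
  let ?P = "({m - 1} \<times> {m..<m + l} \<union> {m..<m + l} \<times> {m - 1}) \<union>
        ({m..<m + l - 1} \<times> {m + l - 1} \<union> {m + l - 1} \<times> {m..<m + l - 1})"
  let ?c = "(m + l - 1, m + l - 1)"
  have card: "card ?P = (l + l) + ((l - 1) + (l - 1))"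
    using assms
    by (subst card_Un_disjoint; (subst card_Un_disjoint)?; (subst card_Un_disjoint)?)
      (auto simp: card_cartesian_product)
  have c: "?c \<in> sites L" and notin: "?c \<notin> ?P"
    using assms by (auto simp: sites_def)
  have "?P \<subseteq> sites L" using assms by (auto simp: sites_def)
  then have P: "(sites L - {?c}) \<inter> ?P = ?P"
    using notin by blast
  have "(\<Prod>v\<in>sites L. rim_base m l v) = s * (\<Prod>v\<in>sites L - {?c}. rim_base m l v)"
    using c by (subst prod.remove[of _ ?c]) (auto simp: rim_base_def)
  also have "(\<Prod>v\<in>sites L - {?c}. rim_base m l v) = (\<Prod>v\<in>sites L - {?c}. if v \<in> ?P then p else 1)"
    by (intro prod.cong refl) (auto simp: rim_base_def)
  also have "\<dots> = p ^ card ?P"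
    by (simp only: prod_if_mem finite_Diff finite_sites P)
  also have "card ?P = 4 * l - 2"
    using card assms by simp
  finally show ?thesis .
qed

text \<open>A flip on a side lowers its own weight from \<open>p\<close> to \<open>r\<close>, and
  those of its left and lower neighbours by a factor of at least \<open>s / p\<close>. Where flips
  meet or the upper right corner is flipped, the true weight is larger than what is charged;
  \<open>rs\<close>, \<open>sr\<close>, \<open>sp\<close> and \<open>sp2\<close> are these
  comparisons.\<close>

lemma rim_weight_ge:
  assumes T: "T \<subseteq> rim m l" and L: "L = m + l + 1" and m: "2 \<le> m" and l: "1 \<le> l"
  shows "s * p ^ (4 * l - 2) * (r * s\<^sup>2 / p ^ 3) ^ card T
    \<le> cw L (square m l) (sym_diff (square m l) T)"
proof -
  let ?A = "square m l"
  let ?X = "sym_diff ?A T"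
  have "rim m l \<subseteq> sites L" using m L by (auto simp: rim_def sites_def)
  then have TS: "T \<subseteq> sites L" using T by blast
  have sp: "s / p \<le> p" using s p by (simp add: field_simps power2_eq_square)
  have sp2: "(s / p) * (s / p) \<le> s"
  proof -
    have "(s / p) * (s / p) \<le> p * (s / p)"
      using sp pos by (intro mult_right_mono) auto
    then show ?thesis using p by simp
  qed
  have rs: "r * s \<le> p * q"
  proof -
    have "r * s \<le> (p * q) * 1"
      using r pos s_le p by (intro mult_mono) auto
    then show ?thesis by simp
  qed
  have sr: "s * (r / p) \<le> q"
  proof -
    have "s * (r / p) \<le> 1 * q" using pos r s_le p by (intro mult_mono) (auto simp: field_simps)
    then show ?thesis by simp
  qed
  have sp1: "s / p \<le> 1" using s_le p by (simp add: field_simps)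
  have "(\<Prod>v\<in>sites L. rim_base m l v) * (r / p * (s / p)\<^sup>2) ^ card T \<le> cw L ?A ?X"
  proof (rule config_weight_ge[OF TS])
    fix v assume v: "v \<in> sites L"
    obtain x y where xy: "v = (x, y)" by force
    have lt: "x < L" "y < L" using v by (auto simp: xy sites_def)
    \<comment> \<open>Writing \<open>m\<close> and \<open>l\<close> as successors removes truncated
      subtraction; only the last index \<open>k + j + 3\<close> needs care, since it wraps to
      \<open>0\<close>.\<close>
    obtain k j where kj: "m = Suc (Suc k)" "l = Suc j"
      using m l that[of "m - 2" "l - 1"] by simp
    have L': "L = Suc (Suc (Suc (Suc (k + j))))" using L kj by simp
    have end_iff: "i = Suc (Suc (Suc (k + j))) \<longleftrightarrow> i + 1 = L" for i
      unfolding L' by auto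
    have rt: "rt L (i, i') = (if i = Suc (Suc (Suc (k + j))) then (0, i') else (Suc i, i'))"
      and up: "up L (i', i) = (if i = Suc (Suc (Suc (k + j))) then (i', 0) else (i', Suc i))"
      if "i \<le> Suc (Suc (Suc (k + j)))" for i i'
    proof -
      have "i < L" using that L' by simp
      then show "rt L (i, i') = (if i = Suc (Suc (Suc (k + j))) then (0, i') else (Suc i, i'))"
        "up L (i', i) = (if i = Suc (Suc (Suc (k + j))) then (i', 0) else (i', Suc i))"
        unfolding end_iff by (auto simp: rt_def up_def)
    qed
    have lt': "x \<le> Suc (Suc (Suc (k + j)))" "y \<le> Suc (Suc (Suc (k + j)))" using lt L' by auto
    note mem = rt up xy rim_def square_def kj
    let ?c = "(m + l - 1, m + l - 1)"
    let ?goal = "rim_base m l v * ((r / p) ^ of_bool (v \<in> T) *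
          ((s / p) ^ of_bool (rt L v \<in> T) * (s / p) ^ of_bool (up L v \<in> T)))
        \<le> wt ((v \<in> ?X) = (v \<in> ?A)) ((rt L v \<in> ?X) = (v \<in> ?A)) ((up L v \<in> ?X) = (v \<in> ?A))"
    \<comment> \<open>Which of the three sites lie in the block decides the reference weight
      (\<open>1\<close>, \<open>p\<close> or \<open>s\<close>); only the pattern of flips is then
      left to check. By convexity, a site outside of the block never has both neighbours in
      it.\<close>
    consider (bulk) "v \<in> ?A" "rt L v \<in> ?A" "up L v \<in> ?A"
      | (top) "v \<in> ?A" "rt L v \<in> ?A" "up L v \<notin> ?A"
      | (right) "v \<in> ?A" "rt L v \<notin> ?A" "up L v \<in> ?A"
      | (corner) "v \<in> ?A" "rt L v \<notin> ?A" "up L v \<notin> ?A"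
      | (left) "v \<notin> ?A" "rt L v \<in> ?A"
      | (bottom) "v \<notin> ?A" "rt L v \<notin> ?A" "up L v \<in> ?A"
      | (far) "v \<notin> ?A" "rt L v \<notin> ?A" "up L v \<notin> ?A"
      by blast
    then show ?goal
    proof cases
      case bulk
      then have "rim_base m l v = 1" "v \<notin> rim m l"
        using lt' by (auto simp: mem rim_base_def split: if_splits)
      then show ?thesis using bulk T pos sp sp2 sp1
        by (cases "rt L v \<in> T"; cases "up L v \<in> T") (auto simp: agree_weight_def)
    next
      case top
      then have "rim_base m l v = p" "up L v \<notin> rim m l"
        using lt' by (auto simp: mem rim_base_def split: if_splits)
      then show ?thesis using top T pos rs
        by (cases "v \<in> T"; cases "rt L v \<in> T") (auto simp: agree_weight_def field_simps)
    next
      case right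
      then have "rim_base m l v = p" "rt L v \<notin> rim m l"
        using lt' by (auto simp: mem rim_base_def split: if_splits)
      then show ?thesis using right T pos rs
        by (cases "v \<in> T"; cases "up L v \<in> T") (auto simp: agree_weight_def field_simps)
    next
      case corner
      then have "rim_base m l v = s" "rt L v \<notin> rim m l" "up L v \<notin> rim m l"
        using lt' by (auto simp: mem rim_base_def split: if_splits)
      then show ?thesis using corner T pos sr
        by (cases "v \<in> T") (auto simp: agree_weight_def)
    next
      case left
      then have "rim_base m l v = p" "rt L v \<notin> rim m l" "up L v \<notin> ?A"
        using lt' by (auto simp: mem rim_base_def split: if_splits)
      then show ?thesis using left T pos rs
        by (cases "v \<in> T"; cases "up L v \<in> T") (auto simp: agree_weight_def field_simps)
    next
      case bottom
      from bottom(3) have *: "Suc (Suc k) \<le> x" "x \<le> Suc (Suc (k + j))" "Suc k \<le> y" "y \<le> Suc (k + j)"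
        using lt' by (auto simp: up xy square_def kj split: if_splits)
      then have "y = Suc k" using bottom(1) by (simp add: xy square_def kj)
      with * have "rim_base m l v = p" "up L v \<notin> rim m l"
        by (auto simp: mem rim_base_def)
      then show ?thesis using bottom T pos rs
        by (cases "v \<in> T"; cases "rt L v \<in> T") (auto simp: agree_weight_def field_simps)
    next
      case far
      have "rt L v \<in> ?A" if "v \<in> {m - 1} \<times> {m..<m + l}"
        using that by (auto simp: rt xy square_def kj)
      moreover have "up L v \<in> ?A" if "v \<in> {m..<m + l} \<times> {m - 1}"
        using that by (auto simp: up xy square_def kj)
      ultimately have out: "v \<notin> {m - 1} \<times> {m..<m + l}" "v \<notin> {m..<m + l} \<times> {m - 1}"
        using far by blast+
      have "{m..<m + l - 1} \<times> {m + l - 1} \<subseteq> ?A" "{m + l - 1} \<times> {m..<m + l - 1} \<subseteq> ?A" "?c \<in> ?A"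
        "{m + 1..<m + l} \<times> {m + l - 1} \<subseteq> ?A" "{m + l - 1} \<times> {m + 1..<m + l - 1} \<subseteq> ?A"
        by (auto simp: square_def kj)
      then have inner: "v \<notin> {m..<m + l - 1} \<times> {m + l - 1}" "v \<notin> {m + l - 1} \<times> {m..<m + l - 1}" "v \<noteq> ?c"
        "v \<notin> {m + 1..<m + l} \<times> {m + l - 1}" "v \<notin> {m + l - 1} \<times> {m + 1..<m + l - 1}"
        using far(1) by (fast)+
      have "rim_base m l v = 1"
        unfolding rim_base_def Un_iff using inner(1-3) out by (simp only: if_False simp_thms)
      moreover have "v \<notin> rim m l"
        unfolding rim_def Un_iff using inner(4-5) out by (simp only: simp_thms)
      ultimately have base: "rim_base m l v = 1" "v \<notin> T" using T by auto
      show ?thesis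
      proof (cases "rt L v \<in> T \<and> up L v \<in> T")
        case True
        then show ?thesis using base far sp2 by (simp add: agree_weight_def)
      next
        case False
        then consider "rt L v \<in> T" "up L v \<notin> T" | "rt L v \<notin> T" "up L v \<in> T"
          | "rt L v \<notin> T" "up L v \<notin> T" by blast
        then show ?thesis using base far sp by cases (simp_all add: agree_weight_def)
      qed
    qed
  qed (use pos in \<open>auto simp: rim_base_def\<close>)
  moreover have "r / p * (s / p)\<^sup>2 = r * s\<^sup>2 / p ^ 3"
    using p by (simp add: field_simps power2_eq_square power3_eq_cube)
  ultimately show ?thesis using m l L by (simp add: prod_rim_base)
qed

text \<open>Summing over independent flips is the binomial theorem. The spin at the lower left
  corner \<open>(m, m)\<close> is flipped in neither family, so it tells them apart.\<close>

lemma Z_ge_sums: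
  assumes m: "2 \<le> m" and l: "1 \<le> l" and L: "L = m + l + 1"
  shows "q ^ (l\<^sup>2) * (1 + s * r\<^sup>2 / q ^ 3) ^ (l div 2 * l) +
      s * p ^ (4 * l - 2) * (1 + r * s\<^sup>2 / p ^ 3) ^ card (rim m l) \<le> Z L (square m l)"
proof -
  let ?A = "square m l"
  let ?O = "odd_columns m l" and ?R = "rim m l"
  let ?f = "\<lambda>T. sym_diff ?A T"
  have fin: "finite ?O" "finite ?R" by (auto simp: odd_columns_def rim_def)
  have AS: "?A \<subseteq> sites L" using square_subset L by simp
  have RS: "?R \<subseteq> sites L" using m L by (auto simp: rim_def sites_def)
  have OA: "?O \<subseteq> ?A" by (auto simp: odd_columns_def)
  have inj: "inj_on ?f (Pow ?R)" by (intro inj_onI) blast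
  have "(m, m) \<in> ?A" "(m, m) \<notin> ?R" "(m, m) \<notin> ?O"
    using l m by (auto simp: square_def rim_def odd_columns_def)
  then have disj: "Pow ?O \<inter> ?f ` Pow ?R = {}" by blast
  have "q ^ (l\<^sup>2) * (1 + s * r\<^sup>2 / q ^ 3) ^ (l div 2 * l) =
      (\<Sum>T\<in>Pow ?O. q ^ (l\<^sup>2) * (s * r\<^sup>2 / q ^ 3) ^ card T)"
    using fin by (simp add: sum_Pow_power_card card_odd_columns flip: sum_distrib_left)
  also have "\<dots> \<le> (\<Sum>T\<in>Pow ?O. cw L ?A T)"
    using m L by (intro sum_mono area_weight_ge) auto
  finally have 1: "q ^ (l\<^sup>2) * (1 + s * r\<^sup>2 / q ^ 3) ^ (l div 2 * l) \<le> (\<Sum>T\<in>Pow ?O. cw L ?A T)" .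
  have "s * p ^ (4 * l - 2) * (1 + r * s\<^sup>2 / p ^ 3) ^ card ?R =
      (\<Sum>T\<in>Pow ?R. s * p ^ (4 * l - 2) * (r * s\<^sup>2 / p ^ 3) ^ card T)"
    using fin by (simp add: sum_Pow_power_card flip: sum_distrib_left)
  also have "\<dots> \<le> (\<Sum>T\<in>Pow ?R. cw L ?A (?f T))"
    using m l L by (intro sum_mono rim_weight_ge) auto
  also have "\<dots> = (\<Sum>X\<in>?f ` Pow ?R. cw L ?A X)"
    using inj by (simp add: sum.reindex)
  finally have 2: "s * p ^ (4 * l - 2) * (1 + r * s\<^sup>2 / p ^ 3) ^ card ?R
      \<le> (\<Sum>X\<in>?f ` Pow ?R. cw L ?A X)" .
  have "(\<Sum>T\<in>Pow ?O. cw L ?A T) + (\<Sum>X\<in>?f ` Pow ?R. cw L ?A X) =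
      (\<Sum>X\<in>Pow ?O \<union> ?f ` Pow ?R. cw L ?A X)"
    using fin disj by (intro sum.union_disjoint [symmetric]) auto
  also have "\<dots> \<le> (\<Sum>X\<in>Pow (sites L). cw L ?A X)"
    using AS RS OA by (intro sum_mono2 cw_nonneg) auto
  finally show ?thesis using 1 2 by (simp add: partition_function_def)
qed

text \<open>Only constants are at stake: 0.75 * 0.9^2 and 0.9 * 0.75^2 both exceed 1/2, which gives
  \<open>e_le\<close> and \<open>t_le\<close>. For the exponent, \<open>l div 2 * l\<close> is
  \<open>l\<^sup>2 / 2\<close> or \<open>l * (l - 1) / 2\<close> according to parity.\<close>

lemma Z_ge:
  assumes m: "2 \<le> m" and l: "1 \<le> l" and L: "L = m + l + 1"
  shows "(1 + inverse q * p ^ 4 / 2) powr ((real l - 1)\<^sup>2 / 2) * q ^ (l\<^sup>2) +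
      0.7 * (1 + q * p\<^sup>2 / 2) ^ (4 * l - 1) * p ^ (4 * l) \<le> Z L (square m l)"
proof -
  define e where "e = inverse q * p ^ 4 / 2"
  define t where "t = q * p\<^sup>2 / 2"
  have e0: "0 \<le> e" and t0: "0 \<le> t" using pos by (auto simp: e_def t_def)
  have e_le: "e \<le> s * r\<^sup>2 / q ^ 3"
  proof -
    have "(0.9 * (p * q))\<^sup>2 \<le> r\<^sup>2" using r pos by (intro power_mono) auto
    then have "0.75 * p\<^sup>2 * (0.9 * (p * q))\<^sup>2 \<le> s * r\<^sup>2"
      using s pos by (intro mult_mono) auto
    moreover have "0.5 * (p ^ 4 * q\<^sup>2) \<le> 0.75 * p\<^sup>2 * (0.9 * (p * q))\<^sup>2"
      using pos by (simp add: power_mult_distrib power2_eq_square power4_eq_xxxx algebra_simps)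
    ultimately have "0.5 * (p ^ 4 * q\<^sup>2) \<le> s * r\<^sup>2" by (rule order_trans[rotated])
    then have "0.5 * (p ^ 4 * q\<^sup>2) / q ^ 3 \<le> s * r\<^sup>2 / q ^ 3"
      using pos by (intro divide_right_mono) auto
    moreover have "0.5 * (p ^ 4 * q\<^sup>2) / q ^ 3 = e"
      using pos by (simp add: e_def field_simps power2_eq_square power3_eq_cube)
    ultimately show ?thesis by simp
  qed
  have t_le: "t \<le> r * s\<^sup>2 / p ^ 3"
  proof -
    have "(0.75 * p\<^sup>2)\<^sup>2 \<le> s\<^sup>2" using s pos by (intro power_mono) auto
    then have "0.9 * (p * q) * (0.75 * p\<^sup>2)\<^sup>2 \<le> r * s\<^sup>2"
      using r pos by (intro mult_mono) auto
    moreover have "0.5 * (p ^ 5 * q) \<le> 0.9 * (p * q) * (0.75 * p\<^sup>2)\<^sup>2"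
      using pos by (simp add: power_mult_distrib power2_eq_square eval_nat_numeral algebra_simps)
    ultimately have "0.5 * (p ^ 5 * q) \<le> r * s\<^sup>2" by (rule order_trans[rotated])
    then have "0.5 * (p ^ 5 * q) / p ^ 3 \<le> r * s\<^sup>2 / p ^ 3"
      using pos by (intro divide_right_mono) auto
    moreover have "0.5 * (p ^ 5 * q) / p ^ 3 = t"
      using pos by (simp add: t_def field_simps eval_nat_numeral)
    ultimately show ?thesis by simp
  qed
  have t_small: "t \<le> 1 / 36"
  proof -
    have "q * (p * p) \<le> 1/2 * (1/3 * (1/3))"
      using p q by (intro mult_mono) auto
    then show ?thesis by (simp add: t_def power2_eq_square mult_ac)
  qed
  have exponent: "(real l - 1)\<^sup>2 / 2 \<le> real (l div 2 * l)"
  proof (cases "even l")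
    case True
    then obtain k where "l = 2 * k" by (elim evenE)
    then show ?thesis using l by (simp add: power2_eq_square algebra_simps)
  next
    case False
    then obtain k where "l = 2 * k + 1" by (elim oddE)
    then show ?thesis by (simp add: power2_eq_square algebra_simps)
  qed
  have "(1 + e) powr ((real l - 1)\<^sup>2 / 2) \<le> (1 + e) powr real (l div 2 * l)"
    using e0 exponent by (intro powr_mono) auto
  also have "\<dots> = (1 + e) ^ (l div 2 * l)"
    using e0 by (intro powr_realpow) auto
  also have "\<dots> \<le> (1 + s * r\<^sup>2 / q ^ 3) ^ (l div 2 * l)"
    using e0 e_le by (intro power_mono) auto
  finally have area: "(1 + e) powr ((real l - 1)\<^sup>2 / 2) * q ^ (l\<^sup>2)
      \<le> q ^ (l\<^sup>2) * (1 + s * r\<^sup>2 / q ^ 3) ^ (l div 2 * l)"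
    using pos by (simp add: mult.commute)
  \<comment> \<open>The rim offers \<open>4 * l - 3\<close> flips where \<open>lambda2\<close> asks
    for \<open>4 * l - 1\<close>. The two missing factors \<open>1 + t\<close> are absorbed in the
    gap between 0.7 and 0.75.\<close>
  have "0.7 * (1 + t)\<^sup>2 \<le> 0.7 * (37 / 36)\<^sup>2"
    using t0 t_small by (intro mult_left_mono power_mono) auto
  also have "\<dots> \<le> (0.75 :: real)" by (simp add: power2_eq_square)
  finally have const: "0.7 * (1 + t)\<^sup>2 \<le> 0.75" .
  have "0.7 * (1 + t) ^ (4 * l - 1) * p ^ (4 * l) =
      (0.7 * (1 + t)\<^sup>2 * p\<^sup>2) * p ^ (4 * l - 2) * (1 + t) ^ (4 * l - 3)"
  proof -
    have "4 * l - 1 = 2 + (4 * l - 3)" "4 * l = 2 + (4 * l - 2)" using l by auto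
    then have "(1 + t) ^ (4 * l - 1) = (1 + t)\<^sup>2 * (1 + t) ^ (4 * l - 3)"
      "p ^ (4 * l) = p\<^sup>2 * p ^ (4 * l - 2)"
      by (metis power_add)+
    then show ?thesis by simp
  qed
  also have "\<dots> \<le> s * p ^ (4 * l - 2) * (1 + r * s\<^sup>2 / p ^ 3) ^ card (rim m l)"
  proof (intro mult_mono)
    show "0.7 * (1 + t)\<^sup>2 * p\<^sup>2 \<le> s"
      by (rule order_trans[OF mult_right_mono[OF const] s(1)]) simp
    have "(1 + t) ^ (4 * l - 3) \<le> (1 + t) ^ card (rim m l)"
      using t0 m card_rim[of m l] by (intro power_increasing) auto
    also have "\<dots> \<le> (1 + r * s\<^sup>2 / p ^ 3) ^ card (rim m l)"
      using t0 t_le by (intro power_mono) auto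
    finally show "(1 + t) ^ (4 * l - 3) \<le> (1 + r * s\<^sup>2 / p ^ 3) ^ card (rim m l)" .
  qed (use pos t0 in auto)
  finally show ?thesis using area Z_ge_sums[OF m l L] unfolding e_def t_def by linarith
qed

end

context spin_weights
begin

subsection \<open>Upper bound\<close>

text \<open>The row and column directly past the block carry the identity. Every run of swaps in a
  row or column of the block then ends inside the block; all other configurations of nonzero weight
  stretch around the torus.\<close>

definition zero_at_end :: "nat \<Rightarrow> site set \<Rightarrow> bool" where
  "zero_at_end L X \<longleftrightarrow> X \<inter> cross L (L - 1) (L - 1) = {}"

text \<open>The tilt \<open>b ^ (2 [v] - [right of v] - [above v])\<close> is a coboundary, so it does not change
  the partition function on the torus. It turns the weight outside of the block into a
  substochastic one. Inside the block, the two further factors give a weight \<open>1 / a\<close> to every spin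
  that is off and \<open>1 / b\<^sup>2\<close> to every right or upper end of a run of spins that are on.\<close>

definition tilted :: "real \<Rightarrow> real \<Rightarrow> site set \<Rightarrow> site \<Rightarrow> bool \<Rightarrow> bool \<Rightarrow> bool \<Rightarrow> real" where
  "tilted a b A v x y z = wt (x = (v \<in> A)) (y = (v \<in> A)) (z = (v \<in> A)) *
     ((b\<^sup>2) ^ of_bool x / (b ^ of_bool y * b ^ of_bool z)) *
     (if v \<in> A then (1 / a) ^ of_bool (\<not> x) *
        ((1 / b\<^sup>2) ^ of_bool (x \<and> \<not> y) * (1 / b\<^sup>2) ^ of_bool (x \<and> \<not> z)) else 1)"

text \<open>When both neighbours agree with the leg, the spin is forced, the tilt cancels, and the
  sum is exactly 1. The other four sums leave room, so that 1.91 and 2.9 need only be large enough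
  here; what limits them from above is \<open>a \<le> 1\<close> and \<open>b \<le> 1\<close> in the
  isoperimetric bound.\<close>

lemma tilted_le_1:
  assumes a: "a = 1.91 * q" and b: "b = 2.9 * p"
  shows "tilted a b A v True y z + tilted a b A v False y z \<le> 1"
proof -
  have b0: "0 < b" and a0: "0 < a" using pos by (auto simp: a b)
  have s_b: "s / b\<^sup>2 \<le> 1 / 8"
  proof -
    have "s / b\<^sup>2 \<le> p\<^sup>2 / b\<^sup>2" using s by (intro divide_right_mono) auto
    also have "\<dots> \<le> 1 / 8" using p by (simp add: b power_mult_distrib power2_eq_square)
    finally show ?thesis .
  qed
  have r_ab: "r / (a * b) \<le> 1 / 5"
  proof -
    have "r / (a * b) \<le> (p * q) / (a * b)" using r a0 b0 by (intro divide_right_mono) auto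
    also have "\<dots> \<le> 1 / 5" using pos by (simp add: a b)
    finally show ?thesis .
  qed
  have p_b: "p / b \<le> 1 / 2" using p by (simp add: b)
  have r_b: "r * b \<le> 1 / 2"
  proof -
    have "r * b \<le> (1 / 6) * (2.9 * (1 / 3))"
      using r_le p pos unfolding b by (intro mult_mono) auto
    then show ?thesis by simp
  qed
  have q_a: "q / a \<le> 1 / 1.9" using q by (simp add: a)
  consider "v \<in> A" "y" "z" | "v \<in> A" "y \<noteq> z" | "v \<in> A" "\<not> y" "\<not> z"
    | "v \<notin> A" "y" "z" | "v \<notin> A" "y \<noteq> z" | "v \<notin> A" "\<not> y" "\<not> z"
    by blast
  then show ?thesis
  proof cases
    case 1
    then show ?thesis using b0 by (simp add: tilted_def agree_weight_def power2_eq_square)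
  next
    case 2
    then have "tilted a b A v True y z + tilted a b A v False y z = p / b + r / (a * b)"
      using b0 by (auto simp: tilted_def agree_weight_def power2_eq_square)
    then show ?thesis using p_b r_ab by linarith
  next
    case 3
    then have "tilted a b A v True y z + tilted a b A v False y z = s / b\<^sup>2 + q / a"
      using b0 by (auto simp: tilted_def agree_weight_def power2_eq_square)
    then show ?thesis using s_b q_a by simp
  next
    case 4
    then have "tilted a b A v True y z + tilted a b A v False y z = q + s / b\<^sup>2"
      using b0 by (auto simp: tilted_def agree_weight_def power2_eq_square)
    then show ?thesis using s_b q by linarith
  next
    case 5
    then have "tilted a b A v True y z + tilted a b A v False y z = r * b + p / b"
      using b0 by (auto simp: tilted_def agree_weight_def power2_eq_square)
    then show ?thesis using p_b r_b by linarith
  next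
    case 6
    then show ?thesis by (simp add: tilted_def agree_weight_def)
  qed
qed

lemma tilted_nonneg:
  assumes "0 < a" "0 < b"
  shows "0 \<le> tilted a b A v x y z"
  unfolding tilted_def using assms by (intro mult_nonneg_nonneg wt_nonneg) auto

lemma tilted_prod:
  assumes ab: "0 < a" "0 < b" and X: "X \<subseteq> sites L" and A: "A \<subseteq> sites L"
  shows "(\<Prod>v\<in>sites L. tilted a b A v (v \<in> X) (rt L v \<in> X) (up L v \<in> X)) *
     (a ^ card (A - X) * (b\<^sup>2) ^ (card {v\<in>A. v \<in> X \<and> rt L v \<notin> X} + card {v\<in>A. v \<in> X \<and> up L v \<notin> X}))
     = cw L A X"
proof -
  have finA: "finite A" using A by (rule finite_subset) simp
  have sets: "{v\<in>sites L. v \<in> X} = X" using X by auto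
  have [simp]: "{v \<in> A. v \<notin> X} = A - X" by auto
  have "(\<Prod>v\<in>sites L. (b\<^sup>2) ^ of_bool (v \<in> X) / (b ^ of_bool (rt L v \<in> X) * b ^ of_bool (up L v \<in> X))) = 1"
    using ab by (simp add: prod_dividef prod.distrib prod_power_of_bool card_rt card_up sets
        power_mult_distrib power2_eq_square)
  moreover have "(\<Prod>v\<in>sites L. if v \<in> A then (1 / a) ^ of_bool (v \<notin> X) *
        ((1 / b\<^sup>2) ^ of_bool (v \<in> X \<and> rt L v \<notin> X) * (1 / b\<^sup>2) ^ of_bool (v \<in> X \<and> up L v \<notin> X)) else 1)
      = (1 / a) ^ card (A - X) * (1 / b\<^sup>2) ^ (card {v\<in>A. v \<in> X \<and> rt L v \<notin> X} + card {v\<in>A. v \<in> X \<and> up L v \<notin> X})"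
    using A finA by (simp add: prod.If_cases Int_absorb1 prod.distrib prod_power_of_bool power_add)
  ultimately have "(\<Prod>v\<in>sites L. tilted a b A v (v \<in> X) (rt L v \<in> X) (up L v \<in> X)) = cw L A X *
      ((1 / a) ^ card (A - X) * (1 / b\<^sup>2) ^ (card {v\<in>A. v \<in> X \<and> rt L v \<notin> X} + card {v\<in>A. v \<in> X \<and> up L v \<notin> X}))"
    unfolding tilted_def config_weight_def prod.distrib by simp
  then show ?thesis using ab by (simp add: field_simps power_divide)
qed

text \<open>A row of the block that meets \<open>X\<close> has a rightmost spin that is on, and the number of spins
  that are on is at most \<open>l\<close> times the number of such rows; the same holds for columns.
  With \<open>k\<close> rows and columns in total, the left-hand side is thus at most the geometric
  interpolation \<open>(a\<^sup>l)\<^bsup>l - k/2\<^esup> (b\<^sup>4)\<^bsup>k/2\<^esup>\<close> of the two terms on the right.\<close>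

lemma isoperimetric:
  fixes a b :: real
  assumes a: "0 < a" "a \<le> 1" and b: "0 < b" "b \<le> 1" and L: "L = m + l + 1"
    and X: "X \<subseteq> sites L" and zero: "zero_at_end L X"
  defines "A \<equiv> square m l"
  shows "a ^ card (A - X) * (b\<^sup>2) ^ (card {v\<in>A. v \<in> X \<and> rt L v \<notin> X} + card {v\<in>A. v \<in> X \<and> up L v \<notin> X})
     \<le> a ^ (l\<^sup>2) + b ^ (4 * l)"
proof -
  define R where "R = snd ` (A \<inter> X)"
  define C where "C = fst ` (A \<inter> X)"
  define hr where "hr = card {v\<in>A. v \<in> X \<and> rt L v \<notin> X}"
  define hu where "hu = card {v\<in>A. v \<in> X \<and> up L v \<notin> X}"
  have finA: "finite A" by (simp add: A_def)
  have zero': "(x, y) \<notin> X" if "x = m + l \<or> y = m + l" for x y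
    using zero X that L by (auto simp: zero_at_end_def cross_def)
  have "R \<subseteq> snd ` {v\<in>A. v \<in> X \<and> rt L v \<notin> X}"
  proof
    fix y assume "y \<in> R"
    then obtain x0 where x0: "(x0, y) \<in> A \<inter> X" by (auto simp: R_def)
    let ?S = "{x. (x, y) \<in> A \<inter> X}"
    have finS: "finite ?S"
      by (rule finite_subset[of _ "fst ` A"]) (use finA in \<open>auto intro: rev_image_eqI\<close>)
    have M: "Max ?S \<in> ?S" using finS x0 by (intro Max_in) auto
    then have *: "m \<le> Max ?S" "Max ?S < m + l" "m \<le> y" "y < m + l" by (auto simp: A_def square_def)
    have "(Max ?S + 1, y) \<notin> X"
    proof
      assume X1: "(Max ?S + 1, y) \<in> X"
      then have "Max ?S + 1 \<noteq> m + l" using zero' by blast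
      then have "Max ?S + 1 \<in> ?S" using X1 * by (auto simp: A_def square_def)
      then show False using Max_ge[OF finS] by fastforce
    qed
    moreover have "rt L (Max ?S, y) = (Max ?S + 1, y)" using * L by (simp add: rt_def)
    ultimately show "y \<in> snd ` {v\<in>A. v \<in> X \<and> rt L v \<notin> X}"
      using M by (intro image_eqI[of _ _ "(Max ?S, y)"]) auto
  qed
  then have hr: "card R \<le> hr"
    unfolding hr_def using finA by (intro surj_card_le) auto
  have "C \<subseteq> fst ` {v\<in>A. v \<in> X \<and> up L v \<notin> X}"
  proof
    fix x assume "x \<in> C"
    then obtain y0 where y0: "(x, y0) \<in> A \<inter> X" by (auto simp: C_def)
    let ?S = "{y. (x, y) \<in> A \<inter> X}"
    have finS: "finite ?S"
      by (rule finite_subset[of _ "snd ` A"]) (use finA in \<open>auto intro: rev_image_eqI\<close>)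
    have M: "Max ?S \<in> ?S" using finS y0 by (intro Max_in) auto
    then have *: "m \<le> Max ?S" "Max ?S < m + l" "m \<le> x" "x < m + l" by (auto simp: A_def square_def)
    have "(x, Max ?S + 1) \<notin> X"
    proof
      assume X1: "(x, Max ?S + 1) \<in> X"
      then have "Max ?S + 1 \<noteq> m + l" using zero' by blast
      then have "Max ?S + 1 \<in> ?S" using X1 * by (auto simp: A_def square_def)
      then show False using Max_ge[OF finS] by fastforce
    qed
    moreover have "up L (x, Max ?S) = (x, Max ?S + 1)" using * L by (simp add: up_def)
    ultimately show "x \<in> fst ` {v\<in>A. v \<in> X \<and> up L v \<notin> X}"
      using M by (intro image_eqI[of _ _ "(x, Max ?S)"]) auto
  qed
  then have hu: "card C \<le> hu"
    unfolding hu_def using finA by (intro surj_card_le) auto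
  have sub: "A \<inter> X \<subseteq> {m..<m + l} \<times> R" "A \<inter> X \<subseteq> C \<times> {m..<m + l}"
    by (force simp: A_def square_def R_def C_def)+
  have finRC: "finite R" "finite C" using finA by (auto simp: R_def C_def)
  have "card (A \<inter> X) \<le> card ({m..<m + l} \<times> R)" "card (A \<inter> X) \<le> card (C \<times> {m..<m + l})"
    by (intro card_mono sub finite_cartesian_product finRC finite_atLeastLessThan)+
  then have ones: "card (A \<inter> X) \<le> l * card R" "card (A \<inter> X) \<le> card C * l"
    by (simp_all add: card_cartesian_product)
  have "R \<subseteq> {m..<m + l}" "C \<subseteq> {m..<m + l}"
    by (auto simp: A_def square_def R_def C_def)
  then have k_le: "card R + card C \<le> 2 * l"
    using card_mono[of "{m..<m + l}" R] card_mono[of "{m..<m + l}" C] by simp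
  define k where "k = card R + card C"
  define M where "M = (if a ^ l \<le> b ^ 4 then b ^ 4 else a ^ l)"
  have "card (A - X) + card (A \<inter> X) = l\<^sup>2"
    using card_square[of m l] card_Int_Diff[OF finA, of X] by (simp add: A_def)
  \<comment> \<open>Adding the row bound and the column bound gives
    \<open>2 * card (A \<inter> X) \<le> l * k\<close>, hence at least
    \<open>l * (2 * l - k) / 2\<close> spins of the block are off.\<close>
  then have "2 * l\<^sup>2 \<le> 2 * card (A - X) + l * k"
    using ones by (simp add: k_def algebra_simps)
  then have zeros: "l * (2 * l - k) \<le> 2 * card (A - X)"
    by (simp add: diff_mult_distrib2 power2_eq_square)
  have M0: "0 \<le> M" using a b by (simp add: M_def)
  \<comment> \<open>Squaring avoids the half-integer exponents of the interpolation: the square is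
    at most \<open>(a ^ l) ^ (2 * l - k) * (b ^ 4) ^ k\<close>, a product of \<open>2 * l\<close>
    factors each at most \<open>M\<close>.\<close>
  have "(a ^ card (A - X) * (b\<^sup>2) ^ (hr + hu))\<^sup>2 = a ^ (2 * card (A - X)) * (b ^ 4) ^ (hr + hu)"
  proof -
    have "((b\<^sup>2) ^ (hr + hu))\<^sup>2 = (b ^ 4) ^ (hr + hu)"
      by (simp only: power_mult [symmetric]) (rule arg_cong[where f = "power b"], simp)
    then show ?thesis by (simp only: power_mult_distrib power_even_eq)
  qed
  also have "\<dots> \<le> a ^ (l * (2 * l - k)) * (b ^ 4) ^ k"
  proof (rule mult_mono)
    show "a ^ (2 * card (A - X)) \<le> a ^ (l * (2 * l - k))"
      by (rule power_decreasing[OF zeros]) (use a in auto)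
    show "(b ^ 4) ^ (hr + hu) \<le> (b ^ 4) ^ k"
      by (rule power_decreasing) (use b hr hu in \<open>auto simp: k_def power_le_one\<close>)
  qed (use a b in auto)
  also have "\<dots> = (a ^ l) ^ (2 * l - k) * (b ^ 4) ^ k" by (simp add: power_mult)
  also have "\<dots> \<le> M ^ (2 * l - k) * M ^ k"
    using a b by (intro mult_mono power_mono) (auto simp: M_def)
  also have "\<dots> = (M ^ l)\<^sup>2"
    using k_le by (simp only: power_add [symmetric] power_even_eq [symmetric] k_def) simp
  finally have "a ^ card (A - X) * (b\<^sup>2) ^ (hr + hu) \<le> M ^ l"
    by (rule power2_le_imp_le) (use M0 in simp)
  also have "M ^ l \<le> (a ^ l) ^ l + (b ^ 4) ^ l"
    using a b by (simp add: M_def)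
  also have "\<dots> = a ^ (l\<^sup>2) + b ^ (4 * l)"
    by (simp only: power2_eq_square power_mult)
  finally show ?thesis by (simp add: hr_def hu_def)
qed

text \<open>The cross at \<open>L - 1\<close> admits a single boundary condition here, so the
  substochastic remainder sums to at most 1, and only the isoperimetric maximum of the extracted
  factors survives.\<close>

lemma good_sum_le:
  assumes L: "L = m + l + 1"
  shows "(\<Sum>X | X \<subseteq> sites L \<and> zero_at_end L X. cw L (square m l) X)
    \<le> (1.91 * q) ^ (l\<^sup>2) + (2.9 * p) ^ (4 * l)"
proof -
  let ?A = "square m l"
  define a where "a = 1.91 * q"
  define b where "b = 2.9 * p"
  have ab: "0 < a" "a \<le> 1" "0 < b" "b \<le> 1" using p q by (auto simp: a_def b_def)
  define M where "M = a ^ (l\<^sup>2) + b ^ (4 * l)"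
  have M0: "0 \<le> M" using ab by (simp add: M_def)
  define W where "W X = (\<Prod>v\<in>sites L. tilted a b ?A v (v \<in> X) (rt L v \<in> X) (up L v \<in> X))" for X
  have W0: "0 \<le> W X" for X unfolding W_def using ab by (intro prod_nonneg ballI tilted_nonneg)
  have "(\<Sum>X | X \<subseteq> sites L \<and> zero_at_end L X. cw L ?A X) \<le> (\<Sum>X | X \<subseteq> sites L \<and> zero_at_end L X. M * W X)"
  proof (intro sum_mono)
    fix X assume "X \<in> {X. X \<subseteq> sites L \<and> zero_at_end L X}"
    then have X: "X \<subseteq> sites L" "zero_at_end L X" by auto
    have "cw L ?A X = W X * (a ^ card (?A - X) *
        (b\<^sup>2) ^ (card {v\<in>?A. v \<in> X \<and> rt L v \<notin> X} + card {v\<in>?A. v \<in> X \<and> up L v \<notin> X}))"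
      unfolding W_def using tilted_prod[OF ab(1,3) X(1), of ?A] square_subset[of m l] L by simp
    also have "\<dots> \<le> W X * M"
      unfolding M_def by (intro mult_left_mono isoperimetric[OF ab L X] W0)
    finally show "cw L ?A X \<le> M * W X" by (simp only: mult.commute)
  qed
  also have "\<dots> = M * (\<Sum>X\<in>Pow (sites L). of_bool (X \<inter> cross L (L - 1) (L - 1) = {}) * W X)"
  proof -
    have "{X \<in> Pow (sites L). X \<inter> cross L (L - 1) (L - 1) = {}} = {X. X \<subseteq> sites L \<and> zero_at_end L X}"
      by (auto simp: zero_at_end_def)
    then show ?thesis
      by (simp add: sum_distrib_left [symmetric] of_bool_def if_distrib if_distribR
          sum.inter_filter [symmetric] cong: if_cong)
  qed
  also have "\<dots> \<le> M * (\<Sum>B\<in>Pow (cross L (L - 1) (L - 1)). of_bool (B = {}))"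
    unfolding W_def using L M0 tilted_le_1[OF a_def b_def] ab
    by (intro mult_left_mono torus_sum_le tilted_nonneg) auto
  also have "\<dots> = M" by (simp add: of_bool_def)
  finally show ?thesis by (simp add: M_def a_def b_def)
qed

section \<open>Configurations that stretch around the torus\<close>

text \<open>In a row that misses the block, the swap either passes to the next row or moves right
  forever and fills the row. From row \<open>L - 1\<close>, which is followed by row
  \<open>0\<close>, it thus either fills some row, giving \<open>L\<close> sites, or visits each of
  the rows \<open>0\<close> to \<open>m - 1\<close>.\<close>

lemma card_ge_if_last_row_nonempty:
  assumes X: "X \<subseteq> sites L" and pre: "\<And>v. v \<in> X \<Longrightarrow> v \<notin> square m l \<Longrightarrow> rt L v \<in> X \<or> up L v \<in> X"
    and L: "L = m + l + 1" and top: "(x0, L - 1) \<in> X"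
  shows "m \<le> card (X - square m l)"
proof -
  have finX: "finite X" using X finite_sites by (rule finite_subset)
  have step: "(\<exists>x. (x, (y + 1) mod L) \<in> X) \<or> (\<forall>x<L. (x, y) \<in> X)"
    if y: "y < m \<or> y = L - 1" and x: "(x, y) \<in> X" for x y
  proof (rule disjCI)
    assume full: "\<not> (\<forall>x<L. (x, y) \<in> X)"
    show "\<exists>x. (x, (y + 1) mod L) \<in> X"
    proof (rule ccontr)
      assume none: "\<nexists>x. (x, (y + 1) mod L) \<in> X"
      have nxt: "((x + 1) mod L, y) \<in> X" if "(x, y) \<in> X" for x
        using pre[OF that] y none L by (auto simp: square_def rt_def up_def)
      have all: "((x + i) mod L, y) \<in> X" for i
      proof (induction i)
        case 0
        then show ?case using x X by (auto simp: sites_def)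
      next
        case (Suc i)
        then show ?case using nxt[OF Suc] by (simp add: mod_simps)
      qed
      have "(x', y) \<in> X" if "x' < L" for x'
      proof -
        have "x < L" using x X by (auto simp: sites_def)
        then have "(x + (x' + L - x)) mod L = x'" using that by simp
        then show ?thesis using all[of "x' + L - x"] by simp
      qed
      with full show False by blast
    qed
  qed
  show ?thesis
  proof (cases "\<exists>y. (y < m \<or> y = L - 1) \<and> (\<forall>x<L. (x, y) \<in> X)")
    case True
    then obtain y where y: "y < m \<or> y = L - 1" "\<forall>x<L. (x, y) \<in> X" by blast
    then have "{..<L} \<times> {y} \<subseteq> X - square m l" using L by (auto simp: square_def)
    then have "card ({..<L} \<times> {y}) \<le> card (X - square m l)" using finX by (intro card_mono) auto
    then show ?thesis using L by (simp add: card_cartesian_product)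
  next
    case False
    have row: "\<exists>x. (x, y) \<in> X" if "y < m" for y
      using that
    proof (induction y)
      case 0
      then show ?case using step[OF _ top] False L by auto
    next
      case (Suc y)
      then obtain x where x: "(x, y) \<in> X" by auto
      have y: "y < m" "(y + 1) mod L = Suc y" using Suc.prems L by auto
      then show ?case using step[OF _ x] False unfolding y(2) by blast
    qed
    have "{..<m} \<subseteq> snd ` (X - square m l)"
    proof
      fix y assume "y \<in> {..<m}"
      then obtain x where "(x, y) \<in> X" "(x, y) \<notin> square m l" using row by (auto simp: square_def)
      then show "y \<in> snd ` (X - square m l)" by force
    qed
    then have "card {..<m} \<le> card (X - square m l)" using finX by (intro surj_card_le) auto
    then show ?thesis by simp
  qed
qed

text \<open>The propagation property comes from the vanishing weight: outside of the block, a swap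
  whose two neighbours carry the identity makes the whole product 0.\<close>

lemma bad_card_ge:
  assumes X: "X \<subseteq> sites L" and L: "L = m + l + 1"
    and nz: "cw L (square m l) X \<noteq> 0" and bad: "\<not> zero_at_end L X"
  shows "m \<le> card (X - square m l)"
proof -
  have finX: "finite X" using X finite_sites by (rule finite_subset)
  have pre: "rt L v \<in> X \<or> up L v \<in> X" if "v \<in> X" "v \<notin> square m l" for v
  proof (rule ccontr)
    assume "\<not> ?thesis"
    then have "wt ((v \<in> X) = (v \<in> square m l)) ((rt L v \<in> X) = (v \<in> square m l))
        ((up L v \<in> X) = (v \<in> square m l)) = 0"
      using that by (simp add: agree_weight_def)
    then have "cw L (square m l) X = 0"
      unfolding config_weight_def using that X by (intro prod_zero bexI[of _ v]) auto
    with nz show False by simp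
  qed
  obtain v where "v \<in> X" "fst v = L - 1 \<or> snd v = L - 1"
    using bad unfolding zero_at_end_def cross_def by blast
  then obtain x y where xy: "(x, y) \<in> X" "x = L - 1 \<or> y = L - 1"
    by (cases v) auto
  from xy(2) show ?thesis
  proof
    assume "y = L - 1"
    then show ?thesis using card_ge_if_last_row_nonempty[OF X pre L] xy by auto
  next
    assume x: "x = L - 1"
    \<comment> \<open>A swap in the last column is reduced to the last row by reflection in the
      diagonal, which exchanges \<open>rt\<close> with \<open>up\<close> and preserves the
      block.\<close>
    let ?X = "prod.swap ` X"
    have sw: "prod.swap v \<in> square m l \<longleftrightarrow> v \<in> square m l" for v
      by (cases v) (auto simp: square_def)
    have mem: "v \<in> ?X \<longleftrightarrow> prod.swap v \<in> X" for v by force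
    have "m \<le> card (?X - square m l)"
    proof (rule card_ge_if_last_row_nonempty[OF _ _ L])
      show "?X \<subseteq> sites L" using X by (auto simp: sites_def)
      show "rt L v \<in> ?X \<or> up L v \<in> ?X" if "v \<in> ?X" "v \<notin> square m l" for v
        using pre[of "prod.swap v"] that by (cases v) (auto simp: mem sw rt_def up_def square_def)
      show "(y, L - 1) \<in> ?X" using xy x by (auto simp: mem)
    qed
    also have "?X - square m l = prod.swap ` (X - square m l)"
      using sw by auto
    also have "card \<dots> = card (X - square m l)" by (intro card_image) simp
    finally show ?thesis .
  qed
qed

lemma exists_sparse_row:
  assumes X: "X \<subseteq> sites L" and card: "card X < 4 * L"
  shows "\<exists>y0<L. card {v\<in>X. snd v = y0} \<le> 3" "\<exists>x0<L. card {v\<in>X. fst v = x0} \<le> 3"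
proof -
  have finX: "finite X" using X finite_sites by (rule finite_subset)
  have "\<exists>y0<L. card {v\<in>X. f v = y0} \<le> 3" if f: "f ` X \<subseteq> {..<L}" for f :: "site \<Rightarrow> nat"
  proof (rule ccontr)
    assume "\<not> ?thesis"
    then have ge: "\<forall>y<L. 4 \<le> card {v\<in>X. f v = y}" by force
    have "4 * L = (\<Sum>y<L. 4)" by simp
    also have "\<dots> \<le> (\<Sum>y<L. card {v\<in>X. f v = y})" using ge by (intro sum_mono) auto
    also have "\<dots> = (\<Sum>y<L. \<Sum>v | v \<in> X \<and> f v = y. 1)" by simp
    also have "\<dots> = (\<Sum>v\<in>X. 1)"
      using finX f by (intro sum.group) auto
    finally show False using card by simp
  qed
  moreover have "snd ` X \<subseteq> {..<L}" "fst ` X \<subseteq> {..<L}" using X by (auto simp: sites_def)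
  ultimately show "\<exists>y0<L. card {v\<in>X. snd v = y0} \<le> 3"
    "\<exists>x0<L. card {v\<in>X. fst v = x0} \<le> 3"
    by blast+
qed

text \<open>A swap outside of the block can be charged an extra 5/3 without destroying
  substochasticity: the critical sum is \<open>5 / 3 * q + s\<close>, at most 5/6 + 1/9. In return
  each such site supplies a factor 3/5.\<close>

definition damped :: "site set \<Rightarrow> site \<Rightarrow> bool \<Rightarrow> bool \<Rightarrow> bool \<Rightarrow> real" where
  "damped A v x y z = wt (x = (v \<in> A)) (y = (v \<in> A)) (z = (v \<in> A)) *
     (5 / 3) ^ of_bool (x \<and> v \<notin> A)"

lemma damped_nonneg: "0 \<le> damped A v x y z"
  unfolding damped_def by (intro mult_nonneg_nonneg wt_nonneg) auto

lemma damped_le_1: "damped A v True y z + damped A v False y z \<le> 1"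
  using p q r_le s_le r_pos s_pos by (auto simp: damped_def agree_weight_def)

lemma damped_prod:
  assumes X: "X \<subseteq> sites L"
  shows "cw L A X = (3 / 5) ^ card (X - A) *
    (\<Prod>v\<in>sites L. damped A v (v \<in> X) (rt L v \<in> X) (up L v \<in> X))"
proof -
  have "{v \<in> sites L. v \<in> X \<and> v \<notin> A} = X - A" using X by auto
  moreover have "(3 / 5 :: real) ^ card (X - A) * (5 / 3) ^ card (X - A) = 1"
    by (simp flip: power_mult_distrib)
  ultimately show ?thesis
    by (simp add: damped_def config_weight_def prod.distrib prod_power_of_bool)
qed

text \<open>A configuration with at least \<open>3 L\<close> spins that are on outside of the block is suppressed
  by a factor that beats the number \<open>4\<^sup>L\<close> of boundary conditions on a cross. Otherwise there is a
  cross on which at most six spins are on, and such crosses have only few boundary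
  conditions.\<close>

definition cross_weight :: "nat \<Rightarrow> nat \<Rightarrow> site set \<Rightarrow> real" where
  "cross_weight L m B = (3 / 5) ^ (3 * L) + (3 / 5) ^ m * 4 ^ 6 * (1 / 4) ^ card B"

lemma cross_weight_nonneg: "0 \<le> cross_weight L m B"
  by (simp add: cross_weight_def)

text \<open>With fewer than \<open>3 * L\<close> swaps outside and at most \<open>L\<close> inside
  of the block, pigeonhole gives a row and a column with at most three swaps each. That at most six
  lie on the cross is then encoded by an exponential Markov bound:
  \<open>4 ^ 6 * (1 / 4) ^ card B\<close> is at least 1 there and sums to a multiple of
  \<open>(5 / 4) ^ card (cross L x0 y0)\<close>. The base 1/4 suffices because 3/5 * (5/4)^2 <
  1.\<close>

lemma cross_weight_ge:
  assumes X: "X \<subseteq> sites L" and A: "card A \<le> L" "finite A" and m: "m \<le> card (X - A)" and L: "0 < L"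
  shows "\<exists>x0<L. \<exists>y0<L. (3 / 5) ^ card (X - A) \<le> cross_weight L m (X \<inter> cross L x0 y0)"
proof (cases "3 * L \<le> card (X - A)")
  case True
  then have "(3 / 5 :: real) ^ card (X - A) \<le> (3 / 5) ^ (3 * L)" by (intro power_decreasing) auto
  also have "\<dots> \<le> cross_weight L m (X \<inter> cross L 0 0)" by (simp add: cross_weight_def)
  finally show ?thesis using L by blast
next
  case False
  have finX: "finite X" using X finite_sites by (rule finite_subset)
  have "card X \<le> card ((X - A) \<union> A)" using finX A by (intro card_mono) auto
  also have "\<dots> \<le> card (X - A) + card A" by (rule card_Un_le)
  finally have "card X < 4 * L" using False A by simp
  then obtain x0 y0 where xy: "x0 < L" "y0 < L" "card {v\<in>X. snd v = y0} \<le> 3"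
      "card {v\<in>X. fst v = x0} \<le> 3"
    using exists_sparse_row[OF X] by blast
  have "card (X \<inter> cross L x0 y0) \<le> card ({v\<in>X. snd v = y0} \<union> {v\<in>X. fst v = x0})"
    using finX by (intro card_mono) (auto simp: cross_def)
  also have "\<dots> \<le> 6" using xy by (intro order_trans[OF card_Un_le]) simp
  finally have "(1 / 4 :: real) ^ 6 \<le> (1 / 4) ^ card (X \<inter> cross L x0 y0)"
    by (intro power_decreasing) auto
  then have "(4 :: real) ^ 6 * (1 / 4) ^ 6 \<le> 4 ^ 6 * (1 / 4) ^ card (X \<inter> cross L x0 y0)"
    by (intro mult_left_mono) auto
  moreover have "(4 :: real) ^ 6 * (1 / 4) ^ 6 = 1" by (simp add: power_divide)
  ultimately have "1 \<le> 4 ^ 6 * (1 / 4 :: real) ^ card (X \<inter> cross L x0 y0)" by linarith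
  then have "(3 / 5) ^ m * 1 \<le> (3 / 5) ^ m * (4 ^ 6 * (1 / 4 :: real) ^ card (X \<inter> cross L x0 y0))"
    by (intro mult_left_mono) auto
  moreover have "(3 / 5 :: real) ^ card (X - A) \<le> (3 / 5) ^ m" using m by (intro power_decreasing) auto
  moreover have "0 \<le> (3 / 5 :: real) ^ (3 * L)" by simp
  ultimately have "(3 / 5) ^ card (X - A) \<le> cross_weight L m (X \<inter> cross L x0 y0)"
    unfolding cross_weight_def by linarith
  then show ?thesis using xy by blast
qed

lemma sum_cross_weight_le:
  "(\<Sum>B\<in>Pow (cross L x0 y0). cross_weight L m B)
    \<le> 4 ^ L * (3 / 5) ^ (3 * L) + (3 / 5) ^ m * 4 ^ 6 * (5 / 4) ^ (2 * L)"
proof -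
  have "(\<Sum>B\<in>Pow (cross L x0 y0). cross_weight L m B) =
     2 ^ card (cross L x0 y0) * (3 / 5) ^ (3 * L) + (3 / 5) ^ m * 4 ^ 6 * (5 / 4) ^ card (cross L x0 y0)"
    using sum_Pow_power_card[of "cross L x0 y0" "1 / 4"]
    by (simp add: cross_weight_def sum.distrib card_Pow flip: sum_distrib_left)
  moreover have "(2 :: real) ^ card (cross L x0 y0) \<le> 2 ^ (2 * L)"
    "(5 / 4 :: real) ^ card (cross L x0 y0) \<le> (5 / 4) ^ (2 * L)"
    using card_cross_le by (intro power_increasing; simp)+
  ultimately show ?thesis
    by (simp add: power_mult) (intro add_mono mult_right_mono mult_left_mono; simp)
qed

text \<open>The favourable cross depends on \<open>X\<close>, so each term is bounded by the sum
  over all crosses; this costs \<open>L\<^sup>2\<close>. For a fixed cross the damped weights are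
  summed out.\<close>

lemma bad_sum_le:
  assumes L: "L = m + l + 1" and large: "l\<^sup>2 \<le> L"
  shows "(\<Sum>X | X \<subseteq> sites L \<and> \<not> zero_at_end L X. cw L (square m l) X)
    \<le> real L ^ 2 * (4 ^ L * (3 / 5) ^ (3 * L) + (3 / 5) ^ m * 4 ^ 6 * (5 / 4) ^ (2 * L))"
proof -
  let ?A = "square m l"
  define W where "W X = (\<Prod>v\<in>sites L. damped ?A v (v \<in> X) (rt L v \<in> X) (up L v \<in> X))" for X
  define G where "G X x0 y0 = cross_weight L m (X \<inter> cross L x0 y0) * W X" for X x0 y0
  have W0: "0 \<le> W X" for X unfolding W_def by (intro prod_nonneg ballI damped_nonneg)
  have G0: "0 \<le> G X x0 y0" for X x0 y0
    unfolding G_def using W0 cross_weight_nonneg by simp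
  have "(\<Sum>X | X \<subseteq> sites L \<and> \<not> zero_at_end L X. cw L ?A X)
     \<le> (\<Sum>X | X \<subseteq> sites L \<and> \<not> zero_at_end L X. \<Sum>x0<L. \<Sum>y0<L. G X x0 y0)"
  proof (intro sum_mono)
    fix X assume "X \<in> {X. X \<subseteq> sites L \<and> \<not> zero_at_end L X}"
    then have X: "X \<subseteq> sites L" "\<not> zero_at_end L X" by auto
    show "cw L ?A X \<le> (\<Sum>x0<L. \<Sum>y0<L. G X x0 y0)"
    proof (cases "cw L ?A X = 0")
      case True
      then show ?thesis using G0 by (simp add: sum_nonneg)
    next
      case False
      have "m \<le> card (X - ?A)" using bad_card_ge[OF X(1) L False X(2)] .
      then obtain x0 y0 where xy: "x0 < L" "y0 < L"
        and le: "(3 / 5) ^ card (X - ?A) \<le> cross_weight L m (X \<inter> cross L x0 y0)"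
        using cross_weight_ge[OF X(1), of ?A m] large L by (auto simp: card_square)
      have "cw L ?A X = (3 / 5) ^ card (X - ?A) * W X"
        unfolding W_def by (rule damped_prod[OF X(1)])
      also have "\<dots> \<le> G X x0 y0"
        unfolding G_def using le W0 by (rule mult_right_mono)
      also have "\<dots> \<le> (\<Sum>y0<L. G X x0 y0)"
        using xy G0 by (intro member_le_sum) auto
      also have "\<dots> \<le> (\<Sum>x0<L. \<Sum>y0<L. G X x0 y0)"
        using xy G0 by (intro member_le_sum[where f = "\<lambda>x0. \<Sum>y0<L. G X x0 y0"] sum_nonneg) auto
      finally show ?thesis .
    qed
  qed
  also have "\<dots> \<le> (\<Sum>X\<in>Pow (sites L). \<Sum>x0<L. \<Sum>y0<L. G X x0 y0)"
    using G0 by (intro sum_mono2) (auto intro!: sum_nonneg)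
  also have "\<dots> = (\<Sum>x0<L. \<Sum>y0<L. \<Sum>X\<in>Pow (sites L). G X x0 y0)"
    by (simp add: sum.swap[of _ "Pow (sites L)"])
  also have "\<dots> \<le> (\<Sum>x0<L. \<Sum>y0<L. \<Sum>B\<in>Pow (cross L x0 y0). cross_weight L m B)"
    unfolding G_def W_def
    by (intro sum_mono torus_sum_le damped_nonneg damped_le_1 cross_weight_nonneg) auto
  also have "\<dots> \<le> (\<Sum>x0<L. \<Sum>y0<L. 4 ^ L * (3 / 5) ^ (3 * L) + (3 / 5) ^ m * 4 ^ 6 * (5 / 4) ^ (2 * L))"
    by (intro sum_mono sum_cross_weight_le)
  finally show ?thesis by (simp add: power2_eq_square mult.assoc)
qed

lemma Z_split: "Z L A = (\<Sum>X | X \<subseteq> sites L \<and> zero_at_end L X. cw L A X) +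
    (\<Sum>X | X \<subseteq> sites L \<and> \<not> zero_at_end L X. cw L A X)"
proof -
  have fin: "finite {X. X \<subseteq> sites L \<and> P X}" for P
    by (rule finite_subset[of _ "Pow (sites L)"]) auto
  have "Pow (sites L) = {X. X \<subseteq> sites L \<and> zero_at_end L X} \<union> {X. X \<subseteq> sites L \<and> \<not> zero_at_end L X}"
    by auto
  then show ?thesis
    unfolding partition_function_def by (simp only:) (rule sum.union_disjoint[OF fin fin], blast)
qed

text \<open>For fixed \<open>l\<close> the main term is a positive constant, while the remainder
  decays like \<open>L\<^sup>2\<close> times powers of 108/125 = 4 (3/5)^3 and 15/16 = 3/5 (5/4)^2.
  It is eventually absorbed by doubling the main term, the source of the constant 2.\<close>

lemma eventually_Z_bounds:
  assumes l: "1 \<le> l"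
  shows "\<forall>\<^sub>F L in sequentially.
     (1 + inverse q * p ^ 4 / 2) powr ((real l - 1)\<^sup>2 / 2) * q ^ (l\<^sup>2) +
      0.7 * (1 + q * p\<^sup>2 / 2) ^ (4 * l - 1) * p ^ (4 * l) \<le> Z L (square (L - l - 1) l) \<and>
     Z L (square (L - l - 1) l) \<le> 2 * (1.91 * q) ^ (l\<^sup>2) + 2 * (2.9 * p) ^ (4 * l)"
proof -
  let ?M = "(1.91 * q) ^ (l\<^sup>2) + (2.9 * p) ^ (4 * l)"
  define err where "err L = real L ^ 2 * (4 ^ L * (3 / 5) ^ (3 * L) +
      (3 / 5) ^ (L - l - 1) * 4 ^ 6 * (5 / 4) ^ (2 * L))" for L
  define K :: real where "K = 4 ^ 6 * (5 / 3) ^ (l + 1)"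
  have "(\<lambda>L. real L ^ 2 * (108 / 125) ^ L) \<longlonglongrightarrow> 0" "(\<lambda>L. real L ^ 2 * (15 / 16) ^ L) \<longlonglongrightarrow> 0"
    by real_asymp+
  then have "(\<lambda>L. real L ^ 2 * (108 / 125) ^ L + K * (real L ^ 2 * (15 / 16) ^ L)) \<longlonglongrightarrow> 0 + K * 0"
    by (intro tendsto_intros)
  then have "(\<lambda>L. real L ^ 2 * ((108 / 125) ^ L + K * (15 / 16) ^ L)) \<longlonglongrightarrow> 0"
    by (simp add: algebra_simps)
  moreover have "0 < ?M" using pos by (simp add: add_pos_pos)
  ultimately have ev: "\<forall>\<^sub>F L in sequentially. real L ^ 2 * ((108 / 125) ^ L + K * (15 / 16) ^ L) < ?M"
    by (rule order_tendstoD(2))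
  have err_eq: "err L = real L ^ 2 * ((108 / 125) ^ L + K * (15 / 16) ^ L)" if "l + 1 \<le> L" for L
  proof -
    have "(4 :: real) ^ L * (3 / 5) ^ (3 * L) = (108 / 125) ^ L"
    proof -
      have "(3 / 5 :: real) ^ (3 * L) = (27 / 125) ^ L" by (simp add: power_mult power3_eq_cube)
      then have "(4 :: real) ^ L * (3 / 5) ^ (3 * L) = (4 * (27 / 125)) ^ L"
        by (simp only: power_mult_distrib)
      then show ?thesis by simp
    qed
    moreover have eq: "(3 / 5 :: real) ^ (L - l - 1) = (5 / 3) ^ (l + 1) * (3 / 5) ^ L"
    proof -
      have "(3 / 5 :: real) ^ L = (3 / 5) ^ (L - l - 1) * (3 / 5) ^ (l + 1)"
        unfolding power_add [symmetric] by (rule arg_cong[where f = "power _"]) (use that in linarith)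
      then have "(5 / 3 :: real) ^ (l + 1) * (3 / 5) ^ L =
          ((5 / 3) ^ (l + 1) * (3 / 5) ^ (l + 1)) * (3 / 5) ^ (L - l - 1)"
        by (simp only: mult_ac)
      then show ?thesis by (simp only: power_mult_distrib [symmetric]) simp
    qed
    moreover have "(3 / 5 :: real) ^ L * (5 / 4) ^ (2 * L) = (15 / 16) ^ L"
    proof -
      have "(5 / 4 :: real) ^ (2 * L) = (25 / 16) ^ L" by (simp add: power_mult power2_eq_square)
      then have "(3 / 5 :: real) ^ L * (5 / 4) ^ (2 * L) = (3 / 5 * (25 / 16)) ^ L"
        by (simp only: power_mult_distrib)
      then show ?thesis by simp
    qed
    moreover have "(3 / 5) ^ (L - l - 1) * 4 ^ 6 * (5 / 4) ^ (2 * L) = K * ((3 / 5) ^ L * (5 / 4) ^ (2 * L))"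
      by (simp only: eq K_def mult_ac)
    ultimately show ?thesis unfolding err_def by (simp only:)
  qed
  show ?thesis
    using ev eventually_ge_at_top[of "l\<^sup>2 + l + 3"]
  proof eventually_elim
    case (elim L)
    define m where "m = L - l - 1"
    have m: "2 \<le> m" "L = m + l + 1" "l\<^sup>2 \<le> L" using elim by (auto simp: m_def)
    have "Z L (square m l) \<le> ?M + err L"
      unfolding Z_split using good_sum_le[OF m(2)] bad_sum_le[OF m(2,3)]
      by (simp add: err_def m_def)
    also have "\<dots> \<le> ?M + ?M" using elim err_eq[of L] by simp
    finally show ?case using Z_ge[OF m(1) l m(2)] by (simp add: m_def)
  qed
qed

end

section \<open>Second moments of the Haar measure\<close>

text \<open>The pairing of two unprimed with two primed indices that belongs to the identity
  (\<open>False\<close>) or to the swap (\<open>True\<close>).\<close>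

definition pairing :: "bool \<Rightarrow> nat \<Rightarrow> nat \<Rightarrow> nat \<Rightarrow> nat \<Rightarrow> bool" where
  "pairing \<sigma> i1 i2 k1 k2 = (if \<sigma> then i1 = k2 \<and> i2 = k1 else i1 = k1 \<and> i2 = k2)"

text \<open>The Weingarten function of two copies of \<open>U(n)\<close>; the argument tells whether the
  two permutations agree.\<close>

definition weingarten :: "nat \<Rightarrow> bool \<Rightarrow> real" where
  "weingarten n same = (if same then 1 / (real n ^ 2 - 1) else - 1 / (real n * (real n ^ 2 - 1)))"

lemma mult_mat_entry:
  assumes "A \<in> carrier_mat n n" "B \<in> carrier_mat n n" "i < n" "j < n"
  shows "(A * B) $$ (i, j) = (\<Sum>k<n. A $$ (i, k) * B $$ (k, j))"
  using assms by (auto simp: scalar_prod_def atLeast0LessThan intro!: sum.cong)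

lemma adjoint_mult_entry:
  fixes W :: "complex mat"
  assumes "W \<in> carrier_mat n n" "i < n" "j < n"
  shows "(mat_adjoint W * W) $$ (i, j) = (\<Sum>k<n. cnj (W $$ (k, i)) * W $$ (k, j))"
  using assms by (auto simp: mat_adjoint_def scalar_prod_def atLeast0LessThan intro!: sum.cong)

lemma mat_adjoint_mult_carrier:
  fixes W :: "complex mat"
  assumes "W \<in> carrier_mat n n"
  shows "mat_adjoint W * W \<in> carrier_mat n n"
  using assms by (auto simp: mat_adjoint_def)

lemma unitary_group_iff:
  "W \<in> unitary_group n \<longleftrightarrow> W \<in> carrier_mat n n \<and>
     (\<forall>i<n. \<forall>j<n. (\<Sum>k<n. cnj (W $$ (k, i)) * W $$ (k, j)) = of_bool (i = j))"
proof (cases "W \<in> carrier_mat n n")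
  case True
  have "mat_adjoint W * W = 1\<^sub>m n \<longleftrightarrow>
      (\<forall>i<n. \<forall>j<n. (mat_adjoint W * W) $$ (i, j) = of_bool (i = j))"
    using mat_adjoint_mult_carrier[OF True] by (auto simp: mat_eq_iff of_bool_def)
  then show ?thesis using True by (simp add: unitary_group_def adjoint_mult_entry)
qed (simp add: unitary_group_def)

lemma unitary_group_mult:
  assumes V: "V \<in> unitary_group n" and W: "W \<in> unitary_group n"
  shows "V * W \<in> unitary_group n"
proof -
  note c = V[unfolded unitary_group_iff, THEN conjunct1] W[unfolded unitary_group_iff, THEN conjunct1]
  note VV = V[unfolded unitary_group_iff, THEN conjunct2, rule_format]
  note WW = W[unfolded unitary_group_iff, THEN conjunct2, rule_format]
  have "(\<Sum>k<n. cnj ((V * W) $$ (k, i)) * (V * W) $$ (k, j)) = of_bool (i = j)"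
    if ij: "i < n" "j < n" for i j
  proof -
    have "(\<Sum>k<n. cnj ((V * W) $$ (k, i)) * (V * W) $$ (k, j)) =
        (\<Sum>k<n. \<Sum>a<n. \<Sum>b<n. cnj (W $$ (a, i)) * W $$ (b, j) * (cnj (V $$ (k, a)) * V $$ (k, b)))"
    proof (rule sum.cong)
      fix k assume "k \<in> {..<n}"
      then have e: "(V * W) $$ (k, i) = (\<Sum>a<n. V $$ (k, a) * W $$ (a, i))"
        "(V * W) $$ (k, j) = (\<Sum>b<n. V $$ (k, b) * W $$ (b, j))"
        using mult_mat_entry[OF c] ij by simp_all
      show "cnj ((V * W) $$ (k, i)) * (V * W) $$ (k, j) =
          (\<Sum>a<n. \<Sum>b<n. cnj (W $$ (a, i)) * W $$ (b, j) * (cnj (V $$ (k, a)) * V $$ (k, b)))"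
        unfolding e cnj_sum complex_cnj_mult sum_product by (simp only: mult_ac)
    qed simp
    also have "\<dots> = (\<Sum>a<n. \<Sum>k<n. \<Sum>b<n. cnj (W $$ (a, i)) * W $$ (b, j) * (cnj (V $$ (k, a)) * V $$ (k, b)))"
      by (rule sum.swap)
    also have "\<dots> = (\<Sum>a<n. \<Sum>b<n. \<Sum>k<n. cnj (W $$ (a, i)) * W $$ (b, j) * (cnj (V $$ (k, a)) * V $$ (k, b)))"
      by (intro sum.cong refl sum.swap)
    also have "\<dots> = (\<Sum>a<n. \<Sum>b<n. cnj (W $$ (a, i)) * W $$ (b, j) * of_bool (a = b))"
      using VV by (intro sum.cong refl) (simp flip: sum_distrib_left)
    also have "\<dots> = (\<Sum>a<n. cnj (W $$ (a, i)) * W $$ (a, j))"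
      by (intro sum.cong refl) (simp add: of_bool_def if_distrib cong: if_cong)
    also have "\<dots> = of_bool (i = j)" using WW ij by simp
    finally show ?thesis .
  qed
  then show ?thesis using c by (simp add: unitary_group_iff)
qed

section \<open>Unitaries that probe the invariance\<close>

text \<open>Left multiplication replaces row \<open>i\<close> by \<open>c i\<close> times row
  \<open>\<pi> i\<close>, so that one family provides both permutations and phases.\<close>

definition monomial_mat :: "nat \<Rightarrow> (nat \<Rightarrow> nat) \<Rightarrow> (nat \<Rightarrow> complex) \<Rightarrow> complex mat" where
  "monomial_mat n \<pi> c = Matrix.mat n n (\<lambda>(i, k). if k = \<pi> i then c i else 0)"

lemma monomial_mat_unitary:
  assumes \<pi>: "bij_betw \<pi> {..<n} {..<n}" and c: "\<And>i. i < n \<Longrightarrow> cnj (c i) * c i = 1"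
  shows "monomial_mat n \<pi> c \<in> unitary_group n"
proof -
  have "(\<Sum>k<n. cnj (monomial_mat n \<pi> c $$ (k, i)) * monomial_mat n \<pi> c $$ (k, j)) = of_bool (i = j)"
    if ij: "i < n" "j < n" for i j
  proof -
    have "(\<Sum>k<n. cnj (monomial_mat n \<pi> c $$ (k, i)) * monomial_mat n \<pi> c $$ (k, j)) =
        (\<Sum>k<n. of_bool (i = \<pi> k \<and> j = \<pi> k))"
      using ij c by (intro sum.cong refl) (auto simp: monomial_mat_def)
    also have "\<dots> = (\<Sum>k<n. of_bool (i = k \<and> j = k))"
      using sum.reindex_bij_betw[OF \<pi>, of "\<lambda>k. of_bool (i = k \<and> j = k)"] .
    also have "\<dots> = of_bool (i = j)"
      using ij by (cases "i = j") (auto simp: of_bool_def intro!: sum.neutral)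
    finally show ?thesis .
  qed
  then show ?thesis by (simp add: unitary_group_iff monomial_mat_def)
qed

lemma monomial_mat_mult_entry:
  assumes "bij_betw \<pi> {..<n} {..<n}" "W \<in> carrier_mat n n" "i < n" "j < n"
  shows "(monomial_mat n \<pi> c * W) $$ (i, j) = c i * W $$ (\<pi> i, j)"
proof -
  have "\<pi> i < n" using assms by (auto dest: bij_betwE)
  have "(monomial_mat n \<pi> c * W) $$ (i, j) = (\<Sum>k<n. monomial_mat n \<pi> c $$ (i, k) * W $$ (k, j))"
    using assms by (intro mult_mat_entry) (auto simp: monomial_mat_def)
  also have "\<dots> = (\<Sum>k<n. if k = \<pi> i then c i * W $$ (k, j) else 0)"
    using assms by (intro sum.cong refl) (simp add: monomial_mat_def)
  also have "\<dots> = c i * W $$ (\<pi> i, j)" using \<open>\<pi> i < n\<close> by simp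
  finally show ?thesis .
qed

text \<open>A Hadamard block on the first two coordinates and the identity elsewhere. Permutations
  and phases cannot relate the moment with four equal row indices to the others; this matrix
  does.\<close>

definition hadamard_mat :: "nat \<Rightarrow> complex mat" where
  "hadamard_mat n = Matrix.mat n n (\<lambda>(i, k). if i < 2 \<and> k < 2
     then complex_of_real (if i = 1 \<and> k = 1 then - sqrt (1/2) else sqrt (1/2)) else of_bool (i = k))"

lemma sum_lessThan_split2:
  fixes n :: nat
  assumes "2 \<le> n"
  shows "(\<Sum>k<n. f k) = f 0 + f 1 + (\<Sum>k\<in>{2..<n}. f k :: complex)"
proof -
  have "{..<n} = insert 0 (insert 1 {2..<n})" using assms by auto
  then show ?thesis by (simp add: add.assoc)
qed

lemma half_sq: "complex_of_real (sqrt (1/2)) * complex_of_real (sqrt (1/2)) = 1 / 2"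
  by (simp flip: of_real_mult)

lemma hadamard_mat_unitary:
  assumes n: "2 \<le> n"
  shows "hadamard_mat n \<in> unitary_group n"
proof -
  let ?h = "complex_of_real (sqrt (1/2))"
  have h: "?h * ?h + ?h * ?h = 1" by (simp only: half_sq) simp
  have "(\<Sum>k<n. cnj (hadamard_mat n $$ (k, i)) * hadamard_mat n $$ (k, j)) = of_bool (i = j)"
    if ij: "i < n" "j < n" for i j
  proof -
    have *: "(\<Sum>k\<in>{2..<n}. cnj (hadamard_mat n $$ (k, i)) * hadamard_mat n $$ (k, j)) =
      of_bool (i = j \<and> 2 \<le> i)"
    proof -
      have "(\<Sum>k\<in>{2..<n}. cnj (hadamard_mat n $$ (k, i)) * hadamard_mat n $$ (k, j)) =
        (\<Sum>k\<in>{2..<n}. if k = i then of_bool (i = j) else 0)"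
        using ij by (intro sum.cong refl) (auto simp: hadamard_mat_def)
      also have "\<dots> = of_bool (i = j \<and> 2 \<le> i)" using ij by auto
      finally show ?thesis .
    qed
    show ?thesis
      unfolding sum_lessThan_split2[OF n] *
      using ij n h by (cases "i = 0"; cases "i = 1"; cases "j = 0"; cases "j = 1")
        (auto simp: hadamard_mat_def simp del: of_real_mult)
  qed
  then show ?thesis by (simp add: unitary_group_iff hadamard_mat_def)
qed

lemma hadamard_mat_mult_entry:
  assumes n: "2 \<le> n" and W: "W \<in> carrier_mat n n" and j: "j < n"
  shows "(hadamard_mat n * W) $$ (0, j) = complex_of_real (sqrt (1/2)) * (W $$ (0, j) + W $$ (1, j))"
proof -
  have "(hadamard_mat n * W) $$ (0, j) = (\<Sum>k<n. hadamard_mat n $$ (0, k) * W $$ (k, j))"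
    using assms by (intro mult_mat_entry) (auto simp: hadamard_mat_def)
  also have "\<dots> = complex_of_real (sqrt (1/2)) * W $$ (0, j) + complex_of_real (sqrt (1/2)) * W $$ (1, j)"
  proof -
    have "(\<Sum>k\<in>{2..<n}. hadamard_mat n $$ (0, k) * W $$ (k, j)) = 0"
      by (intro sum.neutral) (auto simp: hadamard_mat_def)
    then show ?thesis unfolding sum_lessThan_split2[OF n] using n by (simp add: hadamard_mat_def)
  qed
  finally show ?thesis by (simp add: algebra_simps)
qed

lemma integral_sum2:
  fixes f :: "'i \<Rightarrow> 'k \<Rightarrow> 'a \<Rightarrow> complex"
  assumes "\<And>i k. i \<in> I \<Longrightarrow> k \<in> K \<Longrightarrow> integrable M (f i k)"
  shows "(\<integral>x. (\<Sum>i\<in>I. \<Sum>k\<in>K. f i k x) \<partial>M) = (\<Sum>i\<in>I. \<Sum>k\<in>K. \<integral>x. f i k x \<partial>M)"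
  using assms
  by (subst Bochner_Integration.integral_sum)
    (auto intro!: Bochner_Integration.integrable_sum sum.cong Bochner_Integration.integral_sum)

section \<open>Invariance determines the second moments\<close>

locale haar =
  fixes n :: nat and \<mu> :: "complex mat measure"
  assumes haar: "haar_measure n \<mu>" and n: "2 \<le> n"

sublocale haar \<subseteq> prob_space \<mu>
  using haar by (simp add: haar_measure_def)

context haar
begin

lemma sets_haar: "sets \<mu> = sets (unitary_borel n)"
  using haar by (simp add: haar_measure_def)

lemma space_haar: "space \<mu> = unitary_group n"
  using sets_eq_imp_space_eq[OF sets_haar] by (simp add: unitary_borel_def)

lemma carrier_haar: "W \<in> space \<mu> \<Longrightarrow> W \<in> carrier_mat n n"
  by (simp add: space_haar unitary_group_def)

lemma measurable_entry [measurable]: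
  assumes "i < n" "j < n"
  shows "(\<lambda>W. W $$ (i, j)) \<in> borel_measurable \<mu>"
proof -
  have "(\<lambda>W. \<lambda>p\<in>{..<n} \<times> {..<n}. W $$ p) \<in> measurable (unitary_borel n) (\<Pi>\<^sub>M p\<in>{..<n} \<times> {..<n}. borel)"
    unfolding unitary_borel_def by (rule measurable_vimage_algebra1) (auto simp: space_PiM)
  then have "(\<lambda>W. (\<lambda>p\<in>{..<n} \<times> {..<n}. W $$ p) (i, j)) \<in> borel_measurable (unitary_borel n)"
    by (rule measurable_compose[OF _ measurable_component_singleton]) (use assms in auto)
  then show ?thesis
    using assms sets_haar by (simp cong: measurable_cong_sets)
qed

lemma measurable_mult_left:
  assumes V: "V \<in> unitary_group n"
  shows "(\<lambda>W. V * W) \<in> measurable \<mu> \<mu>"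
proof -
  have Vc: "V \<in> carrier_mat n n" using V by (simp add: unitary_group_def)
  have "(\<lambda>W. V * W) \<in> measurable \<mu> (unitary_borel n)"
    unfolding unitary_borel_def
  proof (rule measurable_vimage_algebra2)
    show "(\<lambda>W. V * W) \<in> space \<mu> \<rightarrow> unitary_group n"
      using V by (auto simp: space_haar unitary_group_mult)
    show "(\<lambda>W. \<lambda>p\<in>{..<n} \<times> {..<n}. (V * W) $$ p) \<in> measurable \<mu> (\<Pi>\<^sub>M p\<in>{..<n} \<times> {..<n}. borel)"
    proof (rule measurable_restrict)
      fix p assume "p \<in> {..<n} \<times> {..<n}"
      then obtain i j where p: "p = (i, j)" "i < n" "j < n" by auto
      have "(\<lambda>W. \<Sum>k<n. V $$ (i, k) * W $$ (k, j)) \<in> borel_measurable \<mu>"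
        using p by measurable
      then show "(\<lambda>W. (V * W) $$ p) \<in> borel_measurable \<mu>"
        using p Vc by (subst measurable_cong[of _ _ "\<lambda>W. \<Sum>k<n. V $$ (i, k) * W $$ (k, j)"])
          (auto simp: mult_mat_entry carrier_haar)
    qed
  qed
  then show ?thesis using sets_haar by (simp cong: measurable_cong_sets)
qed

lemma integral_mult_left:
  fixes f :: "complex mat \<Rightarrow> complex"
  assumes V: "V \<in> unitary_group n" and f: "f \<in> borel_measurable \<mu>"
  shows "(\<integral>W. f (V * W) \<partial>\<mu>) = (\<integral>W. f W \<partial>\<mu>)"
proof -
  have "distr \<mu> \<mu> (\<lambda>W. V * W) = \<mu>" using haar V by (simp add: haar_measure_def)
  then show ?thesis using integral_distr[OF measurable_mult_left[OF V] f] by simp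
qed

lemma column_orthonormal:
  assumes "W \<in> space \<mu>" "i < n" "j < n"
  shows "(\<Sum>k<n. cnj (W $$ (k, i)) * W $$ (k, j)) = of_bool (i = j)"
  using assms by (simp add: space_haar unitary_group_iff)

lemma norm_entry_le_1:
  assumes W: "W \<in> space \<mu>" and ij: "i < n" "j < n"
  shows "norm (W $$ (i, j)) \<le> 1"
proof -
  have "complex_of_real (\<Sum>k<n. (norm (W $$ (k, j)))\<^sup>2) = 1"
    unfolding of_real_sum complex_norm_square
    using column_orthonormal[OF W ij(2) ij(2)] by (simp add: mult.commute)
  then have "(\<Sum>k<n. (norm (W $$ (k, j)))\<^sup>2) = 1" by (simp only: of_real_eq_1_iff)
  moreover have "(norm (W $$ (i, j)))\<^sup>2 \<le> (\<Sum>k<n. (norm (W $$ (k, j)))\<^sup>2)"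
    using ij by (intro member_le_sum) auto
  ultimately have "(norm (W $$ (i, j)))\<^sup>2 \<le> 1\<^sup>2" by simp
  then show ?thesis by (rule power2_le_imp_le) simp
qed

text \<open>Row indices come first and column indices last: left multiplication acts on rows only,
  so the moments are studied as functions of the rows with the columns held fixed.\<close>

definition quartic :: "nat \<Rightarrow> nat \<Rightarrow> nat \<Rightarrow> nat \<Rightarrow> nat \<Rightarrow> nat \<Rightarrow> nat \<Rightarrow> nat \<Rightarrow> complex mat \<Rightarrow> complex" where
  "quartic i1 i2 k1 k2 j1 j2 l1 l2 W =
     W $$ (i1, j1) * W $$ (i2, j2) * cnj (W $$ (k1, l1)) * cnj (W $$ (k2, l2))"

lemma measurable_quartic [measurable]:
  assumes "i1 < n" "i2 < n" "k1 < n" "k2 < n" "j1 < n" "j2 < n" "l1 < n" "l2 < n"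
  shows "quartic i1 i2 k1 k2 j1 j2 l1 l2 \<in> borel_measurable \<mu>"
proof -
  have [measurable]: "cnj \<in> borel_measurable borel"
    by (intro borel_measurable_continuous_onI continuous_intros)
  show ?thesis unfolding quartic_def [abs_def] using assms by measurable
qed

lemma integrable_quartic:
  assumes "i1 < n" "i2 < n" "k1 < n" "k2 < n" "j1 < n" "j2 < n" "l1 < n" "l2 < n"
  shows "integrable \<mu> (quartic i1 i2 k1 k2 j1 j2 l1 l2)"
proof (rule integrable_const_bound[where B = 1])
  show "AE W in \<mu>. norm (quartic i1 i2 k1 k2 j1 j2 l1 l2 W) \<le> 1"
  proof (rule AE_I2)
    fix W assume W: "W \<in> space \<mu>"
    have "norm (quartic i1 i2 k1 k2 j1 j2 l1 l2 W) \<le> 1 * 1 * 1 * 1"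
      unfolding quartic_def norm_mult complex_mod_cnj
      using assms norm_entry_le_1[OF W] by (intro mult_mono mult_nonneg_nonneg norm_ge_zero) auto
    then show "norm (quartic i1 i2 k1 k2 j1 j2 l1 l2 W) \<le> 1" by simp
  qed
qed (use assms in measurable)

lemma moment_eqI:
  assumes V: "V \<in> unitary_group n"
    and "i1 < n" "i2 < n" "k1 < n" "k2 < n" "j1 < n" "j2 < n" "l1 < n" "l2 < n"
    and eq: "\<And>W. W \<in> space \<mu> \<Longrightarrow> quartic i1 i2 k1 k2 j1 j2 l1 l2 (V * W) = g W"
  shows "(\<integral>W. quartic i1 i2 k1 k2 j1 j2 l1 l2 W \<partial>\<mu>) = (\<integral>W. g W \<partial>\<mu>)"
proof -
  have "(\<integral>W. quartic i1 i2 k1 k2 j1 j2 l1 l2 (V * W) \<partial>\<mu>) = (\<integral>W. g W \<partial>\<mu>)"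
    by (intro Bochner_Integration.integral_cong refl eq)
  then show ?thesis using assms integral_mult_left[OF V] by simp
qed

context
  fixes j1 j2 l1 l2 :: nat
  assumes jl: "j1 < n" "j2 < n" "l1 < n" "l2 < n"
begin

definition moment :: "nat \<Rightarrow> nat \<Rightarrow> nat \<Rightarrow> nat \<Rightarrow> complex" where
  "moment i1 i2 k1 k2 = (\<integral>W. quartic i1 i2 k1 k2 j1 j2 l1 l2 W \<partial>\<mu>)"

lemma moment_permute:
  assumes "i1 < n" "i2 < n" "k1 < n" "k2 < n" and \<pi>: "bij_betw \<pi> {..<n} {..<n}"
  shows "moment i1 i2 k1 k2 = moment (\<pi> i1) (\<pi> i2) (\<pi> k1) (\<pi> k2)"
  unfolding moment_def
proof (rule moment_eqI)
  show "monomial_mat n \<pi> (\<lambda>_. 1) \<in> unitary_group n"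
    using \<pi> by (intro monomial_mat_unitary) auto
qed (use assms jl in \<open>auto simp: quartic_def monomial_mat_mult_entry carrier_haar\<close>)

text \<open>Multiplying row \<open>a\<close> by \<open>\<i>\<close> multiplies the moment by a power of \<open>\<i>\<close> with exponent between
  \<open>-2\<close> and \<open>2\<close>, which is \<open>1\<close> only for exponent \<open>0\<close>.\<close>

lemma moment_phase:
  assumes ik: "i1 < n" "i2 < n" "k1 < n" "k2 < n" and a: "a < n"
    and nz: "moment i1 i2 k1 k2 \<noteq> 0"
  shows "of_bool (i1 = a) + of_bool (i2 = a) = (of_bool (k1 = a) + of_bool (k2 = a) :: nat)"
proof -
  define c where "c = (\<lambda>i. if i = a then \<i> else 1)"
  have "moment i1 i2 k1 k2 = (\<integral>W. (c i1 * c i2 * cnj (c k1) * cnj (c k2)) * quartic i1 i2 k1 k2 j1 j2 l1 l2 W \<partial>\<mu>)"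
    unfolding moment_def
  proof (rule moment_eqI)
    show "monomial_mat n (\<lambda>i. i) c \<in> unitary_group n"
      by (intro monomial_mat_unitary) (auto simp: c_def bij_betw_def)
  qed (use assms jl in \<open>auto simp: quartic_def monomial_mat_mult_entry carrier_haar bij_betw_def\<close>)
  also have "\<dots> = (c i1 * c i2 * cnj (c k1) * cnj (c k2)) * moment i1 i2 k1 k2"
    unfolding moment_def by (rule integral_mult_right_zero)
  finally have "c i1 * c i2 * cnj (c k1) * cnj (c k2) = 1" using nz by simp
  then show ?thesis
    by (cases "i1 = a"; cases "i2 = a"; cases "k1 = a"; cases "k2 = a") (auto simp: c_def complex_eq_iff)
qed

text \<open>Counting phases at \<open>i1\<close> and at \<open>i2\<close> forces
  \<open>{i1, i2}\<close> and \<open>{k1, k2}\<close> to agree as multisets.\<close>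

lemma moment_eq_0:
  assumes "i1 < n" "i2 < n" "k1 < n" "k2 < n"
    and "\<not> pairing False i1 i2 k1 k2" "\<not> pairing True i1 i2 k1 k2"
  shows "moment i1 i2 k1 k2 = 0"
proof (rule ccontr)
  assume nz: "moment i1 i2 k1 k2 \<noteq> 0"
  show False
    using moment_phase[OF assms(1-4) assms(1) nz] moment_phase[OF assms(1-4) assms(2) nz] assms(5,6)
    by (cases "i1 = i2"; cases "i1 = k1"; cases "i1 = k2"; cases "i2 = k1"; cases "i2 = k2")
      (auto simp: pairing_def)
qed

text \<open>Permutations act transitively on ordered pairs of distinct indices; two transpositions
  bring \<open>(a, b)\<close> to \<open>(0, 1)\<close>.\<close>

lemma transposition_invariant:
  fixes G :: "nat \<Rightarrow> nat \<Rightarrow> 'b"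
  assumes inv: "\<And>a b \<pi>. a < n \<Longrightarrow> b < n \<Longrightarrow> bij_betw \<pi> {..<n} {..<n} \<Longrightarrow> G a b = G (\<pi> a) (\<pi> b)"
    and ab: "a < n" "b < n" "a \<noteq> b"
  shows "G a b = G 0 1"
proof -
  define t where "t = (\<lambda>x y i :: nat. if i = x then y else if i = y then x else i)"
  have t: "bij_betw (t x y) {..<n} {..<n}" if "x < n" "y < n" for x y
    by (rule bij_betwI[where g = "t x y"]) (use that in \<open>auto simp: t_def\<close>)
  define b' where "b' = t a 0 b"
  have b': "b' < n" "b' \<noteq> 0" using ab n by (auto simp: b'_def t_def)
  have "G a b = G (t a 0 a) (t a 0 b)" using ab n by (intro inv t) auto
  also have "\<dots> = G 0 b'" by (simp add: t_def b'_def)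
  also have "\<dots> = G (t b' 1 0) (t b' 1 b')" using b' n by (intro inv t) auto
  also have "\<dots> = G 0 1" using b' by (simp add: t_def)
  finally show ?thesis .
qed

lemma moment_diag:
  assumes "a < n"
  shows "moment a a a a = moment 0 0 0 0"
proof -
  define t where "t = (\<lambda>i :: nat. if i = a then 0 else if i = 0 then a else i)"
  have "bij_betw t {..<n} {..<n}"
    by (rule bij_betwI[where g = t]) (use assms n in \<open>auto simp: t_def\<close>)
  then have "moment a a a a = moment (t a) (t a) (t a) (t a)"
    using assms by (intro moment_permute)
  then show ?thesis by (simp add: t_def)
qed

text \<open>The Hadamard block expands \<open>moment 0 0 0 0\<close> into 16 moments with
  coefficient 1/4. Six of them survive, in three equal pairs, and one pair is the original moment
  again; solving for it gives the claim.\<close>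

lemma moment_rotate:
  "moment 0 0 0 0 = moment 0 1 0 1 + moment 0 1 1 0"
proof -
  let ?Q = "\<lambda>a b c d. quartic a b c d j1 j2 l1 l2"
  let ?h = "complex_of_real (sqrt (1/2))"
  have n0: "0 < n" "1 < n" using n by auto
  have int: "integrable \<mu> (?Q a b c d)" if "a < 2" "b < 2" "c < 2" "d < 2" for a b c d
    using that n jl by (intro integrable_quartic) auto
  have h4: "?h * ?h * ?h * ?h = 1 / 4"
  proof -
    have "?h * ?h * ?h * ?h = (?h * ?h) * (?h * ?h)" by (simp only: mult.assoc)
    then show ?thesis unfolding half_sq by simp
  qed
  have "moment 0 0 0 0 = (\<integral>W. (1 / 4) * (\<Sum>a<2. \<Sum>b<2. \<Sum>c<2. \<Sum>d<2. ?Q a b c d W) \<partial>\<mu>)"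
    unfolding moment_def
  proof (rule moment_eqI[OF hadamard_mat_unitary[OF n]])
    fix W assume "W \<in> space \<mu>"
    then have W: "W \<in> carrier_mat n n" by (rule carrier_haar)
    have "?Q 0 0 0 0 (hadamard_mat n * W) = (?h * ?h * ?h * ?h) *
      ((W $$ (0, j1) + W $$ (1, j1)) * (W $$ (0, j2) + W $$ (1, j2)) *
       cnj (W $$ (0, l1) + W $$ (1, l1)) * cnj (W $$ (0, l2) + W $$ (1, l2)))"
      unfolding quartic_def using hadamard_mat_mult_entry[OF n W] jl
      by (simp del: of_real_mult)
    also have "\<dots> = (1 / 4) * (\<Sum>a<2. \<Sum>b<2. \<Sum>c<2. \<Sum>d<2. ?Q a b c d W)"
      unfolding h4 by (simp add: quartic_def numeral_2_eq_2 algebra_simps)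
    finally show "?Q 0 0 0 0 (hadamard_mat n * W) = (1 / 4) * (\<Sum>a<2. \<Sum>b<2. \<Sum>c<2. \<Sum>d<2. ?Q a b c d W)" .
  qed (use n0 jl in auto)
  also have "\<dots> = (1 / 4) * (\<Sum>a<2. \<Sum>b<2. \<Sum>c<2. \<Sum>d<2. moment a b c d)"
  proof -
    have "(\<integral>W. (\<Sum>a<2. \<Sum>b<2. \<Sum>c<2. \<Sum>d<2. ?Q a b c d W) \<partial>\<mu>) =
        (\<Sum>a<2. \<Sum>b<2. \<integral>W. (\<Sum>c<2. \<Sum>d<2. ?Q a b c d W) \<partial>\<mu>)"
      by (intro integral_sum2 Bochner_Integration.integrable_sum int) auto
    also have "\<dots> = (\<Sum>a<2. \<Sum>b<2. \<Sum>c<2. \<Sum>d<2. moment a b c d)"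
      unfolding moment_def by (intro sum.cong refl integral_sum2 int) auto
    finally show ?thesis by (simp only: integral_mult_right_zero)
  qed
  also have "(\<Sum>a<2. \<Sum>b<2. \<Sum>c<2. \<Sum>d<2. moment a b c d) =
      (moment 0 0 0 0 + moment 1 1 1 1) + (moment 0 1 0 1 + moment 1 0 1 0) + (moment 0 1 1 0 + moment 1 0 0 1)"
    using n0 by (simp add: numeral_2_eq_2 moment_eq_0 pairing_def)
  also have "moment 1 1 1 1 = moment 0 0 0 0" using n0 by (intro moment_diag)
  also have "moment 1 0 1 0 = moment 0 1 0 1"
    by (rule transposition_invariant[where G = "\<lambda>a b. moment a b a b"]) (use n0 moment_permute in auto)
  also have "moment 1 0 0 1 = moment 0 1 1 0"
    by (rule transposition_invariant[where G = "\<lambda>a b. moment a b b a"]) (use n0 moment_permute in auto)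
  finally show ?thesis by (auto simp: complex_eq_iff)
qed

text \<open>For \<open>i1 = i2\<close> both pairings may hold at once, and
  \<open>moment_rotate\<close> says precisely that the diagonal value is then the sum of the two
  coefficients.\<close>

lemma moment_form:
  assumes "i1 < n" "i2 < n" "k1 < n" "k2 < n"
  shows "moment i1 i2 k1 k2 = moment 0 1 0 1 * of_bool (pairing False i1 i2 k1 k2) +
           moment 0 1 1 0 * of_bool (pairing True i1 i2 k1 k2)"
proof (cases "i1 = i2")
  case True
  then show ?thesis
    using moment_eq_0[OF assms] moment_diag[OF assms(1)] moment_rotate
    by (cases "k1 = i1 \<and> k2 = i1") (auto simp: pairing_def)
next
  case False
  have "moment i1 i2 i1 i2 = moment 0 1 0 1"
    by (rule transposition_invariant[where G = "\<lambda>a b. moment a b a b"])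
      (use False assms moment_permute in auto)
  moreover have "moment i1 i2 i2 i1 = moment 0 1 1 0"
    by (rule transposition_invariant[where G = "\<lambda>a b. moment a b b a"])
      (use False assms moment_permute in auto)
  ultimately show ?thesis
    using moment_eq_0[OF assms] False
    by (cases "pairing False i1 i2 k1 k2"; cases "pairing True i1 i2 k1 k2") (auto simp: pairing_def)
qed

text \<open>Contracting the row indices leaves inner products of columns, which orthonormality
  evaluates pointwise, before averaging.\<close>

lemma moment_contract:
  "(\<Sum>i1<n. \<Sum>i2<n. moment i1 i2 i1 i2) = of_bool (pairing False j1 j2 l1 l2)"
  "(\<Sum>i1<n. \<Sum>i2<n. moment i1 i2 i2 i1) = of_bool (pairing True j1 j2 l1 l2)"
proof -
  have "(\<Sum>i1<n. \<Sum>i2<n. moment i1 i2 i1 i2) =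
      (\<integral>W. (\<Sum>i1<n. \<Sum>i2<n. quartic i1 i2 i1 i2 j1 j2 l1 l2 W) \<partial>\<mu>)"
    unfolding moment_def using jl by (intro integral_sum2 [symmetric] integrable_quartic) auto
  also have "\<dots> = (\<integral>W. of_bool (pairing False j1 j2 l1 l2) \<partial>\<mu>)"
  proof (intro Bochner_Integration.integral_cong refl)
    fix W assume W: "W \<in> space \<mu>"
    have "(\<Sum>i1<n. \<Sum>i2<n. quartic i1 i2 i1 i2 j1 j2 l1 l2 W) =
      (\<Sum>i<n. cnj (W $$ (i, l1)) * W $$ (i, j1)) * (\<Sum>i<n. cnj (W $$ (i, l2)) * W $$ (i, j2))"
      unfolding quartic_def sum_product by (intro sum.cong refl) (simp add: mult_ac)
    also have "\<dots> = of_bool (pairing False j1 j2 l1 l2)"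
      using W jl by (auto simp: column_orthonormal pairing_def)
    finally show "(\<Sum>i1<n. \<Sum>i2<n. quartic i1 i2 i1 i2 j1 j2 l1 l2 W) = of_bool (pairing False j1 j2 l1 l2)" .
  qed
  also have "\<dots> = of_bool (pairing False j1 j2 l1 l2)" by (simp add: prob_space)
  finally show "(\<Sum>i1<n. \<Sum>i2<n. moment i1 i2 i1 i2) = of_bool (pairing False j1 j2 l1 l2)" .
  have "(\<Sum>i1<n. \<Sum>i2<n. moment i1 i2 i2 i1) =
      (\<integral>W. (\<Sum>i1<n. \<Sum>i2<n. quartic i1 i2 i2 i1 j1 j2 l1 l2 W) \<partial>\<mu>)"
    unfolding moment_def using jl by (intro integral_sum2 [symmetric] integrable_quartic) auto
  also have "\<dots> = (\<integral>W. of_bool (pairing True j1 j2 l1 l2) \<partial>\<mu>)"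
  proof (intro Bochner_Integration.integral_cong refl)
    fix W assume W: "W \<in> space \<mu>"
    have "(\<Sum>i1<n. \<Sum>i2<n. quartic i1 i2 i2 i1 j1 j2 l1 l2 W) =
      (\<Sum>i<n. cnj (W $$ (i, l2)) * W $$ (i, j1)) * (\<Sum>i<n. cnj (W $$ (i, l1)) * W $$ (i, j2))"
      unfolding quartic_def sum_product by (intro sum.cong refl) (simp add: mult_ac)
    also have "\<dots> = of_bool (pairing True j1 j2 l1 l2)"
      using W jl by (auto simp: column_orthonormal pairing_def)
    finally show "(\<Sum>i1<n. \<Sum>i2<n. quartic i1 i2 i2 i1 j1 j2 l1 l2 W) = of_bool (pairing True j1 j2 l1 l2)" .
  qed
  also have "\<dots> = of_bool (pairing True j1 j2 l1 l2)" by (simp add: prob_space)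
  finally show "(\<Sum>i1<n. \<Sum>i2<n. moment i1 i2 i2 i1) = of_bool (pairing True j1 j2 l1 l2)" .
qed

text \<open>The two contractions of \<open>moment_form\<close> yield a linear system with the Gram
  matrix of the two pairings, entries \<open>N * N\<close> and \<open>N\<close>; the Weingarten
  function is its inverse.\<close>

lemma moment_coefficients:
  "moment 0 1 0 1 = (\<Sum>\<tau>\<in>UNIV. weingarten n (False = \<tau>) * of_bool (pairing \<tau> j1 j2 l1 l2))"
  "moment 0 1 1 0 = (\<Sum>\<tau>\<in>UNIV. weingarten n (True = \<tau>) * of_bool (pairing \<tau> j1 j2 l1 l2))"
proof -
  define A where "A = moment 0 1 0 1"
  define B where "B = moment 0 1 1 0"
  define x :: complex where "x = of_bool (pairing False j1 j2 l1 l2)"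
  define y :: complex where "y = of_bool (pairing True j1 j2 l1 l2)"
  define N :: complex where "N = of_nat n"
  have c: "(\<Sum>i1<n. \<Sum>i2<n. of_bool (i1 = i2)) = N" "(\<Sum>i1<n. \<Sum>i2<n. 1) = N * N"
    by (simp_all add: of_bool_def N_def)
  have "x = (\<Sum>i1<n. \<Sum>i2<n. A + B * of_bool (i1 = i2))"
    unfolding x_def moment_contract(1)[symmetric] A_def B_def
    by (intro sum.cong refl) (subst moment_form; auto simp: pairing_def)
  also have "\<dots> = A * (\<Sum>i1<n. \<Sum>i2<n. 1) + B * (\<Sum>i1<n. \<Sum>i2<n. of_bool (i1 = i2))"
    by (simp only: sum.distrib sum_distrib_left mult_1_right)
  finally have x: "x = A * (N * N) + B * N" unfolding c .
  have "y = (\<Sum>i1<n. \<Sum>i2<n. A * of_bool (i1 = i2) + B)"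
    unfolding y_def moment_contract(2)[symmetric] A_def B_def
    by (intro sum.cong refl) (subst moment_form; auto simp: pairing_def)
  also have "\<dots> = A * (\<Sum>i1<n. \<Sum>i2<n. of_bool (i1 = i2)) + B * (\<Sum>i1<n. \<Sum>i2<n. 1)"
    by (simp only: sum.distrib sum_distrib_left mult_1_right)
  finally have y: "y = A * N + B * (N * N)" unfolding c .
  have "real n * real n \<noteq> 1" "real n \<noteq> 0" using n by (auto simp flip: of_nat_mult)
  then have "complex_of_real (real n * real n) \<noteq> 1" "complex_of_real (real n) \<noteq> 0"
    by (auto simp only: of_real_eq_1_iff of_real_eq_0_iff)
  then have N: "N * N - 1 \<noteq> 0" "N \<noteq> 0" by (auto simp: N_def)
  have w: "complex_of_real (weingarten n True) = 1 / (N * N - 1)"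
    "complex_of_real (weingarten n False) = - 1 / (N * (N * N - 1))"
    by (simp_all add: weingarten_def N_def power2_eq_square)
  have solve: "u = 1 / (N * N - 1) * v + - 1 / (N * (N * N - 1)) * z"
    if "u * (N * (N * N - 1)) = N * v - z" for u v z
  proof -
    have "u = (N * v - z) / (N * (N * N - 1))" using N that by (simp add: nonzero_eq_divide_eq)
    then show ?thesis using N(2) by (simp add: diff_divide_distrib)
  qed
  have "A = 1 / (N * N - 1) * x + - 1 / (N * (N * N - 1)) * y"
    by (rule solve) (simp add: x y algebra_simps)
  then show "moment 0 1 0 1 = (\<Sum>\<tau>\<in>UNIV. weingarten n (False = \<tau>) * of_bool (pairing \<tau> j1 j2 l1 l2))"
    by (simp add: UNIV_bool w A_def x_def y_def del: of_real_minus of_real_divide)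
  have "B = 1 / (N * N - 1) * y + - 1 / (N * (N * N - 1)) * x"
    by (rule solve) (simp add: x y algebra_simps)
  then show "moment 0 1 1 0 = (\<Sum>\<tau>\<in>UNIV. weingarten n (True = \<tau>) * of_bool (pairing \<tau> j1 j2 l1 l2))"
    by (simp add: UNIV_bool w B_def x_def y_def del: of_real_minus of_real_divide)
qed

end

lemma haar_second_moment:
  assumes "i1 < n" "i2 < n" "k1 < n" "k2 < n" "j1 < n" "j2 < n" "l1 < n" "l2 < n"
  shows "(\<integral>W. quartic i1 i2 k1 k2 j1 j2 l1 l2 W \<partial>\<mu>) =
    (\<Sum>\<sigma>\<in>UNIV. \<Sum>\<tau>\<in>UNIV. of_real (weingarten n (\<sigma> = \<tau>)) *
       of_bool (pairing \<sigma> i1 i2 k1 k2) * of_bool (pairing \<tau> j1 j2 l1 l2))"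
  using moment_form[OF assms(5-8) assms(1-4)] moment_coefficients[OF assms(5-8)]
  unfolding moment_def[OF assms(5-8)]
  by (simp add: UNIV_bool algebra_simps)

end

section \<open>Averaging the tensor network\<close>

lemma four_sums:
  fixes f :: "'a \<Rightarrow> 'b :: comm_semiring_1"
  shows "sum f I * sum g J * sum h K * sum k M =
    (\<Sum>(a, b, c, z)\<in>I \<times> J \<times> K \<times> M. f a * g b * h c * k z)"
proof -
  have "sum f I * sum g J * sum h K * sum k M = (\<Sum>a\<in>I. \<Sum>b\<in>J. \<Sum>c\<in>K. \<Sum>z\<in>M. f a * (g b * (h c * k z)))"
    by (simp only: mult.assoc sum_distrib_right) (simp only: sum_distrib_left)
  then show ?thesis by (simp add: sum.cartesian_product mult.assoc)
qed

lemma prod_four_sums_PiE: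
  fixes h :: "'a \<Rightarrow> 'b \<Rightarrow> 'b \<Rightarrow> 'b \<Rightarrow> 'b \<Rightarrow> 'c :: comm_semiring_1"
  assumes "finite S" "finite I"
  shows "(\<Sum>(a, b, c, z)\<in>PiE S (\<lambda>_. I) \<times> PiE S (\<lambda>_. I) \<times> PiE S (\<lambda>_. I) \<times> PiE S (\<lambda>_. I).
      \<Prod>v\<in>S. h v (a v) (b v) (c v) (z v)) = (\<Prod>v\<in>S. \<Sum>(a, b, c, z)\<in>I \<times> I \<times> I \<times> I. h v a b c z)"
  using assms by (simp add: prod_sum_PiE flip: sum.cartesian_product)

lemma prod_two_sums_PiE:
  fixes h :: "'a \<Rightarrow> 'b \<Rightarrow> 'c \<Rightarrow> 'd :: comm_semiring_1"
  assumes "finite S" "finite I" "finite J"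
  shows "(\<Prod>v\<in>S. \<Sum>a\<in>I. \<Sum>b\<in>J. h v a b) =
    (\<Sum>a\<in>PiE S (\<lambda>_. I). \<Sum>b\<in>PiE S (\<lambda>_. J). \<Prod>v\<in>S. h v (a v) (b v))"
  using assms by (simp add: prod_sum_PiE)

lemma sum_of_bool_eq:
  assumes "y < (m :: nat)"
  shows "(\<Sum>x<m. of_bool (y = x) * f x) = (f y :: 'a :: semiring_1)"
    "(\<Sum>x<m. of_bool (x = y) * f x) = (f y :: 'a :: semiring_1)"
  using assms by (simp_all add: of_bool_def if_distrib if_distribR cong: if_cong)

text \<open>The overlap of two pairings on a \<open>D\<close>-dimensional leg: \<open>D\<close> to
  the number of cycles of the product of the two permutations.\<close>

definition bond :: "nat \<Rightarrow> bool \<Rightarrow> bool \<Rightarrow> real" where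
  "bond D s t = (if s = t then real D ^ 2 else real D)"

lemma sum_pairing_pairing:
  "(\<Sum>(a, b, c, z)\<in>{..<m} \<times> {..<m} \<times> {..<m} \<times> {..<m}.
     of_bool (pairing s a b c z) * of_bool (pairing t a b c z) :: complex) = of_real (bond m s t)"
proof -
  have F: "of_bool (pairing False a b c z) = (of_bool (a = c) * of_bool (b = z) :: complex)"
    and T: "of_bool (pairing True a b c z) = (of_bool (b = c) * of_bool (a = z) :: complex)" for a b c z
    by (auto simp: pairing_def)
  have ff: "(\<Sum>a<m. \<Sum>b<m. \<Sum>c<m. \<Sum>z<m. of_bool (a = c) * (of_bool (b = z) * (1 :: complex))) = of_nat m ^ 2"
    by (simp add: sum_of_bool_eq power2_eq_square flip: sum_distrib_left)
  have tt: "(\<Sum>a<m. \<Sum>b<m. \<Sum>c<m. \<Sum>z<m. of_bool (b = c) * (of_bool (a = z) * (1 :: complex))) = of_nat m ^ 2"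
    by (simp add: sum_of_bool_eq power2_eq_square flip: sum_distrib_left)
  have ft: "(\<Sum>a<m. \<Sum>b<m. \<Sum>c<m. \<Sum>z<m. of_bool (a = c) * (of_bool (b = z) * (of_bool (b = c) * (of_bool (a = z) * (1 :: complex))))) = of_nat m"
  proof -
    have "(\<Sum>c<m. \<Sum>z<m. of_bool (a = c) * (of_bool (b = z) * (of_bool (b = c) * (of_bool (a = z) * (1 :: complex))))) =
        of_bool (a = b) * 1" if "a < m" "b < m" for a b
      unfolding sum_distrib_left[symmetric] sum_of_bool_eq(1)[OF that(1)] sum_of_bool_eq(1)[OF that(2)]
      by auto
    then have "(\<Sum>a<m. \<Sum>b<m. \<Sum>c<m. \<Sum>z<m. of_bool (a = c) * (of_bool (b = z) * (of_bool (b = c) * (of_bool (a = z) * (1 :: complex))))) =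
        (\<Sum>a<m. \<Sum>b<m. of_bool (a = b) * 1)"
      by (intro sum.cong refl) auto
    also have "\<dots> = (\<Sum>a<m. 1)"
      by (intro sum.cong refl) (simp only: sum_of_bool_eq lessThan_iff)
    finally show ?thesis by simp
  qed
  show ?thesis
  proof (cases s; cases t)
    assume "s" "t"
    then have "(\<Sum>(a, b, c, z)\<in>{..<m} \<times> {..<m} \<times> {..<m} \<times> {..<m}.
     of_bool (pairing s a b c z) * of_bool (pairing t a b c z) :: complex) =
     (\<Sum>a<m. \<Sum>b<m. \<Sum>c<m. \<Sum>z<m. of_bool (b = c) * (of_bool (a = z) * (1 :: complex)))"
      unfolding sum.cartesian_product[symmetric] by (intro sum.cong refl) (auto simp: pairing_def)
    then show ?thesis using \<open>s\<close> \<open>t\<close> unfolding tt by (simp add: bond_def)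
  next
    assume "\<not> s" "\<not> t"
    then have "(\<Sum>(a, b, c, z)\<in>{..<m} \<times> {..<m} \<times> {..<m} \<times> {..<m}.
     of_bool (pairing s a b c z) * of_bool (pairing t a b c z) :: complex) =
     (\<Sum>a<m. \<Sum>b<m. \<Sum>c<m. \<Sum>z<m. of_bool (a = c) * (of_bool (b = z) * (1 :: complex)))"
      unfolding sum.cartesian_product[symmetric] by (intro sum.cong refl) (auto simp: pairing_def)
    then show ?thesis using \<open>\<not> s\<close> \<open>\<not> t\<close> unfolding ff by (simp add: bond_def)
  next
    assume "s" "\<not> t"
    then have "s = True" "t = False" by simp_all
    then have "(\<Sum>(a, b, c, z)\<in>{..<m} \<times> {..<m} \<times> {..<m} \<times> {..<m}.
     of_bool (pairing s a b c z) * of_bool (pairing t a b c z) :: complex) =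
     (\<Sum>a<m. \<Sum>b<m. \<Sum>c<m. \<Sum>z<m. of_bool (a = c) * (of_bool (b = z) * (of_bool (b = c) * (of_bool (a = z) * (1 :: complex)))))"
      unfolding sum.cartesian_product[symmetric]
      by (intro sum.cong refl) (simp only: F T mult_1_right mult_1_left mult_ac simp_thms)
    then show ?thesis using \<open>s\<close> \<open>\<not> t\<close> unfolding ft by (simp add: bond_def)
  next
    assume "\<not> s" "t"
    then have "s = False" "t = True" by simp_all
    then have "(\<Sum>(a, b, c, z)\<in>{..<m} \<times> {..<m} \<times> {..<m} \<times> {..<m}.
     of_bool (pairing s a b c z) * of_bool (pairing t a b c z) :: complex) =
     (\<Sum>a<m. \<Sum>b<m. \<Sum>c<m. \<Sum>z<m. of_bool (a = c) * (of_bool (b = z) * (of_bool (b = c) * (of_bool (a = z) * (1 :: complex)))))"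
      unfolding sum.cartesian_product[symmetric]
      by (intro sum.cong refl) (simp only: F T mult_1_right mult_1_left mult_ac simp_thms)
    then show ?thesis using \<open>\<not> s\<close> \<open>t\<close> unfolding ft by (simp add: bond_def)
  qed
qed

text \<open>Every bond variable is seen twice, as a row index at its own site and as a column index
  at the preceding one. Transporting the second occurrence along the inverse of \<open>f\<close>
  puts both at the same site, and the sum factorizes.\<close>

lemma bond_sum:
  assumes S: "finite S" and f: "bij_betw f S S"
  shows "(\<Sum>(a1, a2, a3, a4)\<in>configs S D \<times> configs S D \<times> configs S D \<times> configs S D.
      \<Prod>v\<in>S. of_bool (pairing (\<sigma> v) (a1 v) (a2 v) (a3 v) (a4 v)) *
             of_bool (pairing (\<tau> v) (a1 (f v)) (a2 (f v)) (a3 (f v)) (a4 (f v))) :: complex)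
    = (\<Prod>v\<in>S. of_real (bond D (\<sigma> (f v)) (\<tau> v)))"
proof -
  define g where "g = inv_into S f"
  have g: "bij_betw g S S" unfolding g_def using f by (rule bij_betw_inv_into)
  have gf: "g (f v) = v" if "v \<in> S" for v
    unfolding g_def using f that by (simp add: bij_betw_def)
  have "(\<Prod>v\<in>S. of_bool (pairing (\<tau> v) (a1 (f v)) (a2 (f v)) (a3 (f v)) (a4 (f v)))) =
      (\<Prod>v\<in>S. of_bool (pairing (\<tau> (g v)) (a1 v) (a2 v) (a3 v) (a4 v)) :: complex)" for a1 a2 a3 a4
  proof -
    have "(\<Prod>v\<in>S. of_bool (pairing (\<tau> v) (a1 (f v)) (a2 (f v)) (a3 (f v)) (a4 (f v)))) =
      (\<Prod>v\<in>S. of_bool (pairing (\<tau> (g (f v))) (a1 (f v)) (a2 (f v)) (a3 (f v)) (a4 (f v))) :: complex)"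
      by (intro prod.cong refl) (simp add: gf)
    also have "\<dots> = (\<Prod>v\<in>S. of_bool (pairing (\<tau> (g v)) (a1 v) (a2 v) (a3 v) (a4 v)))"
      by (rule prod.reindex_bij_betw[OF f])
    finally show ?thesis .
  qed
  then have "(\<Sum>(a1, a2, a3, a4)\<in>configs S D \<times> configs S D \<times> configs S D \<times> configs S D.
      \<Prod>v\<in>S. of_bool (pairing (\<sigma> v) (a1 v) (a2 v) (a3 v) (a4 v)) *
             of_bool (pairing (\<tau> v) (a1 (f v)) (a2 (f v)) (a3 (f v)) (a4 (f v))) :: complex) =
      (\<Sum>(a1, a2, a3, a4)\<in>configs S D \<times> configs S D \<times> configs S D \<times> configs S D.
      \<Prod>v\<in>S. of_bool (pairing (\<sigma> v) (a1 v) (a2 v) (a3 v) (a4 v)) *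
             of_bool (pairing (\<tau> (g v)) (a1 v) (a2 v) (a3 v) (a4 v)))"
    by (simp add: prod.distrib)
  also have "\<dots> = (\<Prod>v\<in>S. \<Sum>(a, b, c, z)\<in>{..<D} \<times> {..<D} \<times> {..<D} \<times> {..<D}.
      of_bool (pairing (\<sigma> v) a b c z) * of_bool (pairing (\<tau> (g v)) a b c z))"
    unfolding configs_def using S
    by (rule prod_four_sums_PiE[where h = "\<lambda>v a b c z. of_bool (pairing (\<sigma> v) a b c z) * of_bool (pairing (\<tau> (g v)) a b c z)"]) simp
  also have "\<dots> = (\<Prod>v\<in>S. of_real (bond D (\<sigma> v) (\<tau> (g v))))"
    by (simp only: sum_pairing_pairing)
  also have "\<dots> = (\<Prod>v\<in>S. of_real (bond D (\<sigma> (f v)) (\<tau> (g (f v)))))"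
    by (rule prod.reindex_bij_betw[OF f, symmetric])
  finally show ?thesis by (simp add: gf)
qed

lemma tensor_index_eq_iff:
  assumes "\<beta> < D" "\<beta>' < D" "j < d" "j' < d"
  shows "tensor_index D d \<alpha> \<beta> j = tensor_index D d \<alpha>' \<beta>' j' \<longleftrightarrow> \<alpha> = \<alpha>' \<and> \<beta> = \<beta>' \<and> j = j'"
proof
  assume eq: "tensor_index D d \<alpha> \<beta> j = tensor_index D d \<alpha>' \<beta>' j'"
  have "tensor_index D d \<alpha> \<beta> j div d = \<alpha> * D + \<beta>" "tensor_index D d \<alpha> \<beta> j mod d = j"
    "tensor_index D d \<alpha>' \<beta>' j' div d = \<alpha>' * D + \<beta>'" "tensor_index D d \<alpha>' \<beta>' j' mod d = j'"
    using assms by (simp_all add: tensor_index_def)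
  with eq have 1: "\<alpha> * D + \<beta> = \<alpha>' * D + \<beta>'" "j = j'" by metis+
  have "(\<alpha> * D + \<beta>) div D = \<alpha>" "(\<alpha> * D + \<beta>) mod D = \<beta>"
    "(\<alpha>' * D + \<beta>') div D = \<alpha>'" "(\<alpha>' * D + \<beta>') mod D = \<beta>'"
    using assms by simp_all
  with 1 show "\<alpha> = \<alpha>' \<and> \<beta> = \<beta>' \<and> j = j'" by metis
qed simp

lemma tensor_index_less:
  assumes "\<alpha> < D" "\<beta> < D" "j < d"
  shows "tensor_index D d \<alpha> \<beta> j < D\<^sup>2 * d"
proof -
  have "\<alpha> * D + \<beta> < D * D"
  proof -
    have "Suc \<alpha> * D \<le> D * D" using assms by (intro mult_right_mono) auto
    then show ?thesis using assms by simp
  qed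
  then have "Suc (\<alpha> * D + \<beta>) * d \<le> D * D * d" by (intro mult_right_mono) auto
  then show ?thesis using assms by (simp add: tensor_index_def power2_eq_square)
qed

lemma pairing_tensor_index:
  assumes "\<beta>1 < D" "\<beta>2 < D" "\<beta>3 < D" "\<beta>4 < D" "k1 < d" "k2 < d" "k3 < d" "k4 < d"
  shows "pairing \<sigma> (tensor_index D d \<alpha>1 \<beta>1 k1) (tensor_index D d \<alpha>2 \<beta>2 k2)
      (tensor_index D d \<alpha>3 \<beta>3 k3) (tensor_index D d \<alpha>4 \<beta>4 k4) \<longleftrightarrow>
    pairing \<sigma> \<alpha>1 \<alpha>2 \<alpha>3 \<alpha>4 \<and> pairing \<sigma> \<beta>1 \<beta>2 \<beta>3 \<beta>4 \<and> pairing \<sigma> k1 k2 k3 k4"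
  using assms by (auto simp: pairing_def tensor_index_eq_iff)

section \<open>Mean of a site tensor and of the whole network\<close>

locale network = haar "D\<^sup>2 * d" \<mu> for D d :: nat and \<mu> +
  fixes e :: "complex Matrix.vec"
  assumes D: "1 \<le> D" and d: "1 \<le> d" and e: "e \<in> carrier_vec d" "e \<bullet>c e = 1"
begin

abbreviation "T \<equiv> site_tensor D d e"
abbreviation "wg \<equiv> weingarten (D\<^sup>2 * d)"

lemma e_norm: "(\<Sum>k<d. e $ k * cnj (e $ k)) = 1"
  using e by (simp add: scalar_prod_def atLeast0LessThan)

text \<open>Either pairing gives the fourth power of the norm of \<open>e\<close>, so the averages
  do not depend on the reference vector.\<close>

lemma reference_sum:
  "(\<Sum>(k1, k2, k3, k4)\<in>{..<d} \<times> {..<d} \<times> {..<d} \<times> {..<d}.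
     cnj (e $ k1) * cnj (e $ k2) * e $ k3 * e $ k4 * of_bool (pairing \<sigma> k1 k2 k3 k4)) = 1"
proof (cases \<sigma>)
  case True
  have "(\<Sum>(k1, k2, k3, k4)\<in>{..<d} \<times> {..<d} \<times> {..<d} \<times> {..<d}.
     cnj (e $ k1) * cnj (e $ k2) * e $ k3 * e $ k4 * of_bool (pairing \<sigma> k1 k2 k3 k4)) =
    (\<Sum>k1<d. \<Sum>k2<d. \<Sum>k3<d. \<Sum>k4<d. of_bool (k2 = k3) * (of_bool (k1 = k4) *
      (cnj (e $ k1) * cnj (e $ k2) * e $ k3 * e $ k4)))"
    unfolding sum.cartesian_product[symmetric] using True
    by (intro sum.cong refl) (auto simp: pairing_def)
  also have "\<dots> = (\<Sum>k1<d. \<Sum>k2<d. cnj (e $ k1) * cnj (e $ k2) * e $ k2 * e $ k1)"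
    by (simp add: sum_of_bool_eq flip: sum_distrib_left)
  also have "\<dots> = (\<Sum>k1<d. e $ k1 * cnj (e $ k1)) * (\<Sum>k2<d. e $ k2 * cnj (e $ k2))"
    unfolding sum_product by (intro sum.cong refl) (simp add: mult_ac)
  finally show ?thesis unfolding e_norm by simp
next
  case False
  have "(\<Sum>(k1, k2, k3, k4)\<in>{..<d} \<times> {..<d} \<times> {..<d} \<times> {..<d}.
     cnj (e $ k1) * cnj (e $ k2) * e $ k3 * e $ k4 * of_bool (pairing \<sigma> k1 k2 k3 k4)) =
    (\<Sum>k1<d. \<Sum>k2<d. \<Sum>k3<d. \<Sum>k4<d. of_bool (k1 = k3) * (of_bool (k2 = k4) *
      (cnj (e $ k1) * cnj (e $ k2) * e $ k3 * e $ k4)))"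
    unfolding sum.cartesian_product[symmetric] using False
    by (intro sum.cong refl) (auto simp: pairing_def)
  also have "\<dots> = (\<Sum>k1<d. \<Sum>k2<d. cnj (e $ k1) * cnj (e $ k2) * e $ k1 * e $ k2)"
    by (simp add: sum_of_bool_eq flip: sum_distrib_left)
  also have "\<dots> = (\<Sum>k1<d. e $ k1 * cnj (e $ k1)) * (\<Sum>k2<d. e $ k2 * cnj (e $ k2))"
    unfolding sum_product by (intro sum.cong refl) (simp add: mult_ac)
  finally show ?thesis unfolding e_norm by simp
qed

text \<open>Pairings of composite indices factor over the three tensor components.
  \<open>\<sigma>\<close> belongs to the rows \<alpha>, \<beta> and the reference vector,
  \<open>\<tau>\<close> to the columns \<gamma>, \<lambda> and the physical index.\<close>

lemma site_moment:
  assumes "\<alpha>1 < D" "\<alpha>2 < D" "\<alpha>3 < D" "\<alpha>4 < D" and \<beta>: "\<beta>1 < D" "\<beta>2 < D" "\<beta>3 < D" "\<beta>4 < D"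
    and "\<gamma>1 < D" "\<gamma>2 < D" "\<gamma>3 < D" "\<gamma>4 < D" and l: "l1 < D" "l2 < D" "l3 < D" "l4 < D"
    and j: "j1 < d" "j2 < d" "j3 < d" "j4 < d"
  defines "f \<equiv> \<lambda>W. T W \<alpha>1 \<beta>1 \<gamma>1 l1 j1 * T W \<alpha>2 \<beta>2 \<gamma>2 l2 j2 * cnj (T W \<alpha>3 \<beta>3 \<gamma>3 l3 j3) * cnj (T W \<alpha>4 \<beta>4 \<gamma>4 l4 j4)"
  shows "integrable \<mu> f"
    and "(\<integral>W. f W \<partial>\<mu>) = (\<Sum>\<sigma>\<in>UNIV. \<Sum>\<tau>\<in>UNIV. of_real (wg (\<sigma> = \<tau>)) *
        (of_bool (pairing \<sigma> \<alpha>1 \<alpha>2 \<alpha>3 \<alpha>4) * of_bool (pairing \<tau> \<gamma>1 \<gamma>2 \<gamma>3 \<gamma>4)) *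
        (of_bool (pairing \<sigma> \<beta>1 \<beta>2 \<beta>3 \<beta>4) * of_bool (pairing \<tau> l1 l2 l3 l4)) *
        of_bool (pairing \<tau> j1 j2 j3 j4))"
proof -
  let ?K = "{..<d} \<times> {..<d} \<times> {..<d} \<times> {..<d}"
  define c where "c k1 k2 k3 k4 = cnj (e $ k1) * cnj (e $ k2) * e $ k3 * e $ k4" for k1 k2 k3 k4
  define Q where "Q k1 k2 k3 k4 = quartic (tensor_index D d \<alpha>1 \<beta>1 k1) (tensor_index D d \<alpha>2 \<beta>2 k2)
      (tensor_index D d \<alpha>3 \<beta>3 k3) (tensor_index D d \<alpha>4 \<beta>4 k4)
      (tensor_index D d \<gamma>1 l1 j1) (tensor_index D d \<gamma>2 l2 j2)
      (tensor_index D d \<gamma>3 l3 j3) (tensor_index D d \<gamma>4 l4 j4)" for k1 k2 k3 k4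
  have f: "f W = (\<Sum>(k1, k2, k3, k4)\<in>?K. c k1 k2 k3 k4 * Q k1 k2 k3 k4 W)" for W
    unfolding f_def site_tensor_def cnj_sum four_sums
    by (intro sum.cong refl) (auto simp: c_def Q_def quartic_def mult_ac)
  have int: "integrable \<mu> (\<lambda>W. c k1 k2 k3 k4 * Q k1 k2 k3 k4 W)" if "k1 < d" "k2 < d" "k3 < d" "k4 < d" for k1 k2 k3 k4
    unfolding Q_def using that assms(1-20)
    by (intro integrable_mult_right integrable_quartic tensor_index_less)
  show "integrable \<mu> f"
    unfolding f using int by (auto intro!: Bochner_Integration.integrable_sum)
  define R where "R \<sigma> \<tau> = of_real (wg (\<sigma> = \<tau>)) *
        (of_bool (pairing \<sigma> \<alpha>1 \<alpha>2 \<alpha>3 \<alpha>4) * of_bool (pairing \<tau> \<gamma>1 \<gamma>2 \<gamma>3 \<gamma>4)) *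
        (of_bool (pairing \<sigma> \<beta>1 \<beta>2 \<beta>3 \<beta>4) * of_bool (pairing \<tau> l1 l2 l3 l4)) *
        (of_bool (pairing \<tau> j1 j2 j3 j4) :: complex)" for \<sigma> \<tau>
  have Q: "(\<integral>W. Q k1 k2 k3 k4 W \<partial>\<mu>) = (\<Sum>\<sigma>\<in>UNIV. \<Sum>\<tau>\<in>UNIV. R \<sigma> \<tau> * of_bool (pairing \<sigma> k1 k2 k3 k4))"
    if k: "k1 < d" "k2 < d" "k3 < d" "k4 < d" for k1 k2 k3 k4
  proof -
    have "(\<integral>W. Q k1 k2 k3 k4 W \<partial>\<mu>) = (\<Sum>\<sigma>\<in>UNIV. \<Sum>\<tau>\<in>UNIV. of_real (wg (\<sigma> = \<tau>)) *
       of_bool (pairing \<sigma> (tensor_index D d \<alpha>1 \<beta>1 k1) (tensor_index D d \<alpha>2 \<beta>2 k2)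
          (tensor_index D d \<alpha>3 \<beta>3 k3) (tensor_index D d \<alpha>4 \<beta>4 k4)) *
       of_bool (pairing \<tau> (tensor_index D d \<gamma>1 l1 j1) (tensor_index D d \<gamma>2 l2 j2)
          (tensor_index D d \<gamma>3 l3 j3) (tensor_index D d \<gamma>4 l4 j4)))"
      unfolding Q_def using k assms(1-20) by (intro haar_second_moment tensor_index_less)
    also have "\<dots> = (\<Sum>\<sigma>\<in>UNIV. \<Sum>\<tau>\<in>UNIV. R \<sigma> \<tau> * of_bool (pairing \<sigma> k1 k2 k3 k4))"
      unfolding pairing_tensor_index[OF \<beta> k] pairing_tensor_index[OF l j] R_def
      by (intro sum.cong refl) auto
    finally show ?thesis .
  qed
  have "(\<integral>W. f W \<partial>\<mu>) = (\<Sum>(k1, k2, k3, k4)\<in>?K. c k1 k2 k3 k4 * (\<integral>W. Q k1 k2 k3 k4 W \<partial>\<mu>))"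
    unfolding f using int
    by (subst Bochner_Integration.integral_sum) (auto intro!: sum.cong)
  also have "\<dots> = (\<Sum>k\<in>?K. \<Sum>\<sigma>\<in>UNIV. \<Sum>\<tau>\<in>UNIV. case k of (k1, k2, k3, k4) \<Rightarrow> R \<sigma> \<tau> * (c k1 k2 k3 k4 * of_bool (pairing \<sigma> k1 k2 k3 k4)))"
  proof (rule sum.cong[OF refl], goal_cases)
    case (1 k)
    then obtain k1 k2 k3 k4 where k: "k = (k1, k2, k3, k4)" "k1 < d" "k2 < d" "k3 < d" "k4 < d"
      by auto
    show ?case
      unfolding k(1) prod.case Q[OF k(2-5)] sum_distrib_left
      by (intro sum.cong refl) (simp only: mult_ac)
  qed
  also have "\<dots> = (\<Sum>\<sigma>\<in>UNIV. \<Sum>k\<in>?K. \<Sum>\<tau>\<in>UNIV. case k of (k1, k2, k3, k4) \<Rightarrow> R \<sigma> \<tau> * (c k1 k2 k3 k4 * of_bool (pairing \<sigma> k1 k2 k3 k4)))"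
    by (rule sum.swap)
  also have "\<dots> = (\<Sum>\<sigma>\<in>UNIV. \<Sum>\<tau>\<in>UNIV. \<Sum>k\<in>?K. case k of (k1, k2, k3, k4) \<Rightarrow> R \<sigma> \<tau> * (c k1 k2 k3 k4 * of_bool (pairing \<sigma> k1 k2 k3 k4)))"
    by (intro sum.cong refl sum.swap)
  also have "\<dots> = (\<Sum>\<sigma>\<in>UNIV. \<Sum>\<tau>\<in>UNIV. R \<sigma> \<tau> * (\<Sum>(k1, k2, k3, k4)\<in>?K. c k1 k2 k3 k4 * of_bool (pairing \<sigma> k1 k2 k3 k4)))"
    unfolding sum_distrib_left by (intro sum.cong refl) auto
  also have "\<dots> = (\<Sum>\<sigma>\<in>UNIV. \<Sum>\<tau>\<in>UNIV. R \<sigma> \<tau>)"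
    unfolding c_def reference_sum by simp
  finally show "(\<integral>W. f W \<partial>\<mu>) = (\<Sum>\<sigma>\<in>UNIV. \<Sum>\<tau>\<in>UNIV. of_real (wg (\<sigma> = \<tau>)) *
        (of_bool (pairing \<sigma> \<alpha>1 \<alpha>2 \<alpha>3 \<alpha>4) * of_bool (pairing \<tau> \<gamma>1 \<gamma>2 \<gamma>3 \<gamma>4)) *
        (of_bool (pairing \<sigma> \<beta>1 \<beta>2 \<beta>3 \<beta>4) * of_bool (pairing \<tau> l1 l2 l3 l4)) *
        of_bool (pairing \<tau> j1 j2 j3 j4))"
    unfolding R_def .
qed

definition network_term ::
  "nat \<Rightarrow> (site \<Rightarrow> nat) \<Rightarrow> (site \<Rightarrow> nat) \<times> (site \<Rightarrow> nat) \<Rightarrow> site \<Rightarrow> complex mat \<Rightarrow> complex" where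
  "network_term L j p v W =
     T W (fst p v) (snd p v) (fst p (up L v)) (snd p (rt L v)) (j v)"

lemma amplitude_eq:
  "amplitude L D d e U j =
    (\<Sum>p\<in>configs (sites L) D \<times> configs (sites L) D. \<Prod>v\<in>sites L. network_term L j p v (U v))"
  unfolding amplitude_def sum.cartesian_product
  by (intro sum.cong refl) (auto simp: network_term_def up_def rt_def intro!: prod.cong)

definition amplitude4 where
  "amplitude4 L j1 j2 j3 j4 U = amplitude L D d e U j1 * amplitude L D d e U j2 *
     cnj (amplitude L D d e U j3) * cnj (amplitude L D d e U j4)"

abbreviation "haar_product L \<equiv> \<Pi>\<^sub>M v\<in>sites L. \<mu>"

text \<open>Independence turns the integral into a product over sites. Once \<open>\<sigma>\<close>
  and \<open>\<tau>\<close> are fixed at all sites, vertical and horizontal bonds decouple and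
  \<open>bond_sum\<close> applies to each kind.\<close>

lemma amplitude4_moment:
  assumes j: "\<And>v. v \<in> sites L \<Longrightarrow> j1 v < d" "\<And>v. v \<in> sites L \<Longrightarrow> j2 v < d"
    "\<And>v. v \<in> sites L \<Longrightarrow> j3 v < d" "\<And>v. v \<in> sites L \<Longrightarrow> j4 v < d"
  shows "integrable (haar_product L) (amplitude4 L j1 j2 j3 j4)"
    and "(\<integral>U. amplitude4 L j1 j2 j3 j4 U \<partial>haar_product L) =
      (\<Sum>\<sigma>\<in>PiE (sites L) (\<lambda>_. UNIV). \<Sum>\<tau>\<in>PiE (sites L) (\<lambda>_. UNIV). \<Prod>v\<in>sites L.
         of_real (wg (\<sigma> v = \<tau> v) * bond D (\<sigma> (up L v)) (\<tau> v) * bond D (\<sigma> (rt L v)) (\<tau> v)) *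
         of_bool (pairing (\<tau> v) (j1 v) (j2 v) (j3 v) (j4 v)))"
proof -
  interpret product_sigma_finite "\<lambda>_ :: site. \<mu>" ..
  let ?S = "sites L" and ?C = "configs (sites L) D"
  let ?P = "(?C \<times> ?C) \<times> (?C \<times> ?C) \<times> (?C \<times> ?C) \<times> (?C \<times> ?C)"
  let ?B = "PiE (sites L) (\<lambda>_. UNIV :: bool set)"
  have finC: "finite ?C" unfolding configs_def by (intro finite_PiE) auto
  define q where "q p1 p2 p3 p4 v W = network_term L j1 p1 v W * network_term L j2 p2 v W *
    cnj (network_term L j3 p3 v W) * cnj (network_term L j4 p4 v W)" for p1 p2 p3 p4 v W
  have amp: "amplitude4 L j1 j2 j3 j4 U = (\<Sum>(p1, p2, p3, p4)\<in>?P. \<Prod>v\<in>?S. q p1 p2 p3 p4 v (U v))" for U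
    unfolding amplitude4_def amplitude_eq cnj_sum four_sums
    by (intro sum.cong refl) (auto simp: q_def prod.distrib)
  have C: "a v < D" if "a \<in> ?C" "v \<in> ?S" for a v
    using that by (auto simp: configs_def PiE_def)
  define M where "M a1 a2 a3 a4 b1 b2 b3 b4 v \<sigma> \<tau> =
        complex_of_real (wg (\<sigma> = \<tau>)) *
        (of_bool (pairing \<sigma> (a1 v) (a2 v) (a3 v) (a4 v)) *
         of_bool (pairing \<tau> (a1 (up L v)) (a2 (up L v)) (a3 (up L v)) (a4 (up L v)))) *
        (of_bool (pairing \<sigma> (b1 v) (b2 v) (b3 v) (b4 v)) *
         of_bool (pairing \<tau> (b1 (rt L v)) (b2 (rt L v)) (b3 (rt L v)) (b4 (rt L v)))) *
        of_bool (pairing \<tau> (j1 v) (j2 v) (j3 v) (j4 v))"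
    for a1 a2 a3 a4 b1 b2 b3 b4 :: "site \<Rightarrow> nat" and v \<sigma> \<tau>
  have q: "integrable \<mu> (q (a1, b1) (a2, b2) (a3, b3) (a4, b4) v)"
    "(\<integral>W. q (a1, b1) (a2, b2) (a3, b3) (a4, b4) v W \<partial>\<mu>) =
      (\<Sum>\<sigma>\<in>UNIV. \<Sum>\<tau>\<in>UNIV. M a1 a2 a3 a4 b1 b2 b3 b4 v \<sigma> \<tau>)"
    if "a1 \<in> ?C" "a2 \<in> ?C" "a3 \<in> ?C" "a4 \<in> ?C" "b1 \<in> ?C" "b2 \<in> ?C" "b3 \<in> ?C" "b4 \<in> ?C" "v \<in> ?S"
    for a1 a2 a3 a4 b1 b2 b3 b4 v
    unfolding q_def network_term_def fst_conv snd_conv M_def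
    by (rule site_moment; use that C j in simp)+
  have int: "integrable (haar_product L) (\<lambda>U. \<Prod>v\<in>?S. q p1 p2 p3 p4 v (U v))"
    if "p1 \<in> ?C \<times> ?C" "p2 \<in> ?C \<times> ?C" "p3 \<in> ?C \<times> ?C" "p4 \<in> ?C \<times> ?C" for p1 p2 p3 p4
    using that q(1) by (intro product_integrable_prod) auto
  show "integrable (haar_product L) (amplitude4 L j1 j2 j3 j4)"
    unfolding amp using int by (auto intro!: Bochner_Integration.integrable_sum)
  have "(\<integral>U. amplitude4 L j1 j2 j3 j4 U \<partial>haar_product L) =
      (\<Sum>(p1, p2, p3, p4)\<in>?P. \<integral>U. (\<Prod>v\<in>?S. q p1 p2 p3 p4 v (U v)) \<partial>haar_product L)"
    unfolding amp using int
    by (subst Bochner_Integration.integral_sum) (auto intro!: sum.cong)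
  also have "\<dots> = (\<Sum>((a1, b1), (a2, b2), (a3, b3), (a4, b4))\<in>?P.
      \<Prod>v\<in>?S. \<Sum>\<sigma>\<in>UNIV. \<Sum>\<tau>\<in>UNIV. M a1 a2 a3 a4 b1 b2 b3 b4 v \<sigma> \<tau>)"
  proof (rule sum.cong[OF refl], goal_cases)
    case (1 p)
    then obtain a1 b1 a2 b2 a3 b3 a4 b4 where p: "p = ((a1, b1), (a2, b2), (a3, b3), (a4, b4))"
      "a1 \<in> ?C" "a2 \<in> ?C" "a3 \<in> ?C" "a4 \<in> ?C" "b1 \<in> ?C" "b2 \<in> ?C" "b3 \<in> ?C" "b4 \<in> ?C" by blast
    have "(\<integral>U. (\<Prod>v\<in>?S. q (a1, b1) (a2, b2) (a3, b3) (a4, b4) v (U v)) \<partial>haar_product L) =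
      (\<Prod>v\<in>?S. \<integral>W. q (a1, b1) (a2, b2) (a3, b3) (a4, b4) v W \<partial>\<mu>)"
      using q(1)[OF p(2-9)] by (intro product_integral_prod) auto
    also have "\<dots> = (\<Prod>v\<in>?S. \<Sum>\<sigma>\<in>UNIV. \<Sum>\<tau>\<in>UNIV. M a1 a2 a3 a4 b1 b2 b3 b4 v \<sigma> \<tau>)"
      using q(2)[OF p(2-9)] by (intro prod.cong refl) auto
    finally show ?case unfolding p(1) prod.case .
  qed
  \<comment> \<open>Regrouping: from four copies of a pair of bond configurations to four vertical
    and four horizontal ones.\<close>
  also have "\<dots> = (\<Sum>((a1, a2, a3, a4), (b1, b2, b3, b4))\<in>(?C \<times> ?C \<times> ?C \<times> ?C) \<times> (?C \<times> ?C \<times> ?C \<times> ?C).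
      \<Prod>v\<in>?S. \<Sum>\<sigma>\<in>UNIV. \<Sum>\<tau>\<in>UNIV. M a1 a2 a3 a4 b1 b2 b3 b4 v \<sigma> \<tau>)"
    by (rule sum.reindex_bij_witness[where
          i = "\<lambda>((a1, a2, a3, a4), (b1, b2, b3, b4)). ((a1, b1), (a2, b2), (a3, b3), (a4, b4))" and
          j = "\<lambda>((a1, b1), (a2, b2), (a3, b3), (a4, b4)). ((a1, a2, a3, a4), (b1, b2, b3, b4))"]) auto
  also have "\<dots> = (\<Sum>((a1, a2, a3, a4), (b1, b2, b3, b4))\<in>(?C \<times> ?C \<times> ?C \<times> ?C) \<times> (?C \<times> ?C \<times> ?C \<times> ?C).
      \<Sum>\<sigma>\<in>?B. \<Sum>\<tau>\<in>?B. \<Prod>v\<in>?S. M a1 a2 a3 a4 b1 b2 b3 b4 v (\<sigma> v) (\<tau> v))"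
    by (intro sum.cong refl) (auto simp: prod_two_sums_PiE)
  also have "\<dots> = (\<Sum>x\<in>(?C \<times> ?C \<times> ?C \<times> ?C) \<times> (?C \<times> ?C \<times> ?C \<times> ?C). \<Sum>\<sigma>\<in>?B. \<Sum>\<tau>\<in>?B.
      case x of ((a1, a2, a3, a4), (b1, b2, b3, b4)) \<Rightarrow> \<Prod>v\<in>?S. M a1 a2 a3 a4 b1 b2 b3 b4 v (\<sigma> v) (\<tau> v))"
    by (intro sum.cong refl) (auto split: prod.splits)
  also have "\<dots> = (\<Sum>\<sigma>\<in>?B. \<Sum>x\<in>(?C \<times> ?C \<times> ?C \<times> ?C) \<times> (?C \<times> ?C \<times> ?C \<times> ?C). \<Sum>\<tau>\<in>?B.
      case x of ((a1, a2, a3, a4), (b1, b2, b3, b4)) \<Rightarrow> \<Prod>v\<in>?S. M a1 a2 a3 a4 b1 b2 b3 b4 v (\<sigma> v) (\<tau> v))"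
    by (rule sum.swap)
  also have "\<dots> = (\<Sum>\<sigma>\<in>?B. \<Sum>\<tau>\<in>?B. \<Sum>x\<in>(?C \<times> ?C \<times> ?C \<times> ?C) \<times> (?C \<times> ?C \<times> ?C \<times> ?C).
      case x of ((a1, a2, a3, a4), (b1, b2, b3, b4)) \<Rightarrow> \<Prod>v\<in>?S. M a1 a2 a3 a4 b1 b2 b3 b4 v (\<sigma> v) (\<tau> v))"
    by (intro sum.cong refl sum.swap)
  also have "\<dots> = (\<Sum>\<sigma>\<in>?B. \<Sum>\<tau>\<in>?B. \<Prod>v\<in>sites L.
         of_real (wg (\<sigma> v = \<tau> v) * bond D (\<sigma> (up L v)) (\<tau> v) * bond D (\<sigma> (rt L v)) (\<tau> v)) *
         of_bool (pairing (\<tau> v) (j1 v) (j2 v) (j3 v) (j4 v)))"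
  proof (intro sum.cong refl)
    fix \<sigma> \<tau> :: "site \<Rightarrow> bool"
    define c where "c = (\<Prod>v\<in>?S. complex_of_real (wg (\<sigma> v = \<tau> v)) * of_bool (pairing (\<tau> v) (j1 v) (j2 v) (j3 v) (j4 v)))"
    define F where "F f = (\<lambda>(a1, a2, a3, a4). \<Prod>v\<in>?S. of_bool (pairing (\<sigma> v) (a1 v) (a2 v) (a3 v) (a4 v)) *
             of_bool (pairing (\<tau> v) (a1 (f v)) (a2 (f v)) (a3 (f v)) (a4 (f v))) :: complex)"
      for f :: "site \<Rightarrow> site"
    have "(\<Sum>x\<in>(?C \<times> ?C \<times> ?C \<times> ?C) \<times> (?C \<times> ?C \<times> ?C \<times> ?C).
      case x of ((a1, a2, a3, a4), (b1, b2, b3, b4)) \<Rightarrow> \<Prod>v\<in>?S. M a1 a2 a3 a4 b1 b2 b3 b4 v (\<sigma> v) (\<tau> v)) =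
      (\<Sum>(a, b)\<in>(?C \<times> ?C \<times> ?C \<times> ?C) \<times> (?C \<times> ?C \<times> ?C \<times> ?C). c * (F (up L) a * F (rt L) b))"
      by (intro sum.cong refl) (auto simp: M_def F_def c_def prod.distrib mult_ac split: prod.splits)
    also have "\<dots> = c * ((\<Sum>a\<in>?C \<times> ?C \<times> ?C \<times> ?C. F (up L) a) * (\<Sum>b\<in>?C \<times> ?C \<times> ?C \<times> ?C. F (rt L) b))"
    proof -
      have "(\<Sum>(a, b)\<in>(?C \<times> ?C \<times> ?C \<times> ?C) \<times> (?C \<times> ?C \<times> ?C \<times> ?C). c * (F (up L) a * F (rt L) b)) =
        c * (\<Sum>(a, b)\<in>(?C \<times> ?C \<times> ?C \<times> ?C) \<times> (?C \<times> ?C \<times> ?C \<times> ?C). F (up L) a * F (rt L) b)"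
        by (simp only: sum_distrib_left split_def)
      then show ?thesis by (simp only: sum_product sum.cartesian_product)
    qed
    also have "\<dots> = c * ((\<Prod>v\<in>?S. of_real (bond D (\<sigma> (up L v)) (\<tau> v))) * (\<Prod>v\<in>?S. of_real (bond D (\<sigma> (rt L v)) (\<tau> v))))"
      unfolding F_def by (simp only: bond_sum finite_sites bij_up bij_rt)
    also have "\<dots> = (\<Prod>v\<in>sites L.
         of_real (wg (\<sigma> v = \<tau> v) * bond D (\<sigma> (up L v)) (\<tau> v) * bond D (\<sigma> (rt L v)) (\<tau> v)) *
         of_bool (pairing (\<tau> v) (j1 v) (j2 v) (j3 v) (j4 v)))"
      by (simp add: c_def prod.distrib mult_ac)
    finally show "(\<Sum>x\<in>(?C \<times> ?C \<times> ?C \<times> ?C) \<times> (?C \<times> ?C \<times> ?C \<times> ?C).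
      case x of ((a1, a2, a3, a4), (b1, b2, b3, b4)) \<Rightarrow> \<Prod>v\<in>?S. M a1 a2 a3 a4 b1 b2 b3 b4 v (\<sigma> v) (\<tau> v)) =
      (\<Prod>v\<in>sites L.
         of_real (wg (\<sigma> v = \<tau> v) * bond D (\<sigma> (up L v)) (\<tau> v) * bond D (\<sigma> (rt L v)) (\<tau> v)) *
         of_bool (pairing (\<tau> v) (j1 v) (j2 v) (j3 v) (j4 v)))" .
  qed
  finally show "(\<integral>U. amplitude4 L j1 j2 j3 j4 U \<partial>haar_product L) =
      (\<Sum>\<sigma>\<in>?B. \<Sum>\<tau>\<in>?B. \<Prod>v\<in>sites L.
         of_real (wg (\<sigma> v = \<tau> v) * bond D (\<sigma> (up L v)) (\<tau> v) * bond D (\<sigma> (rt L v)) (\<tau> v)) *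
         of_bool (pairing (\<tau> v) (j1 v) (j2 v) (j3 v) (j4 v)))" .
qed

end

section \<open>The averaged purity as a partition function\<close>

lemma sum_PiE_UNIV_eq_Pow:
  fixes F :: "site \<Rightarrow> bool \<Rightarrow> bool \<Rightarrow> bool \<Rightarrow> real"
  shows "(\<Sum>\<sigma>\<in>PiE (sites L) (\<lambda>_. UNIV). \<Prod>v\<in>sites L. F v (\<sigma> v) (\<sigma> (rt L v)) (\<sigma> (up L v))) =
    (\<Sum>X\<in>Pow (sites L). \<Prod>v\<in>sites L. F v (v \<in> X) (rt L v \<in> X) (up L v \<in> X))"
proof (rule sum.reindex_bij_witness[where i = "\<lambda>X. \<lambda>v\<in>sites L. v \<in> X" and j = "\<lambda>\<sigma>. {v\<in>sites L. \<sigma> v}"])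
  show "(\<lambda>v\<in>sites L. v \<in> {v \<in> sites L. \<sigma> v}) = \<sigma>" if "\<sigma> \<in> PiE (sites L) (\<lambda>_. UNIV)" for \<sigma>
    using that by (auto simp: fun_eq_iff PiE_def extensional_def)
qed (auto intro!: prod.cong)

text \<open>\<open>q_kink\<close> and \<open>q_island\<close> are the local weights beside
  \<open>q_area\<close> and \<open>q_perimeter\<close> that remain after summing over
  \<open>\<tau>\<close>. The common denominator is \<open>n\<^sup>2 - 1\<close> for
  \<open>n = D\<^sup>2 * d\<close>, from the Weingarten function.\<close>

definition q_kink :: "nat \<Rightarrow> nat \<Rightarrow> real" where
  "q_kink D d = (real D ^ 3 * real d - real D * real d) / (real D ^ 4 * real d ^ 2 - 1)"

definition q_island :: "nat \<Rightarrow> nat \<Rightarrow> real" where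
  "q_island D d = (real D ^ 2 * real d ^ 2 - real D ^ 2) / (real D ^ 4 * real d ^ 2 - 1)"

abbreviation network_partition_function :: "nat \<Rightarrow> nat \<Rightarrow> nat \<Rightarrow> site set \<Rightarrow> real" where
  "network_partition_function D d \<equiv>
     partition_function (q_area D d) (q_perimeter D d) (q_kink D d) (q_island D d)"

context network
begin

abbreviation "q \<equiv> q_area D d"
abbreviation "p \<equiv> q_perimeter D d"
abbreviation "r \<equiv> q_kink D d"
abbreviation "s \<equiv> q_island D d"

text \<open>Here \<open>x\<close> is the permutation imposed on the physical leg by the region.\<close>

definition leg :: "bool \<Rightarrow> bool \<Rightarrow> real" where
  "leg x t = (if t = x then real d ^ 2 else real d)"

text \<open>If both neighbours agree with the leg, the bond and leg factors multiply to
  \<open>n\<^sup>2\<close> or \<open>n\<close>, the Gram function to which the Weingarten function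
  is inverse. The sum is then 1 or 0; this is the origin of the directed constraint.\<close>

lemma site_sum:
  "(\<Sum>\<tau>\<in>UNIV. wg (\<sigma> = \<tau>) * bond D \<sigma>u \<tau> * bond D \<sigma>r \<tau> * leg x \<tau>) =
    agree_weight q p r s (\<sigma> = x) (\<sigma>r = x) (\<sigma>u = x)"
proof -
  have n2: "2 \<le> D\<^sup>2 * d" by (rule n)
  then have "2 * 2 \<le> (D\<^sup>2 * d) * (D\<^sup>2 * d)" by (intro mult_mono) auto
  then have "real (2 * 2) \<le> real ((D\<^sup>2 * d) * (D\<^sup>2 * d))" by (rule of_nat_mono)
  then have P: "real D ^ 4 * real d ^ 2 - 1 \<noteq> 0"
    by (simp add: power2_eq_square power4_eq_xxxx mult_ac)
  have D0: "real D \<noteq> 0" "real d \<noteq> 0" using D d by auto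
  define Q where "Q = real D ^ 4 * real d ^ 2 - 1"
  have w: "wg True = 1 / Q" "wg False = - 1 / (real D ^ 2 * real d * Q)"
    by (simp_all add: weingarten_def Q_def power_mult_distrib flip: power_mult)
  have Q: "Q \<noteq> 0" using P by (simp add: Q_def)
  have defs: "q = (real D ^ 4 * real d - real d) / Q" "p = (real D ^ 3 * real d ^ 2 - real D) / Q"
    "r = (real D ^ 3 * real d - real D * real d) / Q" "s = (real D ^ 2 * real d ^ 2 - real D ^ 2) / Q"
    by (simp_all add: q_kink_def q_island_def q_area_def q_perimeter_def Q_def)
  have one: "(real D ^ 4 * real d ^ 2 - 1) / Q = 1" using Q by (simp add: Q_def)
  have "1 / Q * real D ^ 2 * real D ^ 2 * real d ^ 2 + - 1 / (real D ^ 2 * real d * Q) * real D * real D * real d = 1"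
    using D0 Q by (subst one[symmetric]) (simp add: field_simps power2_eq_square power4_eq_xxxx)
  moreover have "1 / Q * real D * real D * real d + - 1 / (real D ^ 2 * real d * Q) * real D ^ 2 * real D ^ 2 * real d ^ 2 = 0"
    using D0 Q by (simp add: field_simps power2_eq_square)
  moreover have "1 / Q * real D * real D ^ 2 * real d ^ 2 + - 1 / (real D ^ 2 * real d * Q) * real D ^ 2 * real D * real d = p"
    "1 / Q * real D ^ 2 * real D * real d ^ 2 + - 1 / (real D ^ 2 * real d * Q) * real D * real D ^ 2 * real d = p"
    using D0 Q unfolding defs by (simp_all add: field_simps power2_eq_square power3_eq_cube)
  moreover have "1 / Q * real D * real D ^ 2 * real d + - 1 / (real D ^ 2 * real d * Q) * real D ^ 2 * real D * real d ^ 2 = r"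
    "1 / Q * real D ^ 2 * real D * real d + - 1 / (real D ^ 2 * real d * Q) * real D * real D ^ 2 * real d ^ 2 = r"
    using D0 Q unfolding defs by (simp_all add: field_simps power2_eq_square power3_eq_cube)
  moreover have "1 / Q * real D ^ 2 * real D ^ 2 * real d + - 1 / (real D ^ 2 * real d * Q) * real D * real D * real d ^ 2 = q"
    using D0 Q unfolding defs by (simp add: field_simps power2_eq_square power4_eq_xxxx)
  moreover have "1 / Q * real D * real D * real d ^ 2 + - 1 / (real D ^ 2 * real d * Q) * real D ^ 2 * real D ^ 2 * real d = s"
    using D0 Q unfolding defs by (simp add: field_simps power2_eq_square)
  moreover have U: "(\<Sum>t\<in>UNIV. f t) = f True + f False" for f :: "bool \<Rightarrow> real"
    by (simp add: UNIV_bool)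
  ultimately show ?thesis
    by (cases \<sigma>; cases x; cases \<sigma>r; cases \<sigma>u)
      (simp_all only: U w bond_def leg_def agree_weight_def if_True if_False simp_thms of_bool_eq add.commute)
qed

text \<open>The two conjugated copies carry \<open>s2\<close>, \<open>s1\<close> on \<open>A\<close>
  but \<open>t1\<close>, \<open>t2\<close> off \<open>A\<close>. Summing the physical indices thus
  gives the overlap of \<open>\<tau>\<close> with the swap on \<open>A\<close> and with the identity
  elsewhere.\<close>

lemma leg_sum:
  assumes A: "A \<subseteq> sites L"
  defines "B \<equiv> sites L - A"
  shows "(\<Sum>(s1, s2, t1, t2)\<in>configs A d \<times> configs A d \<times> configs B d \<times> configs B d. \<Prod>v\<in>sites L.
      of_bool (pairing (\<tau> v) (merge A B (s1, t1) v) (merge A B (s2, t2) v)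
        (merge A B (s2, t1) v) (merge A B (s1, t2) v)) :: complex) =
    (\<Prod>v\<in>sites L. of_real (leg (v \<in> A) (\<tau> v)))"
proof -
  have fin: "finite A" "finite B" using A finite_subset[OF A] by (auto simp: B_def)
  have S: "sites L = A \<union> B" and disj: "A \<inter> B = {}" using A by (auto simp: B_def)
  define f :: "(site \<Rightarrow> nat) \<Rightarrow> (site \<Rightarrow> nat) \<Rightarrow> complex" where
    "f s1 s2 = (\<Prod>v\<in>A. of_bool (pairing (\<tau> v) (s1 v) (s2 v) (s2 v) (s1 v)))" for s1 s2
  define g :: "(site \<Rightarrow> nat) \<Rightarrow> (site \<Rightarrow> nat) \<Rightarrow> complex" where
    "g t1 t2 = (\<Prod>v\<in>B. of_bool (pairing (\<tau> v) (t1 v) (t2 v) (t1 v) (t2 v)))" for t1 t2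
  have T: "(\<Sum>a<d. \<Sum>b<d. of_bool (pairing t a b b a) :: complex) = of_real (leg True t)" for t
  proof (cases t)
    case False
    have "(\<Sum>a<d. \<Sum>b<d. of_bool (pairing False a b b a)) = (\<Sum>a<d. \<Sum>b<d. of_bool (a = b) * (1 :: complex))"
      by (intro sum.cong refl) (auto simp: pairing_def)
    then show ?thesis using False by (simp add: leg_def sum_of_bool_eq)
  qed (simp add: pairing_def leg_def power2_eq_square)
  have F: "(\<Sum>a<d. \<Sum>b<d. of_bool (pairing t a b a b) :: complex) = of_real (leg False t)" for t
  proof (cases t)
    case True
    have "(\<Sum>a<d. \<Sum>b<d. of_bool (pairing True a b a b)) = (\<Sum>a<d. \<Sum>b<d. of_bool (a = b) * (1 :: complex))"
      by (intro sum.cong refl) (auto simp: pairing_def)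
    then show ?thesis using True by (simp add: leg_def sum_of_bool_eq)
  qed (simp add: pairing_def leg_def power2_eq_square)
  have "(\<Sum>(s1, s2, t1, t2)\<in>configs A d \<times> configs A d \<times> configs B d \<times> configs B d. \<Prod>v\<in>sites L.
      of_bool (pairing (\<tau> v) (merge A B (s1, t1) v) (merge A B (s2, t2) v)
        (merge A B (s2, t1) v) (merge A B (s1, t2) v)) :: complex) =
    (\<Sum>(s1, s2, t1, t2)\<in>configs A d \<times> configs A d \<times> configs B d \<times> configs B d. f s1 s2 * g t1 t2)"
    unfolding S prod.union_disjoint[OF fin disj] f_def g_def
  proof (rule sum.cong[OF refl], goal_cases)
    case (1 z)
    show ?case using disj by (cases z) (auto intro!: arg_cong2[of _ _ _ _ times] prod.cong)
  qed
  also have "\<dots> = (\<Sum>s1\<in>configs A d. \<Sum>s2\<in>configs A d. f s1 s2) * (\<Sum>t1\<in>configs B d. \<Sum>t2\<in>configs B d. g t1 t2)"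
    by (simp only: sum.cartesian_product [symmetric] sum_distrib_right) (simp only: sum_distrib_left)
  also have "(\<Sum>s1\<in>configs A d. \<Sum>s2\<in>configs A d. f s1 s2) = (\<Prod>v\<in>A. \<Sum>a<d. \<Sum>b<d. of_bool (pairing (\<tau> v) a b b a))"
    unfolding f_def configs_def
    by (rule prod_two_sums_PiE [symmetric, where h = "\<lambda>v a b. of_bool (pairing (\<tau> v) a b b a)"])
      (use fin in auto)
  also have "\<dots> = (\<Prod>v\<in>A. of_real (leg (v \<in> A) (\<tau> v)))"
    unfolding T by (intro prod.cong refl) simp
  also have "(\<Sum>t1\<in>configs B d. \<Sum>t2\<in>configs B d. g t1 t2) = (\<Prod>v\<in>B. \<Sum>a<d. \<Sum>b<d. of_bool (pairing (\<tau> v) a b a b))"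
    unfolding g_def configs_def
    by (rule prod_two_sums_PiE [symmetric, where h = "\<lambda>v a b. of_bool (pairing (\<tau> v) a b a b)"])
      (use fin in auto)
  also have "\<dots> = (\<Prod>v\<in>B. of_real (leg (v \<in> A) (\<tau> v)))"
    unfolding F by (intro prod.cong refl) (auto simp: B_def)
  also have "(\<Prod>v\<in>A. of_real (leg (v \<in> A) (\<tau> v))) * (\<Prod>v\<in>B. complex_of_real (leg (v \<in> A) (\<tau> v))) =
      (\<Prod>v\<in>sites L. of_real (leg (v \<in> A) (\<tau> v)))"
    unfolding S by (rule prod.union_disjoint[OF fin disj, symmetric])
  finally show ?thesis .
qed

lemma purity_eq:
  defines "B A L \<equiv> sites L - A"
  shows "purity L D d e U A =
    Re (\<Sum>(s1, s2, t1, t2)\<in>configs A d \<times> configs A d \<times> configs (B A L) d \<times> configs (B A L) d.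
      amplitude4 L (merge A (B A L) (s1, t1)) (merge A (B A L) (s2, t2))
        (merge A (B A L) (s2, t1)) (merge A (B A L) (s1, t2)) U)"
  unfolding purity_def reduced_density_def amplitude4_def sum_product B_def
  by (simp add: mult_ac flip: sum.cartesian_product)

lemma average_purity_eq:
  assumes A: "A \<subseteq> sites L"
  shows "average_purity \<mu> L D d e A = network_partition_function D d L A"
proof -
  let ?S = "sites L"
  define B where "B = sites L - A"
  let ?C = "configs A d \<times> configs A d \<times> configs B d \<times> configs B d"
  let ?P = "PiE (sites L) (\<lambda>_. UNIV :: bool set)"
  have bound: "merge A B (s1, t1) v < d" if "s1 \<in> configs A d" "t1 \<in> configs B d" "v \<in> ?S" for s1 t1 v
    using that by (cases "v \<in> A") (auto simp: configs_def B_def merge_def dest: PiE_mem)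
  define amp where "amp = (\<lambda>(s1, s2, t1, t2). amplitude4 L (merge A B (s1, t1)) (merge A B (s2, t2))
        (merge A B (s2, t1)) (merge A B (s1, t2)))"
  define h where "h \<sigma> \<tau> v = wg (\<sigma> v = \<tau> v) * bond D (\<sigma> (up L v)) (\<tau> v) * bond D (\<sigma> (rt L v)) (\<tau> v)"
    for \<sigma> \<tau> :: "site \<Rightarrow> bool" and v
  define pr where "pr = (\<lambda>(s1, s2, t1, t2) (\<tau> :: site \<Rightarrow> bool). \<Prod>v\<in>?S.
      of_bool (pairing (\<tau> v) (merge A B (s1, t1) v) (merge A B (s2, t2) v)
        (merge A B (s2, t1) v) (merge A B (s1, t2) v)) :: complex)"
  have int: "integrable (haar_product L) (amp z)" if "z \<in> ?C" for z
    using that bound unfolding amp_def by (auto intro!: amplitude4_moment(1))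
  have mom: "(\<integral>U. amp z U \<partial>haar_product L) = (\<Sum>\<sigma>\<in>?P. \<Sum>\<tau>\<in>?P. (\<Prod>v\<in>?S. of_real (h \<sigma> \<tau> v)) * pr z \<tau>)"
    if "z \<in> ?C" for z
  proof -
    obtain s1 s2 t1 t2 where z: "z = (s1, s2, t1, t2)" "s1 \<in> configs A d" "s2 \<in> configs A d"
      "t1 \<in> configs B d" "t2 \<in> configs B d" using \<open>z \<in> ?C\<close> by auto
    show ?thesis
      unfolding z(1) amp_def pr_def prod.case h_def prod.distrib[symmetric]
      by (rule amplitude4_moment(2)) (use bound z in auto)
  qed
  have "average_purity \<mu> L D d e A = (\<integral>U. Re (\<Sum>z\<in>?C. amp z U) \<partial>haar_product L)"
    unfolding average_purity_def purity_eq B_def amp_def by (simp add: split_def)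
  also have "\<dots> = Re (\<integral>U. (\<Sum>z\<in>?C. amp z U) \<partial>haar_product L)"
    using int by (intro integral_Re Bochner_Integration.integrable_sum)
  also have "(\<integral>U. (\<Sum>z\<in>?C. amp z U) \<partial>haar_product L) = (\<Sum>z\<in>?C. \<Sum>\<sigma>\<in>?P. \<Sum>\<tau>\<in>?P. (\<Prod>v\<in>?S. of_real (h \<sigma> \<tau> v)) * pr z \<tau>)"
    using int mom by (subst Bochner_Integration.integral_sum) auto
  also have "\<dots> = (\<Sum>\<sigma>\<in>?P. \<Sum>z\<in>?C. \<Sum>\<tau>\<in>?P. (\<Prod>v\<in>?S. of_real (h \<sigma> \<tau> v)) * pr z \<tau>)"
    by (rule sum.swap)
  also have "\<dots> = (\<Sum>\<sigma>\<in>?P. \<Sum>\<tau>\<in>?P. \<Sum>z\<in>?C. (\<Prod>v\<in>?S. of_real (h \<sigma> \<tau> v)) * pr z \<tau>)"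
    by (intro sum.cong refl sum.swap)
  also have "\<dots> = (\<Sum>\<sigma>\<in>?P. \<Sum>\<tau>\<in>?P. (\<Prod>v\<in>?S. of_real (h \<sigma> \<tau> v)) * (\<Sum>z\<in>?C. pr z \<tau>))"
    by (simp only: sum_distrib_left)
  also have "\<dots> = (\<Sum>\<sigma>\<in>?P. \<Sum>\<tau>\<in>?P. (\<Prod>v\<in>?S. of_real (h \<sigma> \<tau> v)) * (\<Prod>v\<in>?S. of_real (leg (v \<in> A) (\<tau> v))))"
  proof -
    have "(\<Sum>z\<in>?C. pr z \<tau>) = (\<Prod>v\<in>?S. of_real (leg (v \<in> A) (\<tau> v)))" for \<tau>
      using leg_sum[OF A, of \<tau>] unfolding pr_def B_def by (simp add: split_def)
    then show ?thesis by simp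
  qed
  also have "\<dots> = of_real (\<Sum>\<sigma>\<in>?P. \<Sum>\<tau>\<in>?P. \<Prod>v\<in>?S. h \<sigma> \<tau> v * leg (v \<in> A) (\<tau> v))"
    by (simp add: prod.distrib)
  also have "(\<Sum>\<sigma>\<in>?P. \<Sum>\<tau>\<in>?P. \<Prod>v\<in>?S. h \<sigma> \<tau> v * leg (v \<in> A) (\<tau> v)) =
      (\<Sum>\<sigma>\<in>?P. \<Prod>v\<in>?S. \<Sum>t\<in>UNIV. wg (\<sigma> v = t) * bond D (\<sigma> (up L v)) t * bond D (\<sigma> (rt L v)) t * leg (v \<in> A) t)"
    unfolding h_def by (intro sum.cong refl prod_sum_PiE [symmetric]) auto
  also have "\<dots> = (\<Sum>\<sigma>\<in>?P. \<Prod>v\<in>?S. agree_weight q p r s (\<sigma> v = (v \<in> A)) (\<sigma> (rt L v) = (v \<in> A)) (\<sigma> (up L v) = (v \<in> A)))"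
    by (simp only: site_sum)
  also have "\<dots> = partition_function q p r s L A"
    unfolding partition_function_def config_weight_def
    by (rule sum_PiE_UNIV_eq_Pow[where F = "\<lambda>v x y z. agree_weight q p r s (x = (v \<in> A)) (y = (v \<in> A)) (z = (v \<in> A))"])
  finally show ?thesis by simp
qed

end

section \<open>The network weights satisfy the local inequalities\<close>

text \<open>The bounds amount to p \<le> 1/D, q \<le> 1/d, r/(pq) \<ge> D^2/(D^2 + 1) and s/p^2
  \<ge> 1 - 1/d^2, so that 0.9 and 0.75 are the values at \<open>D = 3\<close> and
  \<open>d = 2\<close>. Most of them rest on \<open>Qx\<close>.\<close>

lemma spin_weights_network:
  assumes D3: "3 \<le> D" and d2: "2 \<le> d"
  shows "spin_weights (q_area D d) (q_perimeter D d) (q_kink D d) (q_island D d)"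
proof -
  define q where "q = q_area D d"
  define p where "p = q_perimeter D d"
  define r where "r = q_kink D d"
  define s where "s = q_island D d"
  define E where "E = real D"
  define f where "f = real d"
  define x where "x = E\<^sup>2"
  define Q where "Q = x\<^sup>2 * f\<^sup>2 - 1"
  have E: "3 \<le> E" and f: "2 \<le> f" using D3 d2 by (auto simp: E_def f_def)
  have x: "9 \<le> x" using power_mono[OF E, of 2] by (simp add: x_def)
  have f4: "4 \<le> f\<^sup>2" using power_mono[OF f, of 2] by simp
  have xf: "36 \<le> x * f\<^sup>2" using mult_mono[OF x f4] x by simp
  have Qx: "x * (x * f\<^sup>2 - 1) \<le> Q" using x by (simp add: Q_def power2_eq_square algebra_simps)
  have "0 < x * (x * f\<^sup>2 - 1)" using x xf by simp
  with Qx have Q: "0 < Q" by linarith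
  have x1: "1 < x\<^sup>2" using x by (simp add: power2_eq_square less_1_mult)
  have defs: "q = f * (x\<^sup>2 - 1) / Q" "p = E * (x * f\<^sup>2 - 1) / Q" "r = E * f * (x - 1) / Q"
    "s = x * (f\<^sup>2 - 1) / Q"
    by (simp_all add: q_def p_def r_def s_def q_kink_def q_island_def q_area_def q_perimeter_def E_def f_def x_def Q_def
        algebra_simps power2_eq_square power3_eq_cube power4_eq_xxxx)
  have "spin_weights q p r s"
  proof
    show p0: "0 < p" unfolding defs using E xf Q by (intro divide_pos_pos mult_pos_pos) auto
    show q0: "0 < q" unfolding defs using f x1 Q by (intro divide_pos_pos mult_pos_pos) auto
    have "3 * (E * (x * f\<^sup>2 - 1)) \<le> E * (E * (x * f\<^sup>2 - 1))"
      using E xf by (intro mult_right_mono mult_nonneg_nonneg) auto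
    also have "\<dots> = x * (x * f\<^sup>2 - 1)" by (simp add: x_def power2_eq_square)
    finally have "3 * (E * (x * f\<^sup>2 - 1)) \<le> Q" using Qx by linarith
    then show "p \<le> 1 / 3" unfolding defs using Q by (simp add: field_simps)
    have "2 * (f * (x\<^sup>2 - 1)) \<le> f * (f * (x\<^sup>2 - 1))"
      using f x1 by (intro mult_right_mono mult_nonneg_nonneg) auto
    also have "\<dots> \<le> Q" using f4 by (simp add: Q_def power2_eq_square algebra_simps)
    finally show "q \<le> 1 / 2" unfolding defs using Q by (simp add: field_simps)
    have pq: "p * q = (E * f * (x - 1)) * ((x * f\<^sup>2 - 1) * (x + 1)) / Q\<^sup>2"
      unfolding defs by (simp add: power2_eq_square algebra_simps)
    have r: "r = (E * f * (x - 1)) * Q / Q\<^sup>2"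
      unfolding defs using Q by (simp add: power2_eq_square)
    have c: "0 \<le> E * f * (x - 1)" using E f x by simp
    have "0 \<le> x * (f\<^sup>2 - 1)" using x f4 by simp
    then have "Q \<le> (x * f\<^sup>2 - 1) * (x + 1)" by (simp add: Q_def power2_eq_square algebra_simps)
    then show "r \<le> p * q"
      unfolding r pq by (intro divide_right_mono mult_left_mono c) auto
    have "0.9 * ((x * f\<^sup>2 - 1) * (x + 1)) = (x * f\<^sup>2 - 1) * (0.9 * (x + 1))"
      by (rule mult.left_commute)
    also have "\<dots> \<le> (x * f\<^sup>2 - 1) * x"
      using x xf by (intro mult_left_mono) auto
    also have "\<dots> = x * (x * f\<^sup>2 - 1)" by (rule mult.commute)
    also note Qx
    finally have "0.9 * ((x * f\<^sup>2 - 1) * (x + 1)) \<le> Q" .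
    then have "(E * f * (x - 1)) * (0.9 * ((x * f\<^sup>2 - 1) * (x + 1))) / Q\<^sup>2 \<le> r"
      unfolding r by (intro divide_right_mono mult_left_mono c) auto
    then show "0.9 * (p * q) \<le> r" unfolding pq by (simp add: mult_ac)
    have p2: "p\<^sup>2 = x * (x * f\<^sup>2 - 1)\<^sup>2 / Q\<^sup>2"
      unfolding defs by (simp add: power_divide power_mult_distrib x_def)
    have s: "s = x * ((f\<^sup>2 - 1) * Q) / Q\<^sup>2"
      unfolding defs using Q by (simp add: power2_eq_square)
    have "(x * f\<^sup>2 - 1)\<^sup>2 - (f\<^sup>2 - 1) * Q = f\<^sup>2 * (x - 1)\<^sup>2"
      by (simp add: Q_def power2_eq_square algebra_simps)
    also have "\<dots> \<ge> 0" by simp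
    finally show "s \<le> p\<^sup>2"
      unfolding s p2 using x by (intro divide_right_mono mult_left_mono) auto
    have "0.75 * (x * f\<^sup>2 - 1)\<^sup>2 \<le> 0.75 * (f\<^sup>2 * Q)"
    proof -
      have "1 * 1 \<le> f\<^sup>2 * (2 * x - 1)" using f4 x by (intro mult_mono) auto
      moreover have "f\<^sup>2 * Q - (x * f\<^sup>2 - 1)\<^sup>2 = f\<^sup>2 * (2 * x - 1) - 1"
        by (simp add: Q_def power2_eq_square algebra_simps)
      ultimately show ?thesis by simp
    qed
    also have "\<dots> = (0.75 * f\<^sup>2) * Q" by simp
    also have "\<dots> \<le> (f\<^sup>2 - 1) * Q" using f4 Q by (intro mult_right_mono) auto
    finally have "x * (0.75 * (x * f\<^sup>2 - 1)\<^sup>2) / Q\<^sup>2 \<le> s"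
      unfolding s using x by (intro divide_right_mono mult_left_mono) auto
    then show "0.75 * p\<^sup>2 \<le> s" unfolding p2 by (simp add: mult_ac)
  qed
  then show ?thesis by (simp only: q_def p_def r_def s_def)
qed

subsection \<open>Translations\<close>

lemma partition_function_translate:
  assumes T: "bij_betw T (sites L) (sites L)"
    and rt: "\<And>v. v \<in> sites L \<Longrightarrow> T (rt L v) = rt L (T v)"
    and up: "\<And>v. v \<in> sites L \<Longrightarrow> T (up L v) = up L (T v)"
    and A: "A \<subseteq> sites L"
  shows "partition_function q p r s L (T ` A) = partition_function q p r s L A"
proof -
  have inj: "inj_on T (sites L)" using T by (simp add: bij_betw_def)
  have mem: "T v \<in> T ` X \<longleftrightarrow> v \<in> X" if "v \<in> sites L" "X \<subseteq> sites L" for v X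
    using inj that by (rule inj_on_image_mem_iff)
  have cw: "config_weight q p r s L (T ` A) (T ` X) = config_weight q p r s L A X" if X: "X \<subseteq> sites L" for X
  proof -
    have "config_weight q p r s L (T ` A) (T ` X) =
      (\<Prod>v\<in>sites L. agree_weight q p r s ((T v \<in> T ` X) = (T v \<in> T ` A)) ((rt L (T v) \<in> T ` X) = (T v \<in> T ` A))
        ((up L (T v) \<in> T ` X) = (T v \<in> T ` A)))"
      unfolding config_weight_def by (rule prod.reindex_bij_betw[OF T, symmetric])
    also have "\<dots> = config_weight q p r s L A X"
      unfolding config_weight_def using X A
      by (intro prod.cong refl) (simp add: mem flip: rt up)
    finally show ?thesis .
  qed
  have "bij_betw ((`) T) (Pow (sites L)) (Pow (sites L))"
    using T by (rule bij_betw_Pow)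
  then have "partition_function q p r s L (T ` A) = (\<Sum>X\<in>Pow (sites L). config_weight q p r s L (T ` A) (T ` X))"
    unfolding partition_function_def by (rule sum.reindex_bij_betw [symmetric])
  also have "\<dots> = partition_function q p r s L A"
    unfolding partition_function_def by (intro sum.cong refl) (simp add: cw)
  finally show ?thesis .
qed

lemma partition_function_block:
  assumes L: "L = m + l + 1" and v: "v \<in> sites L"
  shows "partition_function q p r s L (block L l v) = partition_function q p r s L (square m l)"
proof -
  obtain a b where ab: "v = (a, b)" by force
  \<comment> \<open>Translation by \<open>c - m\<close>, written with \<open>L - m\<close> to stay
    within the naturals; it carries index \<open>m\<close> to \<open>c\<close>.\<close>
  define t where "t c x = (c + (L - m) + x) mod L" for c x :: nat
  have bij: "bij_betw (t c) {..<L} {..<L}" for c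
  proof -
    have "inj_on (t c) {..<L}"
    proof (rule inj_onI)
      have *: "x = y" if "x \<le> y" "y < L" "t c x = t c y" for x y
      proof -
        have "L dvd (c + (L - m) + y) - (c + (L - m) + x)"
          using that by (subst mod_eq_dvd_iff_nat [symmetric]) (auto simp: t_def)
        then have "L dvd y - x" by simp
        then show ?thesis using that by (auto dest: dvd_imp_le)
      qed
      fix x y assume "x \<in> {..<L}" "y \<in> {..<L}" "t c x = t c y"
      then show "x = y" using *[of x y] *[of y x] by (cases "x \<le> y") auto
    qed
    moreover have "t c ` {..<L} \<subseteq> {..<L}" using L by (auto simp: t_def)
    ultimately show ?thesis using endo_inj_surj[of "{..<L}" "t c"] by (auto simp: bij_betw_def)
  qed
  define T where "T = map_prod (t a) (t b)"
  have T: "bij_betw T (sites L) (sites L)"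
    unfolding T_def sites_def by (intro bij_betw_map_prod bij)
  have step: "t c ((x + 1) mod L) = (t c x + 1) mod L" for c x
    unfolding t_def mod_add_right_eq mod_add_left_eq by (simp only: add.assoc)
  have off: "t c (m + x) = (c + x) mod L" for c x
  proof -
    have "c + (L - m) + (m + x) = (c + x) + L" using L by simp
    then show ?thesis unfolding t_def by (simp only: mod_add_self2)
  qed
  have "{m..<m + l} = (\<lambda>x. m + x) ` {..<l}"
    by (simp add: lessThan_atLeast0 add.commute)
  then have sq: "square m l = map_prod (\<lambda>x. m + x) (\<lambda>x. m + x) ` ({..<l} \<times> {..<l})"
    unfolding square_def by (simp add: map_prod_image)
  have "T ` square m l = (\<lambda>z. T (map_prod (\<lambda>x. m + x) (\<lambda>x. m + x) z)) ` ({..<l} \<times> {..<l})"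
    by (simp only: sq image_image)
  also have "\<dots> = block L l v"
    unfolding block_def by (intro image_cong refl) (auto simp: T_def ab off)
  finally have "T ` square m l = block L l v" .
  moreover have "partition_function q p r s L (T ` square m l) = partition_function q p r s L (square m l)"
  proof (rule partition_function_translate[OF T])
    show "T (rt L w) = rt L (T w)" "T (up L w) = up L (T w)" for w
      by (cases w; simp only: T_def rt_def up_def map_prod_simp fst_conv snd_conv step)+
    show "square m l \<subseteq> sites L" using square_subset L by simp
  qed
  ultimately show ?thesis by simp
qed

theorem theorem2:
  shows "\<exists>c::real. \<forall>D d l :: nat. D \<ge> 3 \<longrightarrow> d \<ge> 2 \<longrightarrow> l \<ge> 1 \<longrightarrow>
    (\<forall>\<^sub>F L in sequentially. \<forall>\<mu> (e :: complex Matrix.vec). \<forall>v\<in>sites L.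
       haar_measure (D ^ 2 * d) \<mu> \<longrightarrow> e \<in> carrier_vec d \<longrightarrow> e \<bullet>c e = 1 \<longrightarrow>
       lambda1 D d l * q_area D d ^ (l ^ 2) + lambda2 D d l * q_perimeter D d ^ (4 * l)
         \<le> average_purity \<mu> L D d e (block L l v) \<and>
       average_purity \<mu> L D d e (block L l v)
         \<le> c * (1.91 * q_area D d) ^ (l ^ 2) + c * (2.9 * q_perimeter D d) ^ (4 * l))"
proof (intro exI[of _ 2] allI impI)
  fix D d l :: nat assume D: "3 \<le> D" and d: "2 \<le> d" and l: "1 \<le> l"
  interpret spin_weights "q_area D d" "q_perimeter D d" "q_kink D d" "q_island D d"
    using D d by (rule spin_weights_network)
  have dim: "2 \<le> D\<^sup>2 * d" using D d mult_le_mono[of 1 "D\<^sup>2" 2 d] by simp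
  show "\<forall>\<^sub>F L in sequentially. \<forall>\<mu> (e :: complex Matrix.vec). \<forall>v\<in>sites L.
       haar_measure (D ^ 2 * d) \<mu> \<longrightarrow> e \<in> carrier_vec d \<longrightarrow> e \<bullet>c e = 1 \<longrightarrow>
       lambda1 D d l * q_area D d ^ (l ^ 2) + lambda2 D d l * q_perimeter D d ^ (4 * l)
         \<le> average_purity \<mu> L D d e (block L l v) \<and>
       average_purity \<mu> L D d e (block L l v)
         \<le> 2 * (1.91 * q_area D d) ^ (l ^ 2) + 2 * (2.9 * q_perimeter D d) ^ (4 * l)"
    using eventually_Z_bounds[OF l] eventually_ge_at_top[of "l + 1"]
  proof eventually_elim
    case (elim L)
    show ?case
    proof (intro allI ballI impI)
      fix \<mu> and e :: "complex Matrix.vec" and v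
      assume v: "v \<in> sites L" and \<mu>: "haar_measure (D ^ 2 * d) \<mu>"
        and e: "e \<in> carrier_vec d" "e \<bullet>c e = 1"
      \<comment> \<open>The average purity equals a partition function that depends on neither
        \<open>\<mu>\<close> nor \<open>e\<close>, and not on \<open>v\<close> by translation; hence
        the bound on \<open>L\<close> fixed above serves all of them.\<close>
      interpret network D d \<mu> e
        using \<mu> e dim D d by unfold_locales auto
      have "L = (L - l - 1) + l + 1" using elim by simp
      note partition_function_block[OF this v]
      moreover have "block L l v \<subseteq> sites L" using v by (auto simp: block_def sites_def)
      ultimately have "average_purity \<mu> L D d e (block L l v) = Z L (square (L - l - 1) l)"
        by (simp add: average_purity_eq)
      then show "lambda1 D d l * q_area D d ^ (l ^ 2) + lambda2 D d l * q_perimeter D d ^ (4 * l)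
         \<le> average_purity \<mu> L D d e (block L l v) \<and>
       average_purity \<mu> L D d e (block L l v)
         \<le> 2 * (1.91 * q_area D d) ^ (l ^ 2) + 2 * (2.9 * q_perimeter D d) ^ (4 * l)"
        using elim unfolding lambda1_def lambda2_def by simp
    qed
  qed
qed

end
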